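(* Let $(X,\omega)$ be a stratified symplectic space with a smooth structure $C^\infty(X)$ that is both Poisson and weakly symplectic. If all regular strata of $X$ have the same dimension $2n$, then we have the following Lefschetz decomposition for $k\ge0$: $$\Omega^k(X)=\mathcal P_k(X)\oplus L(\mathcal P_{k-2}(X))\oplus\cdots,$$ where the further summands are $L^r(\mathcal P_{k-2r}(X))$, $r\ge 2$.
   Context: Stratified spaces. A decomposed space is a Hausdorff paracompact finite-dimensional topological space $X$ with a locally finite collection of disjoint locally closed (smooth) manifolds $S_i\subset X$ (strata), indexed by a poset, such that $X=\bigcup_i S_i$ and $S_i\cap\bar S_j\ne\emptyset\Leftrightarrow S_i\subset\bar S_j\Leftrightarrow i\le j$. Its depth is the supremum of $n$ with strata $S_0<\dots<S_n$. A stratum is singular if it is contained in the closure of another stratum, otherwise regular. For a space $L$, $cL=L\times[0,\infty)/L\times\{0\}$ and $cL(1)=\{[z,t]\in cL: t<1\}$. $X$ is a stratified space if (recursively) for each point $x$ in a stratum $S$ there are an open neighborhood $U(x)$ in $X$, an open ball $B_x$ around $x$ in $S$, a compact stratified space $L$ and a homeomorphism $\phi_x:U(x)\to B_x\times cL(1)$ preserving the decompositions. Smooth structures. A subalgebra $C^\infty(X)\subset C^0(X)$ of continuous real functions is a $C^\infty$-ring if $G(f_1,\dots,f_n)\in C^\infty(X)$ for $f_i\in C^\infty(X)$, $G\in C^\infty(\mathbb R^n)$; it is germ-defined if every function locally coinciding with elements of $C^\infty(X)$ belongs to it. The product smooth structure on $Y_1\times Y_2$ consists of functions locally of the form $G(\pi_1^*f_1,\dots,\pi_1^*f_n,\pi_2^*h_1,\dots,\pi_2^*h_k)$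 with $G$ smooth, $f_i,h_j$ smooth on $Y_1,Y_2$. A smooth structure on $X$ is (recursively on depth) an $\mathbb R$-subalgebra $C^\infty(X)\subset C^0(X)$ such that: (1) it is a germ-defined $C^\infty$-ring; (2) for any $x$ there is a trivialization $\phi_x$ with $C^\infty(U(x))=\phi_x^*C^\infty(B_x\times cL(1))$, the latter being the product smooth structure of the usual one on $B_x$ and a smooth structure on $cL(1)$; (3) a smooth structure on the cone over a compact stratified space $L$ (with its smooth structure) satisfies (3a) $C^\infty(cL(1))|_{L\times(0,1)}\subset C^\infty(L\times(0,1))$ (product smooth structure) and (3b) the pullback to $L\times(0,1)$ of any compactly supported smooth function on $(0,1)$, extended by zero, lies in $C^\infty(cL(1))$. Forms. Let $C^\infty_x(X)$ be the algebra of germs of smooth functions at $x$, $\mathfrak m_x$ its maximal ideal of germs vanishing at $x$, $T^*_xX=\mathfrak m_x/\mathfrak m_x^2$, $T^Z_xX=\mathrm{Hom}(T^*_xX,\mathbb R)$, $df(x)$ the class of $f-f(x)$. $\Omega^k(X)$ is the space of sections of $\Lambda^kT^*X$ locally of the form $\sum f_{i_0}df_{i_1}\wedge\dots\wedge df_{i_k}$, $f_{i_j}\in C^\infty(X)$; germs of such forms at $x$ are identified with elements $\sum f_{i_0}\otimes df_{i_1}\wedge\dots\wedge df_{i_k}$ of $C^\infty_x(X)\otimes_{\mathbb R}\Lambda^k(\mathfrak m_x/\mathfrak m_x^2)$. $\Omega(X)=\bigoplus_k\Omega^k(X)$. Restriction to a stratum is the usual form obtained by restricting the functions. Symplectic notions.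 $(X,\omega)$ is a stratified symplectic space if each stratum $S_i$ has a symplectic form $\omega_i$, $\omega=\{\omega_i\}$. $C^\infty(X)$ is weakly symplectic if some $\tilde\omega\in\Omega^2(X)$ restricts to $\omega_i$ on each $S_i$. It is Poisson if there is a Poisson bracket $\{\,,\}_\omega$ on $C^\infty(X)$ with $(\{f,g\}_\omega)|_{S_i}=\{f|_{S_i},g|_{S_i}\}_{\omega_i}$ for each stratum, where $\{f,g\}_{\omega_i}=G_{\omega_i}(df\wedge dg)$, $G_{\omega_i}=\sum_j\partial_{y_j}\wedge\partial_{x_j}$ when $\omega_i=\sum_jdx^j\wedge dy^j$. Equivalently there is a Zariski bivector field $\tilde G_\omega$ (section of $\Lambda^2T^ZX$) with $\tilde G_\omega(df\wedge dg)=\{f,g\}_\omega$. $L:\Omega^k(X)\to\Omega^{k+2}(X)$ is the wedge product with $\tilde\omega$, and $L^*:\Omega^k(X)\to\Omega^{k-2}(X)$ is the contraction $i(\tilde G_\omega)$. A form $\alpha$ is primitive if $L^*\alpha=0$; $\mathcal P_k(X)=\{\alpha\in\Omega^k(X):\alpha\text{ is primitive}\}$. *)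

theory Defs
  imports "HOL-Analysis.Analysis"
begin

section \<open>Smooth functions on open subsets of \<open>R^n\<close>\<close>

text \<open>The dimension varies inside the definitions below, so \<open>R^n\<close> is \<^const>\<open>Euclidean_space\<close>:
  the functions \<open>nat \<Rightarrow> real\<close> vanishing from \<open>n\<close> on, with the product topology.\<close>

definition partial_deriv :: "nat \<Rightarrow> ((nat \<Rightarrow> real) \<Rightarrow> real) \<Rightarrow> (nat \<Rightarrow> real) \<Rightarrow> real" where
  "partial_deriv i f y = deriv (\<lambda>t. f (y(i := t))) (y i)"

primrec C_k_on :: "nat \<Rightarrow> nat \<Rightarrow> (nat \<Rightarrow> real) set \<Rightarrow> ((nat \<Rightarrow> real) \<Rightarrow> real) \<Rightarrow> bool" where
  "C_k_on 0 n W f \<longleftrightarrow> continuous_map (subtopology (Euclidean_space n) W) euclideanreal f"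
| "C_k_on (Suc k) n W f \<longleftrightarrow>
     continuous_map (subtopology (Euclidean_space n) W) euclideanreal f \<and>
     (\<forall>i<n. (\<forall>y\<in>W. (\<lambda>t. f (y(i := t))) differentiable (at (y i))) \<and>
            C_k_on k n W (partial_deriv i f))"

definition smooth_on :: "nat \<Rightarrow> (nat \<Rightarrow> real) set \<Rightarrow> ((nat \<Rightarrow> real) \<Rightarrow> real) \<Rightarrow> bool" where
  "smooth_on n W f \<longleftrightarrow> openin (Euclidean_space n) W \<and> (\<forall>k. C_k_on k n W f)"


section \<open>Smooth manifolds inside a topological space\<close>

record 'a mfd =
  pts :: "'a set"
  dim :: nat
  charts :: "('a set \<times> ('a \<Rightarrow> nat \<Rightarrow> real)) set"

text \<open>Membership in the maximal atlas determined by \<^term>\<open>charts M\<close>.\<close>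

definition is_chart :: "'a topology \<Rightarrow> 'a mfd \<Rightarrow> 'a set \<Rightarrow> ('a \<Rightarrow> nat \<Rightarrow> real) \<Rightarrow> bool" where
  "is_chart T M U \<phi> \<longleftrightarrow>
     openin (subtopology T (pts M)) U \<and>
     openin (Euclidean_space (dim M)) (\<phi> ` U) \<and>
     homeomorphic_map (subtopology T U) (subtopology (Euclidean_space (dim M)) (\<phi> ` U)) \<phi> \<and>
     (\<forall>(V, \<psi>) \<in> charts M. \<forall>i < dim M.
        smooth_on (dim M) (\<phi> ` (U \<inter> V)) (\<lambda>y. \<psi> (inv_into U \<phi> y) i) \<and>
        smooth_on (dim M) (\<psi> ` (U \<inter> V)) (\<lambda>y. \<phi> (inv_into V \<psi> y) i))"

text \<open>Hausdorffness comes from the ambient space. Second countability or paracompactness of \<^term>\<open>M\<close>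
  itself is not demanded, so every usual convention for manifolds is covered.\<close>

definition smooth_manifold :: "'a topology \<Rightarrow> 'a mfd \<Rightarrow> bool" where
  "smooth_manifold T M \<longleftrightarrow>
     pts M \<subseteq> topspace T \<and>
     (\<forall>(U, \<phi>) \<in> charts M. is_chart T M U \<phi>) \<and>
     pts M = (\<Union>(U, \<phi>) \<in> charts M. U)"

definition smooth_map :: "'a mfd \<Rightarrow> 'b mfd \<Rightarrow> ('a \<Rightarrow> 'b) \<Rightarrow> bool" where
  "smooth_map M N h \<longleftrightarrow> h ` pts M \<subseteq> pts N \<and>
     (\<forall>(U, \<phi>) \<in> charts M. \<forall>(V, \<psi>) \<in> charts N. \<forall>i < dim N.
        smooth_on (dim M) (\<phi> ` {x \<in> U. h x \<in> V}) (\<lambda>y. \<psi> (h (inv_into U \<phi> y)) i))"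

definition diffeo :: "'a mfd \<Rightarrow> 'b mfd \<Rightarrow> ('a \<Rightarrow> 'b) \<Rightarrow> bool" where
  "diffeo M N h \<longleftrightarrow> bij_betw h (pts M) (pts N) \<and> smooth_map M N h \<and>
     smooth_map N M (inv_into (pts M) h)"

text \<open>Real functions on a subset of \<^typ>\<open>'a\<close> are total functions \<^typ>\<open>'a \<Rightarrow> real\<close> whose values off
  the subset are immaterial. All function spaces below are closed under changing those values, and
  restricting a function to a smaller set is the identity.\<close>

definition mfd_smooth :: "'a mfd \<Rightarrow> ('a \<Rightarrow> real) set" where
  "mfd_smooth M = {f. \<forall>(U, \<phi>) \<in> charts M. smooth_on (dim M) (\<phi> ` U) (\<lambda>y. f (inv_into U \<phi> y))}"

definition mfd_restrict :: "'a mfd \<Rightarrow> 'a set \<Rightarrow> 'a mfd" where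
  "mfd_restrict M W = \<lparr>pts = pts M \<inter> W, dim = dim M, charts = (\<lambda>(U, \<phi>). (U \<inter> W, \<phi>)) ` charts M\<rparr>"

definition mfd_prod :: "'a mfd \<Rightarrow> 'b mfd \<Rightarrow> ('a \<times> 'b) mfd" where
  "mfd_prod M N = \<lparr>pts = pts M \<times> pts N, dim = dim M + dim N,
     charts = {(U \<times> V, \<lambda>p i. if i < dim M then \<phi> (fst p) i else \<psi> (snd p) (i - dim M)) | U \<phi> V \<psi>.
                 (U, \<phi>) \<in> charts M \<and> (V, \<psi>) \<in> charts N}\<rparr>"

definition unit_interval_mfd :: "real mfd" where
  "unit_interval_mfd = \<lparr>pts = {0<..<1}, dim = 1,
     charts = {({0<..<1}, \<lambda>t i. if i = 0 then t else 0)}\<rparr>"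

definition open_ball :: "'a topology \<Rightarrow> 'a mfd \<Rightarrow> 'a \<Rightarrow> 'a set \<Rightarrow> bool" where
  "open_ball T M x B \<longleftrightarrow> x \<in> B \<and>
     (\<exists>\<phi> r. r > 0 \<and> is_chart T M B \<phi> \<and>
        \<phi> ` B = {y \<in> topspace (Euclidean_space (dim M)). (\<Sum>i<dim M. (y i - \<phi> x i)\<^sup>2) < r\<^sup>2})"


section \<open>Decomposed and stratified spaces\<close>

definition paracompact_space :: "'a topology \<Rightarrow> bool" where
  "paracompact_space T \<longleftrightarrow>
     (\<forall>\<U>. (\<forall>U\<in>\<U>. openin T U) \<and> \<Union>\<U> = topspace T \<longrightarrow>
       (\<exists>\<V>. (\<forall>V\<in>\<V>. openin T V \<and> (\<exists>U\<in>\<U>. V \<subseteq> U)) \<and> \<Union>\<V> = topspace T \<and> locally_finite_in T \<V>))"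

text \<open>Finite Lebesgue covering dimension.\<close>

definition finite_dimensional_space :: "'a topology \<Rightarrow> bool" where
  "finite_dimensional_space T \<longleftrightarrow>
     (\<exists>d::nat. \<forall>\<U>. (\<forall>U\<in>\<U>. openin T U) \<and> \<Union>\<U> = topspace T \<longrightarrow>
       (\<exists>\<V>. (\<forall>V\<in>\<V>. openin T V \<and> (\<exists>U\<in>\<U>. V \<subseteq> U)) \<and> \<Union>\<V> = topspace T \<and>
            (\<forall>x\<in>topspace T. finite {V\<in>\<V>. x \<in> V} \<and> card {V\<in>\<V>. x \<in> V} \<le> d + 1)))"

record 'a dspace =
  dtop :: "'a topology"
  strata :: "'a mfd set"

definition stratum_le :: "'a dspace \<Rightarrow> 'a mfd \<Rightarrow> 'a mfd \<Rightarrow> bool" where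
  "stratum_le X S S' \<longleftrightarrow> pts S \<subseteq> dtop X closure_of pts S'"

text \<open>The poset order on the indices is determined by the strata (\<^const>\<open>stratum_le\<close>), and so are the
  indices, because the frontier condition forces strata to be nonempty. The collection of strata is
  therefore indexed by itself.\<close>

definition decomposed_space :: "'a dspace \<Rightarrow> bool" where
  "decomposed_space X \<longleftrightarrow>
     Hausdorff_space (dtop X) \<and> paracompact_space (dtop X) \<and> finite_dimensional_space (dtop X) \<and>
     (\<forall>S\<in>strata X. smooth_manifold (dtop X) S \<and>
        (\<exists>U F. openin (dtop X) U \<and> closedin (dtop X) F \<and> pts S = U \<inter> F)) \<and>
     (\<forall>S\<in>strata X. \<forall>S'\<in>strata X. S \<noteq> S' \<longrightarrow> pts S \<inter> pts S' = {}) \<and>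
     locally_finite_in (dtop X) (pts ` strata X) \<and>
     (\<Union>S\<in>strata X. pts S) = topspace (dtop X) \<and>
     (\<forall>S\<in>strata X. \<forall>S'\<in>strata X.
        pts S \<inter> dtop X closure_of pts S' \<noteq> {} \<longleftrightarrow> stratum_le X S S') \<and>
     (\<forall>S\<in>strata X. \<forall>S'\<in>strata X. stratum_le X S S' \<and> stratum_le X S' S \<longrightarrow> S = S')"

definition regular_stratum :: "'a dspace \<Rightarrow> 'a mfd \<Rightarrow> bool" where
  "regular_stratum X S \<longleftrightarrow> S \<in> strata X \<and>
     \<not> (\<exists>S'\<in>strata X. S' \<noteq> S \<and> pts S \<subseteq> dtop X closure_of pts S')"

definition ds_restrict :: "'a dspace \<Rightarrow> 'a set \<Rightarrow> 'a dspace" where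
  "ds_restrict X U = \<lparr>dtop = subtopology (dtop X) U,
     strata = {mfd_restrict S U | S. S \<in> strata X \<and> pts S \<inter> U \<noteq> {}}\<rparr>"

definition ds_single :: "'a topology \<Rightarrow> 'a mfd \<Rightarrow> 'a dspace" where
  "ds_single T M = \<lparr>dtop = subtopology T (pts M), strata = {M}\<rparr>"

definition ds_prod :: "'a dspace \<Rightarrow> 'b dspace \<Rightarrow> ('a \<times> 'b) dspace" where
  "ds_prod X Y = \<lparr>dtop = prod_topology (dtop X) (dtop Y),
     strata = {mfd_prod S S' | S S'. S \<in> strata X \<and> S' \<in> strata Y}\<rparr>"

text \<open>Open cone \<open>cL(1)\<close>: \<^const>\<open>None\<close> is the apex and \<^term>\<open>Some (z, t)\<close> with \<open>0 < t < 1\<close> is \<open>[z,t]\<close>;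
  the topology is the quotient topology of \<open>L \<times> [0,1)\<close>. For \<open>L = \<emptyset>\<close> it is a point
  (the usual convention, needed at points of regular strata).\<close>

definition cone_proj :: "'a \<times> real \<Rightarrow> ('a \<times> real) option" where
  "cone_proj p = (if snd p = 0 then None else Some p)"

definition cone_points :: "'a set \<Rightarrow> ('a \<times> real) option set" where
  "cone_points A = insert None (Some ` (A \<times> {0<..<1}))"

definition cone_topology :: "'a topology \<Rightarrow> ('a \<times> real) option topology" where
  "cone_topology T = topology (\<lambda>W. W \<subseteq> cone_points (topspace T) \<and>
     openin (prod_topology T (top_of_set {0..<1})) {p \<in> topspace T \<times> {0..<1}. cone_proj p \<in> W})"

lemma openin_cone_topology:
  "openin (cone_topology T) W \<longleftrightarrow> W \<subseteq> cone_points (topspace T) \<and>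
     openin (prod_topology T (top_of_set {0..<1})) {p \<in> topspace T \<times> {0..<1}. cone_proj p \<in> W}"
proof -
  let ?P = "\<lambda>W. {p \<in> topspace T \<times> {0..<1::real}. cone_proj p \<in> W}"
  have 1: "?P (A \<inter> B) = ?P A \<inter> ?P B" for A B :: "('a \<times> real) option set" by auto
  have 2: "?P (\<Union>\<K>) = \<Union>(?P ` \<K>)" for \<K> :: "('a \<times> real) option set set" by auto
  have "istopology (\<lambda>W. W \<subseteq> cone_points (topspace T) \<and>
     openin (prod_topology T (top_of_set {0..<1})) (?P W))"
    unfolding istopology_def 1 2 by (auto intro!: openin_Union openin_Int)
  then show ?thesis
    unfolding cone_topology_def by (simp add: topology_inverse')
qed

definition apex_mfd :: "('a \<times> real) option mfd" where
  "apex_mfd = \<lparr>pts = {None}, dim = 0, charts = {({None}, \<lambda>_ _. 0)}\<rparr>"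

definition cone_mfd :: "'a mfd \<Rightarrow> ('a \<times> real) option mfd" where
  "cone_mfd M = (let N = mfd_prod M unit_interval_mfd in
     \<lparr>pts = Some ` pts N, dim = dim N, charts = (\<lambda>(U, \<phi>). (Some ` U, \<phi> \<circ> the)) ` charts N\<rparr>)"

definition ds_cone :: "'a dspace \<Rightarrow> ('a \<times> real) option dspace" where
  "ds_cone L = \<lparr>dtop = cone_topology (dtop L), strata = insert apex_mfd (cone_mfd ` strata L)\<rparr>"

text \<open>Homeomorphisms preserving the decompositions into smooth manifolds. As both sides partition the
  spaces into nonempty pieces, every piece of the target is hit.\<close>

definition ds_iso :: "'a dspace \<Rightarrow> 'b dspace \<Rightarrow> ('a \<Rightarrow> 'b) \<Rightarrow> bool" where
  "ds_iso X Y h \<longleftrightarrow> homeomorphic_map (dtop X) (dtop Y) h \<and>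
     (\<forall>S\<in>strata X. \<exists>S'\<in>strata Y. diffeo S S' h)"

definition trivialization ::
  "'b dspace \<Rightarrow> 'b \<Rightarrow> 'b set \<Rightarrow> 'b mfd \<Rightarrow> 'a dspace \<Rightarrow> ('b \<Rightarrow> 'b \<times> ('a \<times> real) option) \<Rightarrow> bool" where
  "trivialization X x U B L h \<longleftrightarrow>
     openin (dtop X) U \<and> x \<in> U \<and>
     (\<exists>S\<in>strata X. x \<in> pts S \<and> open_ball (dtop X) S x (pts B) \<and> B = mfd_restrict S (pts B)) \<and>
     ds_iso (ds_restrict X U) (ds_prod (ds_single (dtop X) B) (ds_cone L)) h \<and>
     h x = (x, None)"

text \<open>The recursion on depth is expressed by a least fixed point: the link of a point has smaller depth
  than the space. The link may be taken in the type \<^typ>\<open>'a\<close> of \<^term>\<open>X\<close> because a trivialization embeds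
  \<open>L \<cong> {x} \<times> L \<times> {1/2}\<close> into \<^term>\<open>X\<close>.\<close>

inductive stratified_space :: "'a dspace \<Rightarrow> bool" where
  "decomposed_space X \<Longrightarrow>
   (\<forall>x \<in> topspace (dtop X). \<exists>U B L h.
      compact_space (dtop L) \<and> stratified_space L \<and> trivialization X x U B L h) \<Longrightarrow>
   stratified_space X"


section \<open>Smooth structures\<close>

definition local_functions :: "'a topology \<Rightarrow> ('a \<Rightarrow> real) set \<Rightarrow> 'a set \<Rightarrow> ('a \<Rightarrow> real) set" where
  "local_functions T C U = {f. \<forall>x\<in>U. \<exists>W g. openin T W \<and> x \<in> W \<and> g \<in> C \<and> (\<forall>y\<in>W \<inter> U. f y = g y)}"

definition germ_defined :: "'a topology \<Rightarrow> ('a \<Rightarrow> real) set \<Rightarrow> bool" where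
  "germ_defined T C \<longleftrightarrow> local_functions T C (topspace T) \<subseteq> C"

definition Cinf_ring :: "('a \<Rightarrow> real) set \<Rightarrow> bool" where
  "Cinf_ring C \<longleftrightarrow>
     (\<forall>n G f. smooth_on n (topspace (Euclidean_space n)) G \<and> (\<forall>i<n. f i \<in> C) \<longrightarrow>
        (\<lambda>x. G (\<lambda>i. if i < n then f i x else 0)) \<in> C)"

definition real_subalgebra :: "('a \<Rightarrow> real) set \<Rightarrow> bool" where
  "real_subalgebra C \<longleftrightarrow> (\<forall>c. (\<lambda>_. c) \<in> C) \<and>
     (\<forall>f\<in>C. \<forall>g\<in>C. (\<lambda>x. f x + g x) \<in> C \<and> (\<lambda>x. f x * g x) \<in> C)"

definition germ_defined_Cinf_algebra :: "'a topology \<Rightarrow> ('a \<Rightarrow> real) set \<Rightarrow> bool" where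
  "germ_defined_Cinf_algebra T C \<longleftrightarrow>
     (\<forall>f\<in>C. continuous_map T euclideanreal f) \<and> real_subalgebra C \<and> germ_defined T C \<and> Cinf_ring C"

definition prod_smooth ::
  "'a topology \<Rightarrow> ('a \<Rightarrow> real) set \<Rightarrow> 'b topology \<Rightarrow> ('b \<Rightarrow> real) set \<Rightarrow> ('a \<times> 'b \<Rightarrow> real) set" where
  "prod_smooth T1 C1 T2 C2 = {F. \<forall>p \<in> topspace T1 \<times> topspace T2.
     \<exists>W n k G f h. openin (prod_topology T1 T2) W \<and> p \<in> W \<and>
       smooth_on (n + k) (topspace (Euclidean_space (n + k))) G \<and>
       (\<forall>i<n. f i \<in> C1) \<and> (\<forall>j<k. h j \<in> C2) \<and>
       (\<forall>(y, z)\<in>W. F (y, z) = G (\<lambda>i. if i < n then f i y else if i < n + k then h (i - n) z else 0))}"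

text \<open>Local model of the smooth structure at the point \<^term>\<open>x\<close>; \<^term>\<open>Q L CL CC\<close> says that
  \<^term>\<open>CC\<close> is a smooth structure on the cone over \<^term>\<open>L\<close> with its smooth structure \<^term>\<open>CL\<close>.\<close>

definition locally_modelled ::
  "('a dspace \<Rightarrow> ('a \<Rightarrow> real) set \<Rightarrow> (('a \<times> real) option \<Rightarrow> real) set \<Rightarrow> bool) \<Rightarrow>
   'b dspace \<Rightarrow> ('b \<Rightarrow> real) set \<Rightarrow> 'b \<Rightarrow> bool" where
  "locally_modelled Q X C x \<longleftrightarrow>
     (\<exists>U B L h CL CC. trivialization X x U B L h \<and> Q L CL CC \<and>
        (\<forall>f. f \<in> local_functions (dtop X) C U \<longleftrightarrow>
           (\<exists>g \<in> prod_smooth (subtopology (dtop X) (pts B)) (mfd_smooth B) (cone_topology (dtop L)) CC.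
              \<forall>y\<in>U. f y = g (h y))))"

lemma locally_modelled_mono [mono]:
  assumes "\<And>L CL CC. Q L CL CC \<longrightarrow> Q' L CL CC"
  shows "locally_modelled Q X C x \<longrightarrow> locally_modelled Q' X C x"
  using assms unfolding locally_modelled_def by blast

text \<open>A smooth structure on a cone is a smooth structure on a stratified space, so it has local models
  too. At the apex this would only refer back to the cone itself, hence it is imposed away from the
  apex; this is what makes the recursion on depth well-founded.\<close>

inductive cone_smooth_structure ::
  "'a dspace \<Rightarrow> ('a \<Rightarrow> real) set \<Rightarrow> (('a \<times> real) option \<Rightarrow> real) set \<Rightarrow> bool" where
  "compact_space (dtop L) \<Longrightarrow> stratified_space L \<Longrightarrow>
   germ_defined_Cinf_algebra (dtop L) CL \<Longrightarrow>
   (\<forall>z \<in> topspace (dtop L). locally_modelled cone_smooth_structure L CL z) \<Longrightarrow>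
   germ_defined_Cinf_algebra (cone_topology (dtop L)) CC \<Longrightarrow>
   (\<forall>z \<in> topspace (dtop L). \<forall>t \<in> {0<..<1}.
      locally_modelled cone_smooth_structure (ds_cone L) CC (Some (z, t))) \<Longrightarrow>
   (\<forall>g\<in>CC. (\<lambda>p. g (Some p)) \<in>
      prod_smooth (dtop L) CL (top_of_set {0<..<1}) (mfd_smooth unit_interval_mfd)) \<Longrightarrow>
   (\<forall>\<rho> \<in> mfd_smooth unit_interval_mfd. \<forall>K. compact K \<and> K \<subseteq> {0<..<1} \<and> (\<forall>t. t \<notin> K \<longrightarrow> \<rho> t = 0) \<longrightarrow>
      (\<lambda>p. case p of None \<Rightarrow> 0 | Some (z, t) \<Rightarrow> \<rho> t) \<in> CC) \<Longrightarrow>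
   cone_smooth_structure L CL CC"

definition smooth_structure :: "'a dspace \<Rightarrow> ('a \<Rightarrow> real) set \<Rightarrow> bool" where
  "smooth_structure X C \<longleftrightarrow> stratified_space X \<and> germ_defined_Cinf_algebra (dtop X) C \<and>
     (\<forall>x \<in> topspace (dtop X).
        locally_modelled (cone_smooth_structure :: 'a dspace \<Rightarrow> _) X C x)"


section \<open>Exterior powers of real vector spaces\<close>

record 'v vspace =
  vcarrier :: "'v set"
  vzero :: 'v
  vadd :: "'v \<Rightarrow> 'v \<Rightarrow> 'v"
  vscale :: "real \<Rightarrow> 'v \<Rightarrow> 'v"

definition dual_space :: "'v vspace \<Rightarrow> ('v \<Rightarrow> real) vspace" where
  "dual_space V = \<lparr>
     vcarrier = {X. (\<forall>u\<in>vcarrier V. \<forall>v\<in>vcarrier V. X (vadd V u v) = X u + X v) \<and>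
                    (\<forall>c. \<forall>u\<in>vcarrier V. X (vscale V c u) = c * X u) \<and>
                    (\<forall>u. u \<notin> vcarrier V \<longrightarrow> X u = 0)},
     vzero = (\<lambda>_. 0), vadd = (\<lambda>X Y u. X u + Y u), vscale = (\<lambda>c X u. c * X u)\<rparr>"

definition alt_forms :: "'v vspace \<Rightarrow> nat \<Rightarrow> ('v list \<Rightarrow> real) set" where
  "alt_forms V k = {A. \<forall>vs. length vs = k \<and> set vs \<subseteq> vcarrier V \<longrightarrow>
     (\<forall>i<k. \<forall>u\<in>vcarrier V. \<forall>v\<in>vcarrier V.
        A (vs[i := vadd V u v]) = A (vs[i := u]) + A (vs[i := v])) \<and>
     (\<forall>i<k. \<forall>c. \<forall>u\<in>vcarrier V. A (vs[i := vscale V c u]) = c * A (vs[i := u])) \<and>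
     (\<forall>i j. i < j \<and> j < k \<and> vs ! i = vs ! j \<longrightarrow> A vs = 0)}"

text \<open>By the universal property, the linear functionals on \<open>\<Lambda>^k V\<close> are the alternating \<open>k\<close>-linear forms
  on \<open>V\<close>, and a vector space embeds into its bidual (in any dimension). An element of \<open>\<Lambda>^k V\<close> is
  represented by its values on all alternating forms; in particular \<open>v_1 \<and> \<dots> \<and> v_k\<close> sends
  \<open>A\<close> to \<open>A(v_1,\<dots>,v_k)\<close>, and \<open>\<Lambda>^k V\<close> is the linear span of these.\<close>

type_synonym 'v multivector = "('v list \<Rightarrow> real) \<Rightarrow> real"

definition wedge :: "'v vspace \<Rightarrow> 'v list \<Rightarrow> 'v multivector" where
  "wedge V vs = (\<lambda>A. if A \<in> alt_forms V (length vs) then A vs else 0)"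

definition ext_power :: "'v vspace \<Rightarrow> nat \<Rightarrow> 'v multivector set" where
  "ext_power V k = {\<xi>. \<exists>(N::nat) c vs. (\<forall>i<N. length (vs i) = k \<and> set (vs i) \<subseteq> vcarrier V) \<and>
     \<xi> = (\<lambda>A. \<Sum>i<N. c i * wedge V (vs i) A)}"

text \<open>\<open>\<xi> \<and> \<eta>\<close> for \<open>\<xi>\<close> in \<open>\<Lambda>^j V\<close> and \<open>\<eta>\<close> in \<open>\<Lambda>^k V\<close>: the bilinear extension of concatenating
  decomposable elements.\<close>

definition wedge_product :: "'v vspace \<Rightarrow> nat \<Rightarrow> nat \<Rightarrow> 'v multivector \<Rightarrow> 'v multivector \<Rightarrow> 'v multivector" where
  "wedge_product V j k \<xi> \<eta> =
     (\<lambda>A. if A \<in> alt_forms V (j + k) then \<xi> (\<lambda>us. \<eta> (\<lambda>vs. A (us @ vs))) else 0)"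

text \<open>\<open>g(u \<and> v)\<close> for a bivector \<open>g\<close> in \<open>\<Lambda>^2 V^*\<close>: on \<open>X \<and> Y\<close> it is \<open>X(u) Y(v) - X(v) Y(u)\<close>.\<close>

definition bivector_eval :: "('v \<Rightarrow> real) multivector \<Rightarrow> 'v \<Rightarrow> 'v \<Rightarrow> real" where
  "bivector_eval g u v = g (\<lambda>Xs. (Xs ! 0) u * (Xs ! 1) v - (Xs ! 0) v * (Xs ! 1) u)"

definition delete2 :: "nat \<Rightarrow> nat \<Rightarrow> 'v list \<Rightarrow> 'v list" where
  "delete2 i j vs = nths vs (- {i, j})"

text \<open>\<open>i(g)(v_1 \<and> \<dots> \<and> v_k) = \<Sum>_{i<j} (-1)^(i+j+1) g(v_i \<and> v_j) v_1 \<and> \<dots> omitting v_i, v_j \<dots> \<and> v_k\<close>,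
  and \<open>0\<close> if \<open>k < 2\<close>.\<close>

definition contraction :: "'v vspace \<Rightarrow> nat \<Rightarrow> ('v \<Rightarrow> real) multivector \<Rightarrow> 'v multivector \<Rightarrow> 'v multivector" where
  "contraction V k g \<xi> =
     (\<lambda>A. if 2 \<le> k \<and> A \<in> alt_forms V (k - 2)
          then \<xi> (\<lambda>vs. \<Sum>j<k. \<Sum>i<j. (-1) ^ (i + j + 1) * bivector_eval g (vs ! i) (vs ! j) * A (delete2 i j vs))
          else 0)"

definition lincomb :: "'v vspace \<Rightarrow> real list \<Rightarrow> 'v list \<Rightarrow> 'v" where
  "lincomb V cs vs = foldr (\<lambda>(c, v) s. vadd V (vscale V c v) s) (zip cs vs) (vzero V)"

definition is_basis :: "'v vspace \<Rightarrow> 'v list \<Rightarrow> bool" where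
  "is_basis V vs \<longleftrightarrow> set vs \<subseteq> vcarrier V \<and>
     (\<forall>v\<in>vcarrier V. \<exists>!cs. length cs = length vs \<and> v = lincomb V cs vs)"

definition coords :: "'v vspace \<Rightarrow> 'v list \<Rightarrow> 'v \<Rightarrow> real list" where
  "coords V vs v = (THE cs. length cs = length vs \<and> v = lincomb V cs vs)"

definition nondegenerate :: "'v vspace \<Rightarrow> 'v multivector \<Rightarrow> bool" where
  "nondegenerate V w \<longleftrightarrow>
     (\<forall>X \<in> vcarrier (dual_space V).
        (\<forall>Y \<in> vcarrier (dual_space V). w (\<lambda>vs. X (vs ! 0) * Y (vs ! 1) - X (vs ! 1) * Y (vs ! 0)) = 0)
        \<longrightarrow> X = (\<lambda>_. 0))"

text \<open>The bilinear form on covectors given by \<open>G_w = \<Sum>_j \<partial>_{y_j} \<and> \<partial>_{x_j}\<close> when \<open>w = \<Sum>_j dx_j \<and> dy_j\<close>.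
  Here \<^term>\<open>xs\<close>, \<^term>\<open>ys\<close> are the \<open>dx_j\<close>, \<open>dy_j\<close> at one point: the value of \<open>G_w\<close> at a point
  depends only on \<open>w\<close> at that point, and it does not depend on the basis chosen.\<close>

definition symplectic_bivector :: "'v vspace \<Rightarrow> 'v multivector \<Rightarrow> ('v \<Rightarrow> 'v \<Rightarrow> real) \<Rightarrow> bool" where
  "symplectic_bivector V w G \<longleftrightarrow>
     (\<exists>m xs ys. length xs = m \<and> length ys = m \<and> is_basis V (xs @ ys) \<and>
        w = (\<lambda>A. \<Sum>j<m. wedge V [xs ! j, ys ! j] A) \<and>
        (\<forall>u\<in>vcarrier V. \<forall>v\<in>vcarrier V.
           G u v = (let a = coords V (xs @ ys) u; b = coords V (xs @ ys) v
                    in \<Sum>j<m. a ! (m + j) * b ! j - a ! j * b ! (m + j))))"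


section \<open>Zariski cotangent spaces and differential forms\<close>

text \<open>\<^term>\<open>T\<close> is the topology of the space and \<^term>\<open>C\<close> its algebra of smooth functions.
  Membership in \<open>m_x^2\<close> is a condition on germs. Germs of smooth functions at \<open>x\<close> are germs of
  elements of \<^term>\<open>C\<close>, and a class in \<open>m_x / m_x^2\<close> is the set of all elements of
  \<^term>\<open>C\<close> whose germs represent it.\<close>

definition max_ideal_sq :: "'a topology \<Rightarrow> ('a \<Rightarrow> real) set \<Rightarrow> 'a \<Rightarrow> ('a \<Rightarrow> real) set" where
  "max_ideal_sq T C x = {h. \<exists>U (n::nat) a b. openin T U \<and> x \<in> U \<and>
     (\<forall>i<n. a i \<in> C \<and> a i x = 0 \<and> b i \<in> C \<and> b i x = 0) \<and>
     (\<forall>y\<in>U. h y = (\<Sum>i<n. a i y * b i y))}"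

type_synonym 'a covector = "('a \<Rightarrow> real) set"

definition diff_at :: "'a topology \<Rightarrow> ('a \<Rightarrow> real) set \<Rightarrow> 'a \<Rightarrow> ('a \<Rightarrow> real) \<Rightarrow> 'a covector" where
  "diff_at T C x f = {g \<in> C. g x = 0 \<and> (\<lambda>y. (f y - f x) - g y) \<in> max_ideal_sq T C x}"

definition cotangent :: "'a topology \<Rightarrow> ('a \<Rightarrow> real) set \<Rightarrow> 'a \<Rightarrow> 'a covector vspace" where
  "cotangent T C x = \<lparr>
     vcarrier = diff_at T C x ` C,
     vzero = diff_at T C x (\<lambda>_. 0),
     vadd = (\<lambda>a b. \<Union>f\<in>a. \<Union>g\<in>b. diff_at T C x (\<lambda>y. f y + g y)),
     vscale = (\<lambda>c a. \<Union>f\<in>a. diff_at T C x (\<lambda>y. c * f y))\<rparr>"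

definition zariski_tangent :: "'a topology \<Rightarrow> ('a \<Rightarrow> real) set \<Rightarrow> 'a \<Rightarrow> ('a covector \<Rightarrow> real) vspace" where
  "zariski_tangent T C x = dual_space (cotangent T C x)"

type_synonym 'a form = "'a \<Rightarrow> 'a covector multivector"

text \<open>Sections of \<open>\<Lambda>^k T^*X\<close> are extended by zero off the space.\<close>

definition forms :: "'a topology \<Rightarrow> ('a \<Rightarrow> real) set \<Rightarrow> nat \<Rightarrow> 'a form set" where
  "forms T C k = {\<alpha>. (\<forall>x. x \<notin> topspace T \<longrightarrow> \<alpha> x = (\<lambda>_. 0)) \<and>
     (\<forall>x\<in>topspace T. \<exists>U (N::nat) f0 fs. openin T U \<and> x \<in> U \<and>
        (\<forall>i<N. f0 i \<in> C \<and> length (fs i) = k \<and> set (fs i) \<subseteq> C) \<and>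
        (\<forall>y\<in>U. \<alpha> y = (\<lambda>A. \<Sum>i<N. f0 i y * wedge (cotangent T C y) (map (diff_at T C y) (fs i)) A)))}"

text \<open>\<open>d(f_0 df_1 \<and> \<dots> \<and> df_k) = df_0 \<and> df_1 \<and> \<dots> \<and> df_k\<close>, as a relation. It is used on manifolds,
  where it is the graph of the de Rham differential.\<close>

definition ext_derivative :: "'a topology \<Rightarrow> ('a \<Rightarrow> real) set \<Rightarrow> nat \<Rightarrow> 'a form \<Rightarrow> 'a form \<Rightarrow> bool" where
  "ext_derivative T C k \<alpha> \<beta> \<longleftrightarrow>
     (\<forall>x\<in>topspace T. \<exists>U (N::nat) f0 fs. openin T U \<and> x \<in> U \<and>
        (\<forall>i<N. f0 i \<in> C \<and> length (fs i) = k \<and> set (fs i) \<subseteq> C) \<and>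
        (\<forall>y\<in>U. \<alpha> y = (\<lambda>A. \<Sum>i<N. f0 i y * wedge (cotangent T C y) (map (diff_at T C y) (fs i)) A) \<and>
               \<beta> y = (\<lambda>A. \<Sum>i<N. wedge (cotangent T C y) (map (diff_at T C y) (f0 i # fs i)) A)))"

abbreviation mfd_top :: "'a dspace \<Rightarrow> 'a mfd \<Rightarrow> 'a topology" where
  "mfd_top X S \<equiv> subtopology (dtop X) (pts S)"

abbreviation mfd_cotangent :: "'a dspace \<Rightarrow> 'a mfd \<Rightarrow> 'a \<Rightarrow> 'a covector vspace" where
  "mfd_cotangent X S x \<equiv> cotangent (mfd_top X S) (mfd_smooth S) x"

text \<open>Value at \<^term>\<open>x\<close> of the restriction of a \<open>k\<close>-form on \<^term>\<open>X\<close> to the stratum \<^term>\<open>S\<close>: the map induced on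
  \<open>\<Lambda>^k\<close> by \<open>df(x) \<mapsto> d(f|_S)(x)\<close>.\<close>

definition restrict_covector :: "'a dspace \<Rightarrow> 'a mfd \<Rightarrow> 'a \<Rightarrow> 'a covector \<Rightarrow> 'a covector" where
  "restrict_covector X S x a = (\<Union>f\<in>a. diff_at (mfd_top X S) (mfd_smooth S) x f)"

definition restrict_form :: "'a dspace \<Rightarrow> 'a mfd \<Rightarrow> nat \<Rightarrow> 'a form \<Rightarrow> 'a form" where
  "restrict_form X S k \<alpha> x =
     (\<lambda>A. if x \<in> pts S \<and> A \<in> alt_forms (mfd_cotangent X S x) k
          then \<alpha> x (\<lambda>vs. A (map (restrict_covector X S x) vs)) else 0)"


section \<open>Stratified symplectic spaces\<close>

definition symplectic_form :: "'a dspace \<Rightarrow> 'a mfd \<Rightarrow> 'a form \<Rightarrow> bool" where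
  "symplectic_form X S w \<longleftrightarrow>
     w \<in> forms (mfd_top X S) (mfd_smooth S) 2 \<and>
     ext_derivative (mfd_top X S) (mfd_smooth S) 2 w (\<lambda>_ _. 0) \<and>
     (\<forall>x\<in>pts S. nondegenerate (mfd_cotangent X S x) (w x))"

definition stratified_symplectic_space :: "'a dspace \<Rightarrow> ('a mfd \<Rightarrow> 'a form) \<Rightarrow> bool" where
  "stratified_symplectic_space X \<omega> \<longleftrightarrow>
     stratified_space X \<and> (\<forall>S\<in>strata X. symplectic_form X S (\<omega> S))"

text \<open>\<^term>\<open>wt\<close> witnesses that \<^term>\<open>C\<close> is weakly symplectic.\<close>

definition weakly_symplectic ::
  "'a dspace \<Rightarrow> ('a \<Rightarrow> real) set \<Rightarrow> ('a mfd \<Rightarrow> 'a form) \<Rightarrow> 'a form \<Rightarrow> bool" where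
  "weakly_symplectic X C \<omega> wt \<longleftrightarrow> wt \<in> forms (dtop X) C 2 \<and>
     (\<forall>S\<in>strata X. restrict_form X S 2 wt = \<omega> S)"

definition poisson_bracket ::
  "'a topology \<Rightarrow> ('a \<Rightarrow> real) set \<Rightarrow> (('a \<Rightarrow> real) \<Rightarrow> ('a \<Rightarrow> real) \<Rightarrow> 'a \<Rightarrow> real) \<Rightarrow> bool" where
  "poisson_bracket T C br \<longleftrightarrow>
     (\<forall>f\<in>C. \<forall>g\<in>C. br f g \<in> C) \<and>
     (\<forall>f\<in>C. \<forall>g\<in>C. \<forall>h\<in>C. \<forall>x\<in>topspace T.
        br f g x = - br g f x \<and>
        (\<forall>a b. br (\<lambda>y. a * f y + b * g y) h x = a * br f h x + b * br g h x) \<and>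
        br f (\<lambda>y. g y * h y) x = br f g x * h x + g x * br f h x \<and>
        br f (br g h) x + br g (br h f) x + br h (br f g) x = 0)"

text \<open>\<^term>\<open>br\<close> witnesses that \<^term>\<open>C\<close> is Poisson: on each stratum it is \<open>{f|_S, g|_S} = G_\<omega>(df \<and> dg)\<close>.\<close>

definition poisson_structure ::
  "'a dspace \<Rightarrow> ('a \<Rightarrow> real) set \<Rightarrow> ('a mfd \<Rightarrow> 'a form) \<Rightarrow>
   (('a \<Rightarrow> real) \<Rightarrow> ('a \<Rightarrow> real) \<Rightarrow> 'a \<Rightarrow> real) \<Rightarrow> bool" where
  "poisson_structure X C \<omega> br \<longleftrightarrow> poisson_bracket (dtop X) C br \<and>
     (\<forall>S\<in>strata X. \<forall>x\<in>pts S. \<exists>G. symplectic_bivector (mfd_cotangent X S x) (\<omega> S x) G \<and>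
        (\<forall>f\<in>C. \<forall>g\<in>C. br f g x =
           G (diff_at (mfd_top X S) (mfd_smooth S) x f) (diff_at (mfd_top X S) (mfd_smooth S) x g)))"

definition poisson_bivector_field ::
  "'a dspace \<Rightarrow> ('a \<Rightarrow> real) set \<Rightarrow> (('a \<Rightarrow> real) \<Rightarrow> ('a \<Rightarrow> real) \<Rightarrow> 'a \<Rightarrow> real) \<Rightarrow>
   ('a \<Rightarrow> ('a covector \<Rightarrow> real) multivector) \<Rightarrow> bool" where
  "poisson_bivector_field X C br g \<longleftrightarrow>
     (\<forall>x\<in>topspace (dtop X). g x \<in> ext_power (zariski_tangent (dtop X) C x) 2 \<and>
        (\<forall>f\<in>C. \<forall>h\<in>C.
           bivector_eval (g x) (diff_at (dtop X) C x f) (diff_at (dtop X) C x h) = br f h x))"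


section \<open>Lefschetz operators\<close>

text \<open>The degree \<open>k\<close> of the argument is explicit. A \<open>k\<close>-form with \<open>k < 2\<close> is primitive, since then
  \<^term>\<open>Lef_dual X C g k \<alpha> = 0\<close>.\<close>

definition Lef :: "'a dspace \<Rightarrow> ('a \<Rightarrow> real) set \<Rightarrow> 'a form \<Rightarrow> nat \<Rightarrow> 'a form \<Rightarrow> 'a form" where
  "Lef X C wt k \<alpha> x = wedge_product (cotangent (dtop X) C x) 2 k (wt x) (\<alpha> x)"

primrec Lef_pow :: "'a dspace \<Rightarrow> ('a \<Rightarrow> real) set \<Rightarrow> 'a form \<Rightarrow> nat \<Rightarrow> nat \<Rightarrow> 'a form \<Rightarrow> 'a form" where
  "Lef_pow X C wt k 0 \<alpha> = \<alpha>"
| "Lef_pow X C wt k (Suc r) \<alpha> = Lef X C wt (k + 2 * r) (Lef_pow X C wt k r \<alpha>)"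

definition Lef_dual ::
  "'a dspace \<Rightarrow> ('a \<Rightarrow> real) set \<Rightarrow> ('a \<Rightarrow> ('a covector \<Rightarrow> real) multivector) \<Rightarrow> nat \<Rightarrow> 'a form \<Rightarrow> 'a form" where
  "Lef_dual X C g k \<alpha> x = contraction (cotangent (dtop X) C x) k (g x) (\<alpha> x)"

definition primitive_forms ::
  "'a dspace \<Rightarrow> ('a \<Rightarrow> real) set \<Rightarrow> ('a \<Rightarrow> ('a covector \<Rightarrow> real) multivector) \<Rightarrow> nat \<Rightarrow> 'a form set" where
  "primitive_forms X C g k = {\<alpha> \<in> forms (dtop X) C k. Lef_dual X C g k \<alpha> = (\<lambda>_ _. 0)}"

definition form_subspace :: "'a form set \<Rightarrow> bool" where
  "form_subspace W \<longleftrightarrow> (\<lambda>_ _. 0) \<in> W \<and>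
     (\<forall>\<alpha>\<in>W. \<forall>\<beta>\<in>W. \<forall>a b. (\<lambda>x A. a * \<alpha> x A + b * \<beta> x A) \<in> W)"

definition internal_direct_sum :: "'a form set \<Rightarrow> nat set \<Rightarrow> (nat \<Rightarrow> 'a form set) \<Rightarrow> bool" where
  "internal_direct_sum W I M \<longleftrightarrow>
     form_subspace W \<and> (\<forall>r\<in>I. form_subspace (M r) \<and> M r \<subseteq> W) \<and>
     (\<forall>\<alpha>\<in>W. \<exists>!\<beta>. \<beta> \<in> (\<Pi>\<^sub>E r\<in>I. M r) \<and> \<alpha> = (\<lambda>x A. \<Sum>r\<in>I. \<beta> r x A))"

end

theory Submission
  imports Defs
begin

text \<open>Evaluating the Poisson bivector on the symplectic form gives a continuous function, whose value at a
  point is minus half the dimension of the stratum through it. It is therefore locally constant. Since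
  a stratum in the closure of another one has smaller dimension, there are no singular strata, and
  \<open>X\<close> is locally a symplectic manifold with its usual smooth functions. There
  \<open>[L\<^sup>*, L] = k - m\<close> on \<open>k\<close>-forms, where \<open>2m\<close> is the dimension, and the decomposition is that of an
  \<open>sl_2\<close>-module. The components are obtained from \<open>\<alpha>\<close> by applying powers of \<open>L\<close> and \<open>L\<^sup>*\<close> and
  multiplying by locally constant functions, so they are smooth.\<close>

section \<open>Alternating forms and contractions\<close>

text \<open>Multivectors are functionals on alternating forms, so \<open>L\<close> and its dual are
  studied through their transposes on forms, \<open>lef\<close> and \<open>con\<close>, and the
  commutator becomes an identity between alternating forms. It is derived from a reproducing
  property instead of a basis: the functions u, v in a local expression of the Zariski symplectic
  form as a sum of a du \<and> dv are chosen once for a whole neighbourhood, whereas symplectic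
  bases exist only point by point on each stratum. The exclusion of singular strata is the main
  obstacle. It is reached along the rays of the cone over a link: near the apex every smooth
  function would have derivative zero along a ray, although the smooth structure of the cone
  contains nonconstant radial bump functions. The sum runs over all r with 2r \<le> k, also over
  those for which L^r kills the primitive forms. There the scalar by which a component has to be
  divided is zero; the component is then zero as well, because powers of the dual are injective in
  high degrees, so that the convention 1/0 = 0 gives the right answer.\<close>

definition vclosed :: "'v vspace \<Rightarrow> bool" where
  "vclosed V \<longleftrightarrow> (\<forall>u\<in>vcarrier V. \<forall>v\<in>vcarrier V. vadd V u v \<in> vcarrier V) \<and>
     (\<forall>c. \<forall>u\<in>vcarrier V. vscale V c u \<in> vcarrier V)"

definition linear_on :: "'v vspace \<Rightarrow> ('v \<Rightarrow> real) \<Rightarrow> bool" where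
  "linear_on V l \<longleftrightarrow> (\<forall>u\<in>vcarrier V. \<forall>v\<in>vcarrier V. l (vadd V u v) = l u + l v) \<and>
     (\<forall>c. \<forall>u\<in>vcarrier V. l (vscale V c u) = c * l u)"

definition alternating_on :: "'v vspace \<Rightarrow> ('v \<Rightarrow> 'v \<Rightarrow> real) \<Rightarrow> bool" where
  "alternating_on V g \<longleftrightarrow> (\<forall>u\<in>vcarrier V. linear_on V (g u) \<and> linear_on V (\<lambda>v. g v u) \<and> g u u = 0)"

lemma alt_forms_0 [simp]: "alt_forms V 0 = UNIV"
  by (auto simp: alt_forms_def)

text \<open>Only lists of length k in the carrier are tested by \<open>alt_forms\<close>, and
  \<open>vclosed\<close> keeps the lists with a substituted sum or multiple inside the
  carrier.\<close>

lemma alt_forms_cong: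
  assumes "\<And>vs. length vs = k \<Longrightarrow> set vs \<subseteq> vcarrier V \<Longrightarrow> A vs = B vs" "vclosed V"
  shows "A \<in> alt_forms V k \<longleftrightarrow> B \<in> alt_forms V k"
proof -
  have "A (vs[i := u]) = B (vs[i := u])"
    if "length vs = k" "set vs \<subseteq> vcarrier V" "u \<in> vcarrier V" for vs i u
    using that set_update_subset_insert[of vs i u] by (intro assms(1)) auto
  then show ?thesis using assms unfolding alt_forms_def vclosed_def
    by (intro iffI CollectI allI impI) (auto simp: subset_iff)
qed

lemma alt_forms_comb:
  assumes "A \<in> alt_forms V k" "B \<in> alt_forms V k"
  shows "(\<lambda>vs. a * A vs + b * B vs) \<in> alt_forms V k"
  using assms unfolding alt_forms_def by (auto simp: algebra_simps)

lemma alt_forms_zero: "(\<lambda>_. 0) \<in> alt_forms V k"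
  by (simp add: alt_forms_def)

lemma alt_forms_sum:
  assumes "finite I" "\<And>i. i \<in> I \<Longrightarrow> A i \<in> alt_forms V k"
  shows "(\<lambda>vs. \<Sum>i\<in>I. c i * A i vs) \<in> alt_forms V k"
  using assms
proof (induction I rule: finite_induct)
  case (insert x F)
  then show ?case using alt_forms_comb[of "A x" V k "\<lambda>vs. \<Sum>i\<in>F. c i * A i vs" "c x" 1] by simp
qed (simp add: alt_forms_zero)

lemma alt_forms_hd_linear:
  assumes "A \<in> alt_forms V (Suc k)" "length vs = k" "set vs \<subseteq> vcarrier V"
  shows "linear_on V (\<lambda>v. A (v # vs))"
  unfolding linear_on_def
proof (intro conjI ballI allI)
  have *: "length (u # vs) = Suc k \<and> set (u # vs) \<subseteq> vcarrier V" if "u \<in> vcarrier V" for u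
    using assms that by auto
  fix u c assume u: "u \<in> vcarrier V"
  have "\<forall>i<Suc k. \<forall>c. \<forall>w\<in>vcarrier V. A ((u # vs)[i := vscale V c w]) = c * A ((u # vs)[i := w])"
    using assms(1) *[OF u] unfolding alt_forms_def by blast
  from this[rule_format, of 0 u c] u show "A (vscale V c u # vs) = c * A (u # vs)" by simp
  fix v assume v: "v \<in> vcarrier V"
  have "\<forall>i<Suc k. \<forall>w\<in>vcarrier V. \<forall>w'\<in>vcarrier V. A ((u # vs)[i := vadd V w w'])
      = A ((u # vs)[i := w]) + A ((u # vs)[i := w'])"
    using assms(1) *[OF u] unfolding alt_forms_def by blast
  from this[rule_format, of 0 u v] u v show "A (vadd V u v # vs) = A (u # vs) + A (v # vs)" by simp
qed

lemma alt_forms_tl: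
  assumes "A \<in> alt_forms V (Suc k)" "v \<in> vcarrier V"
  shows "(\<lambda>vs. A (v # vs)) \<in> alt_forms V k"
  unfolding alt_forms_def mem_Collect_eq
proof (intro allI impI conjI)
  have *: "length (v # vs) = Suc k \<and> set (v # vs) \<subseteq> vcarrier V"
    if "length vs = k \<and> set vs \<subseteq> vcarrier V" for vs using assms that by auto
  fix vs assume vs: "length vs = k \<and> set vs \<subseteq> vcarrier V"
  have A: "(\<forall>i<Suc k. \<forall>u\<in>vcarrier V. \<forall>w\<in>vcarrier V.
        A ((v # vs)[i := vadd V u w]) = A ((v # vs)[i := u]) + A ((v # vs)[i := w])) \<and>
     (\<forall>i<Suc k. \<forall>c. \<forall>u\<in>vcarrier V. A ((v # vs)[i := vscale V c u]) = c * A ((v # vs)[i := u])) \<and>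
     (\<forall>i j. i < j \<and> j < Suc k \<and> (v # vs) ! i = (v # vs) ! j \<longrightarrow> A (v # vs) = 0)"
    using assms(1) *[OF vs] unfolding alt_forms_def by blast
  show "\<forall>u\<in>vcarrier V. \<forall>w\<in>vcarrier V.
      A (v # vs[i := vadd V u w]) = A (v # vs[i := u]) + A (v # vs[i := w])" if "i < k" for i
    using A[THEN conjunct1, rule_format, of "Suc i"] that by simp
  show "\<forall>u\<in>vcarrier V. A (v # vs[i := vscale V c u]) = c * A (v # vs[i := u])" if "i < k" for i c
    using A[THEN conjunct2, THEN conjunct1, rule_format, of "Suc i"] that by simp
  show "A (v # vs) = 0" if "i < j \<and> j < k \<and> vs ! i = vs ! j" for i j
    using A[THEN conjunct2, THEN conjunct2, rule_format, of "Suc i" "Suc j"] that by simp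
qed

lemma alt_forms_eq0:
  assumes "A \<in> alt_forms V k" "length vs = k" "set vs \<subseteq> vcarrier V" "\<not> distinct vs"
  shows "A vs = 0"
proof -
  obtain i j where "i < length vs" "j < length vs" "i \<noteq> j" "vs ! i = vs ! j"
    using assms(4) by (auto simp: distinct_conv_nth)
  then obtain i j where "i < j" "j < k" "vs ! i = vs ! j"
    using assms(2) by (metis linorder_neq_iff)
  then show ?thesis using assms unfolding alt_forms_def by blast
qed

text \<open>Polarization: expand b(u + v, u + v) = 0.\<close>

lemma antisymI:
  assumes "vclosed V" "u \<in> vcarrier V" "v \<in> vcarrier V"
    and "\<And>w. w \<in> vcarrier V \<Longrightarrow> linear_on V (\<lambda>z. b z w)"
    and "\<And>w. w \<in> vcarrier V \<Longrightarrow> linear_on V (b w)"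
    and "\<And>w. w \<in> vcarrier V \<Longrightarrow> b w w = 0"
  shows "b u v = - b v u"
proof -
  have s: "vadd V u v \<in> vcarrier V" using assms by (simp add: vclosed_def)
  have "b (vadd V u v) (vadd V u v) = b u u + b u v + (b v u + b v v)"
    using assms(2-5) s unfolding linear_on_def by (metis (no_types, lifting))
  then show ?thesis using assms(2,3,6) s by simp
qed

text \<open>A criterion adapted to recursion on the argument list, which is how \<open>ins\<close>
  and \<open>con\<close> are defined. It is enough to test the coincidence of the first two entries:
  if the head equals a later entry, swapping the first two entries costs a sign and brings both
  copies into the tail, where the first hypothesis applies.\<close>

lemma alt_forms_SucI:
  assumes V: "vclosed V"
    and 1: "\<And>v. v \<in> vcarrier V \<Longrightarrow> (\<lambda>vs. A (v # vs)) \<in> alt_forms V k"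
    and 2: "\<And>vs. length vs = k \<Longrightarrow> set vs \<subseteq> vcarrier V \<Longrightarrow> linear_on V (\<lambda>v. A (v # vs))"
    and 3: "\<And>v vs. v \<in> vcarrier V \<Longrightarrow> Suc (length vs) = k \<Longrightarrow> set vs \<subseteq> vcarrier V \<Longrightarrow> A (v # v # vs) = 0"
  shows "A \<in> alt_forms V (Suc k)"
  unfolding alt_forms_def mem_Collect_eq
proof (intro allI impI)
  fix ws assume "length ws = Suc k \<and> set ws \<subseteq> vcarrier V"
  then obtain v vs where ws: "ws = v # vs" and v: "v \<in> vcarrier V"
    and vs: "length vs = k" "set vs \<subseteq> vcarrier V"
    by (cases ws) auto
  have t: "(\<forall>i<k. \<forall>u\<in>vcarrier V. \<forall>w\<in>vcarrier V.
        A (v # vs[i := vadd V u w]) = A (v # vs[i := u]) + A (v # vs[i := w])) \<and>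
     (\<forall>i<k. \<forall>c. \<forall>u\<in>vcarrier V. A (v # vs[i := vscale V c u]) = c * A (v # vs[i := u])) \<and>
     (\<forall>i j. i < j \<and> j < k \<and> vs ! i = vs ! j \<longrightarrow> A (v # vs) = 0)"
    using 1[OF v] vs unfolding alt_forms_def by blast
  note l = 2[OF vs, unfolded linear_on_def]
  have z: "A ws = 0" if ij: "i < j" "j < Suc k" "ws ! i = ws ! j" for i j
  proof (cases i)
    case (Suc i')
    then obtain j' where "j = Suc j'" using ij by (cases j) auto
    then show ?thesis using t ij Suc ws by auto
  next
    case 0
    then obtain j' where j: "j = Suc j'" using ij by (cases j) auto
    then have j': "j' < k" "vs ! j' = v" using ij ws 0 by auto
    then obtain u us where vs': "vs = u # us" using vs by (cases vs) auto
    then have u: "u \<in> vcarrier V" "set us \<subseteq> vcarrier V" using vs by auto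
    have k: "k = Suc (length us)" using vs vs' by simp
    show ?thesis
    proof (cases j')
      case 0
      then have "u = v" using j' vs' by simp
      then show ?thesis using 3[OF v, of us] k u ws vs' by simp
    next
      case (Suc i)
      have "A (v # u # us) = - A (u # v # us)"
      proof (rule antisymI[OF V v u(1)])
        show "linear_on V (\<lambda>z. A (z # w # us))" if "w \<in> vcarrier V" for w
          using that k u by (intro 2) auto
        show "linear_on V (\<lambda>z. A (w # z # us))" if "w \<in> vcarrier V" for w
          using alt_forms_hd_linear[OF 1[OF that, unfolded k] _ u(2)] by simp
        show "A (w # w # us) = 0" if "w \<in> vcarrier V" for w
          using 3[OF that, of us] k u by simp
      qed
      moreover have "v \<in> set us" using j' vs' Suc k by auto
      then have "A (u # v # us) = 0"
        using alt_forms_eq0[OF 1[OF u(1)], of "v # us"] k u v by auto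
      ultimately show ?thesis using ws vs' by simp
    qed
  qed
  show "(\<forall>i<Suc k. \<forall>u\<in>vcarrier V. \<forall>v\<in>vcarrier V.
        A (ws[i := vadd V u v]) = A (ws[i := u]) + A (ws[i := v])) \<and>
     (\<forall>i<Suc k. \<forall>c. \<forall>u\<in>vcarrier V. A (ws[i := vscale V c u]) = c * A (ws[i := u])) \<and>
     (\<forall>i j. i < j \<and> j < Suc k \<and> ws ! i = ws ! j \<longrightarrow> A ws = 0)"
  proof (intro conjI)
    show "\<forall>i j. i < j \<and> j < Suc k \<and> ws ! i = ws ! j \<longrightarrow> A ws = 0"
      using z by blast
  qed (use t l in \<open>auto simp: ws less_Suc_eq_0_disj\<close>)
qed

lemma alt_forms_swap:
  assumes V: "vclosed V" and A: "A \<in> alt_forms V (Suc (Suc k))"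
    and uv: "u \<in> vcarrier V" "v \<in> vcarrier V" and us: "length us = k" "set us \<subseteq> vcarrier V"
  shows "A (u # v # us) = - A (v # u # us)"
proof (rule antisymI[OF V uv])
  show "linear_on V (\<lambda>z. A (z # w # us))" if "w \<in> vcarrier V" for w
    using that us by (intro alt_forms_hd_linear[OF A]) auto
  show "linear_on V (\<lambda>z. A (w # z # us))" if "w \<in> vcarrier V" for w
    using alt_forms_hd_linear[OF alt_forms_tl[OF A that] us] .
  show "A (w # w # us) = 0" if "w \<in> vcarrier V" for w
    using alt_forms_eq0[OF A, of "w # w # us"] that us by simp
qed

text \<open>The exterior product of the linear form f with A, that is the signed sum of f(v_j) times
  the value of A at the list without v_j.\<close>

primrec ins :: "('v \<Rightarrow> real) \<Rightarrow> ('v list \<Rightarrow> real) \<Rightarrow> 'v list \<Rightarrow> real" where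
  "ins f A [] = 0"
| "ins f A (v # vs) = f v * A vs - ins f (\<lambda>ws. A (v # ws)) vs"

text \<open>\<open>con g\<close> is the transpose of the contraction with \<open>g\<close>, in recursive form.\<close>

primrec con :: "('v \<Rightarrow> 'v \<Rightarrow> real) \<Rightarrow> ('v list \<Rightarrow> real) \<Rightarrow> 'v list \<Rightarrow> real" where
  "con g A [] = 0"
| "con g A (v # vs) = ins (g v) A vs + con g (\<lambda>ws. A (v # ws)) vs"

lemma ins_comb: "ins f (\<lambda>ws. a * A ws + b * B ws) vs = a * ins f A vs + b * ins f B vs"
  by (induction vs arbitrary: A B) (auto simp: algebra_simps)

lemma con_comb: "con g (\<lambda>ws. a * A ws + b * B ws) vs = a * con g A vs + b * con g B vs"
  by (induction vs arbitrary: A B) (auto simp: algebra_simps ins_comb)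

lemma ins_zero [simp]: "ins f (\<lambda>_. 0) vs = 0"
  by (induction vs) auto

lemma con_zero [simp]: "con g (\<lambda>_. 0) vs = 0"
  by (induction vs) auto

lemma con_sum: "finite I \<Longrightarrow> con g (\<lambda>ws. \<Sum>i\<in>I. a i * A i ws) vs = (\<Sum>i\<in>I. a i * con g (A i) vs)"
proof (induction I rule: finite_induct)
  case (insert x F)
  then show ?case using con_comb[of g "a x" "A x" 1 "\<lambda>ws. \<Sum>i\<in>F. a i * A i ws" vs] by simp
qed simp

lemma ins_cong:
  assumes "\<And>ws. Suc (length ws) = length vs \<Longrightarrow> set ws \<subseteq> set vs \<Longrightarrow> A ws = B ws"
  shows "ins f A vs = ins f B vs"
  using assms
proof (induction vs arbitrary: A B)
  case (Cons v vs)
  have "ins f (\<lambda>ws. A (v # ws)) vs = ins f (\<lambda>ws. B (v # ws)) vs"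
    by (rule Cons.IH, rule Cons.prems) auto
  moreover have "A vs = B vs" by (rule Cons.prems) auto
  ultimately show ?case by simp
qed simp

lemma con_cong:
  assumes "\<And>ws. length ws + 2 = length vs \<Longrightarrow> set ws \<subseteq> set vs \<Longrightarrow> A ws = B ws"
  shows "con g A vs = con g B vs"
  using assms
proof (induction vs arbitrary: A B)
  case (Cons v vs)
  have "con g (\<lambda>ws. A (v # ws)) vs = con g (\<lambda>ws. B (v # ws)) vs"
    by (rule Cons.IH, rule Cons.prems) auto
  moreover have "ins (g v) A vs = ins (g v) B vs"
    by (rule ins_cong, rule Cons.prems) auto
  ultimately show ?case by simp
qed simp

lemma ins_fun_comb: "ins (\<lambda>v. a * f v + b * h v) A vs = a * ins f A vs + b * ins h A vs"
  by (induction vs arbitrary: A) (auto simp: algebra_simps)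

lemma ins_fun_cong: "(\<And>v. v \<in> set vs \<Longrightarrow> f v = h v) \<Longrightarrow> ins f A vs = ins h A vs"
  by (induction vs arbitrary: A) auto

lemma ins_hd_linear:
  assumes "A \<in> alt_forms V (Suc k)" "length vs = Suc k" "set vs \<subseteq> vcarrier V"
  shows "linear_on V (\<lambda>v. ins f (\<lambda>ws. A (v # ws)) vs)"
  unfolding linear_on_def
proof (intro conjI ballI allI)
  have l: "linear_on V (\<lambda>v. A (v # ws))" if "Suc (length ws) = length vs" "set ws \<subseteq> set vs" for ws
    by (rule alt_forms_hd_linear[OF assms(1)]) (use assms that in auto)
  fix u c assume u: "u \<in> vcarrier V"
  have "ins f (\<lambda>ws. A (vscale V c u # ws)) vs = ins f (\<lambda>ws. c * A (u # ws) + 0 * A (u # ws)) vs"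
    by (rule ins_cong) (use l u in \<open>auto simp: linear_on_def\<close>)
  then show "ins f (\<lambda>ws. A (vscale V c u # ws)) vs = c * ins f (\<lambda>ws. A (u # ws)) vs"
    unfolding ins_comb by simp
  fix v assume v: "v \<in> vcarrier V"
  have "ins f (\<lambda>ws. A (vadd V u v # ws)) vs = ins f (\<lambda>ws. 1 * A (u # ws) + 1 * A (v # ws)) vs"
    by (rule ins_cong) (use l u v in \<open>auto simp: linear_on_def\<close>)
  then show "ins f (\<lambda>ws. A (vadd V u v # ws)) vs = ins f (\<lambda>ws. A (u # ws)) vs + ins f (\<lambda>ws. A (v # ws)) vs"
    unfolding ins_comb by simp
qed

lemma con_hd_linear:
  assumes "A \<in> alt_forms V (Suc k)" "length vs = k + 2" "set vs \<subseteq> vcarrier V"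
  shows "linear_on V (\<lambda>v. con g (\<lambda>ws. A (v # ws)) vs)"
  unfolding linear_on_def
proof (intro conjI ballI allI)
  have l: "linear_on V (\<lambda>v. A (v # ws))" if "length ws + 2 = length vs" "set ws \<subseteq> set vs" for ws
    by (rule alt_forms_hd_linear[OF assms(1)]) (use assms that in auto)
  fix u c assume u: "u \<in> vcarrier V"
  have "con g (\<lambda>ws. A (vscale V c u # ws)) vs = con g (\<lambda>ws. c * A (u # ws) + 0 * A (u # ws)) vs"
    by (rule con_cong) (use l u in \<open>auto simp: linear_on_def\<close>)
  then show "con g (\<lambda>ws. A (vscale V c u # ws)) vs = c * con g (\<lambda>ws. A (u # ws)) vs"
    unfolding con_comb by simp
  fix v assume v: "v \<in> vcarrier V"
  have "con g (\<lambda>ws. A (vadd V u v # ws)) vs = con g (\<lambda>ws. 1 * A (u # ws) + 1 * A (v # ws)) vs"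
    by (rule con_cong) (use l u v in \<open>auto simp: linear_on_def\<close>)
  then show "con g (\<lambda>ws. A (vadd V u v # ws)) vs = con g (\<lambda>ws. A (u # ws)) vs + con g (\<lambda>ws. A (v # ws)) vs"
    unfolding con_comb by simp
qed

lemma linear_on_comb: "linear_on V f \<Longrightarrow> linear_on V h \<Longrightarrow> linear_on V (\<lambda>v. a * f v + b * h v)"
  by (auto simp: linear_on_def algebra_simps)

lemma ins_alt_forms:
  assumes V: "vclosed V" and f: "linear_on V f" and A: "A \<in> alt_forms V k"
  shows "ins f A \<in> alt_forms V (Suc k)"
  using A
proof (induction k arbitrary: A)
  case 0
  show ?case
    by (rule alt_forms_SucI[OF V]) (use f in \<open>auto simp: linear_on_def algebra_simps\<close>)
next
  case (Suc k)
  note t = alt_forms_tl[OF Suc.prems]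
  show ?case
  proof (rule alt_forms_SucI[OF V])
    show "(\<lambda>vs. ins f A (v # vs)) \<in> alt_forms V (Suc k)" if "v \<in> vcarrier V" for v
      using alt_forms_comb[OF Suc.prems Suc.IH[OF t[OF that]], of "f v" "-1"] by simp
    show "linear_on V (\<lambda>v. ins f A (v # vs))" if "length vs = Suc k" "set vs \<subseteq> vcarrier V" for vs
      using linear_on_comb[OF f ins_hd_linear[OF Suc.prems that], of "A vs" "-1"]
      by (simp add: mult.commute)
    show "ins f A (v # v # vs) = 0"
      if v: "v \<in> vcarrier V" "Suc (length vs) = Suc k" "set vs \<subseteq> vcarrier V" for v vs
    proof -
      \<comment> \<open>The two terms with the factor \<open>f v\<close> cancel; what is left sees A
        only at lists that contain v twice.\<close>
      have "ins f (\<lambda>ws. A (v # v # ws)) vs = ins f (\<lambda>_. 0) vs"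
        by (rule ins_cong) (use v in \<open>auto intro!: alt_forms_eq0[OF Suc.prems]\<close>)
      then show ?thesis by simp
    qed
  qed
qed

text \<open>The hypothesis on A is conditional because \<open>con g A\<close> vanishes at lists of
  length less than 2 whatever A is. This agrees with the convention that a contraction is zero below
  degree 2.\<close>

lemma con_alt_forms:
  assumes V: "vclosed V" and g: "alternating_on V g" and A: "2 \<le> k \<Longrightarrow> A \<in> alt_forms V (k - 2)"
  shows "con g A \<in> alt_forms V k"
  using A
proof (induction k arbitrary: A)
  case 0
  show ?case by simp
next
  case (Suc k)
  show ?case
  proof (cases "k = 0")
    case True
    then show ?thesis
      by (intro alt_forms_cong[THEN iffD2, OF _ V alt_forms_zero]) (auto simp: length_Suc_conv)
  next
    case False
    then obtain l where k: "k = Suc l" by (cases k) auto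
    then have A: "A \<in> alt_forms V l" using Suc.prems by simp
    have gl: "linear_on V (g v)" "linear_on V (\<lambda>u. g u v)" "g v v = 0" if "v \<in> vcarrier V" for v
      using g that by (auto simp: alternating_on_def)
    have t: "2 \<le> k \<Longrightarrow> (\<lambda>ws. A (v # ws)) \<in> alt_forms V (k - 2)" if "v \<in> vcarrier V" for v
      using alt_forms_tl[of A V "l - 1" v] A that k by (cases l) auto
    show ?thesis
    proof (rule alt_forms_SucI[OF V])
      show "(\<lambda>vs. con g A (v # vs)) \<in> alt_forms V k" if "v \<in> vcarrier V" for v
        using alt_forms_comb[OF ins_alt_forms[OF V gl(1)[OF that] A, folded k] Suc.IH[OF t[OF that]], of 1 1]
        by simp
      fix vs assume vs: "set vs \<subseteq> vcarrier V"
      show "linear_on V (\<lambda>v. con g A (v # vs))" if len: "length vs = k"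
      proof -
        have 1: "linear_on V (\<lambda>v. ins (g v) A vs)"
          unfolding linear_on_def
        proof (intro conjI ballI allI)
          fix u c assume u: "u \<in> vcarrier V"
          have "ins (g (vscale V c u)) A vs = ins (\<lambda>w. c * g u w + 0 * g u w) A vs"
            by (rule ins_fun_cong) (use gl(2) u vs in \<open>auto simp: linear_on_def subset_iff\<close>)
          then show "ins (g (vscale V c u)) A vs = c * ins (g u) A vs" unfolding ins_fun_comb by simp
          fix v assume v: "v \<in> vcarrier V"
          have "ins (g (vadd V u v)) A vs = ins (\<lambda>w. 1 * g u w + 1 * g v w) A vs"
            by (rule ins_fun_cong) (use gl(2) u v vs in \<open>auto simp: linear_on_def subset_iff\<close>)
          then show "ins (g (vadd V u v)) A vs = ins (g u) A vs + ins (g v) A vs"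
            unfolding ins_fun_comb by simp
        qed
        have 2: "linear_on V (\<lambda>v. con g (\<lambda>ws. A (v # ws)) vs)"
        proof (cases l)
          case 0
          then obtain w where "vs = [w]" using len k by (auto simp: length_Suc_conv)
          then show ?thesis by (simp add: linear_on_def)
        next
          case (Suc l')
          show ?thesis by (rule con_hd_linear[of _ _ l']) (use A Suc vs len k in auto)
        qed
        show ?thesis using linear_on_comb[OF 1 2, of 1 1] by simp
      qed
      show "con g A (v # v # vs) = 0" if v: "v \<in> vcarrier V" "Suc (length vs) = k" for v
      proof -
        \<comment> \<open>Unfolding twice gives \<open>g v v * A vs\<close>, two insertions of
          \<open>g v\<close> that cancel, and this remainder.\<close>
        have "con g (\<lambda>ws. A (v # v # ws)) vs = con g (\<lambda>_. 0) vs"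
          by (rule con_cong) (use v vs k in \<open>auto intro!: alt_forms_eq0[OF A]\<close>)
        then show ?thesis using gl(3)[OF v(1)] by simp
      qed
    qed
  qed
qed

section \<open>Insertion and contraction as signed sums over positions\<close>

lemma nths_Cons_compl:
  "nths (v # vs) (- {Suc j}) = v # nths vs (- {j})"
  "nths (v # vs) (- {0}) = vs"
  "delete2 0 (Suc j) (v # vs) = nths vs (- {j})"
  "delete2 (Suc i) (Suc j) (v # vs) = v # delete2 i j vs"
proof -
  have "{x. Suc x \<in> - {Suc i, Suc j}} = - {i, j}" "{x. Suc x \<in> - {0, Suc j}} = - {j}"
    "{x. Suc x \<in> - {Suc j}} = - {j}" "{x::nat. Suc x \<in> - {0}} = UNIV" for i j by auto
  then show "nths (v # vs) (- {Suc j}) = v # nths vs (- {j})"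
    "nths (v # vs) (- {0}) = vs"
    "delete2 0 (Suc j) (v # vs) = nths vs (- {j})"
    "delete2 (Suc i) (Suc j) (v # vs) = v # delete2 i j vs"
    by (simp_all add: nths_Cons delete2_def nths_all)
qed

lemma ins_eq_sum: "ins f A vs = (\<Sum>j<length vs. (-1) ^ j * f (vs ! j) * A (nths vs (- {j})))"
  by (induction vs arbitrary: A)
    (simp_all add: sum.lessThan_Suc_shift nths_Cons_compl sum_negf algebra_simps del: sum.lessThan_Suc)

text \<open>Links the recursion to the double sum over i < j in \<open>contraction\<close>: the head
  is either one of the two deleted entries, which is the insertion term, or stays in front.\<close>

lemma con_eq_sum:
  "con g A vs = (\<Sum>j<length vs. \<Sum>i<j. (-1) ^ (i + j + 1) * g (vs ! i) (vs ! j) * A (delete2 i j vs))"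
proof (induction vs arbitrary: A)
  case (Cons v vs)
  show ?case
    by (simp add: sum.lessThan_Suc_shift nths_Cons_compl ins_eq_sum Cons sum.distrib algebra_simps
        del: sum.lessThan_Suc)
qed simp

section \<open>Modules with operators satisfying \<open>[D, L] = k - m\<close>\<close>

text \<open>The spaces consist of real functions since multivectors are functionals, so the linear
  structure is pointwise. Truncated subtraction is harmless: below degree 2 the operator D vanishes,
  and \<open>L (k - 2) (D k f)\<close> is then the image of zero. \<open>bounded\<close> takes the
  place of finite dimension.\<close>

locale lefschetz_module =
  fixes M :: "nat \<Rightarrow> ('i \<Rightarrow> real) set" and L D :: "nat \<Rightarrow> ('i \<Rightarrow> real) \<Rightarrow> 'i \<Rightarrow> real" and m :: nat
  assumes comb: "\<And>k a b f h. f \<in> M k \<Longrightarrow> h \<in> M k \<Longrightarrow> (\<lambda>i. a * f i + b * h i) \<in> M k"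
    and zero: "\<And>k. (\<lambda>_. 0) \<in> M k"
    and L_in: "\<And>k f. f \<in> M k \<Longrightarrow> L k f \<in> M (k + 2)"
    and D_in: "\<And>k f. f \<in> M k \<Longrightarrow> D k f \<in> M (k - 2)"
    and L_lin: "\<And>k a b f h. f \<in> M k \<Longrightarrow> h \<in> M k \<Longrightarrow>
      L k (\<lambda>i. a * f i + b * h i) = (\<lambda>i. a * L k f i + b * L k h i)"
    and D_lin: "\<And>k a b f h. f \<in> M k \<Longrightarrow> h \<in> M k \<Longrightarrow>
      D k (\<lambda>i. a * f i + b * h i) = (\<lambda>i. a * D k f i + b * D k h i)"
    and D_low: "\<And>k f. f \<in> M k \<Longrightarrow> k < 2 \<Longrightarrow> D k f = (\<lambda>_. 0)"
    and comm: "\<And>k f. f \<in> M k \<Longrightarrow>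
      D (k + 2) (L k f) = (\<lambda>i. L (k - 2) (D k f) i + (real k - real m) * f i)"
    and bounded: "\<exists>K. \<forall>k\<ge>K. M k \<subseteq> {\<lambda>_. 0}"
begin

primrec Lp :: "nat \<Rightarrow> nat \<Rightarrow> ('i \<Rightarrow> real) \<Rightarrow> 'i \<Rightarrow> real" where
  "Lp k 0 f = f"
| "Lp k (Suc r) f = L (k + 2 * r) (Lp k r f)"

primrec Dp :: "nat \<Rightarrow> nat \<Rightarrow> ('i \<Rightarrow> real) \<Rightarrow> 'i \<Rightarrow> real" where
  "Dp k 0 f = f"
| "Dp k (Suc r) f = D (k - 2 * r) (Dp k r f)"

lemma scale: "f \<in> M k \<Longrightarrow> (\<lambda>i. a * f i) \<in> M k"
  using comb[of f k f a 0] by simp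

lemma L_scale: "f \<in> M k \<Longrightarrow> L k (\<lambda>i. a * f i) = (\<lambda>i. a * L k f i)"
  using L_lin[of f k f a 0] by simp

lemma D_scale: "f \<in> M k \<Longrightarrow> D k (\<lambda>i. a * f i) = (\<lambda>i. a * D k f i)"
  using D_lin[of f k f a 0] by simp

lemma L_zero [simp]: "L k (\<lambda>_. 0) = (\<lambda>_. 0)"
  using L_scale[OF zero, of k 0] by simp

lemma D_zero [simp]: "D k (\<lambda>_. 0) = (\<lambda>_. 0)"
  using D_scale[OF zero, of k 0] by simp

lemma Lp_in: "f \<in> M k \<Longrightarrow> Lp k r f \<in> M (k + 2 * r)"
proof (induction r)
  case (Suc r)
  then show ?case using L_in[of "Lp k r f" "k + 2 * r"] by (simp add: algebra_simps)
qed simp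

lemma Dp_in: "f \<in> M k \<Longrightarrow> Dp k r f \<in> M (k - 2 * r)"
proof (induction r)
  case (Suc r)
  then show ?case using D_in[of "Dp k r f" "k - 2 * r"] by (simp add: algebra_simps)
qed simp

lemma Lp_zero [simp]: "Lp k r (\<lambda>_. 0) = (\<lambda>_. 0)"
  by (induction r) auto

lemma Dp_zero [simp]: "Dp k r (\<lambda>_. 0) = (\<lambda>_. 0)"
  by (induction r) auto

lemma Lp_lin: "f \<in> M k \<Longrightarrow> h \<in> M k \<Longrightarrow>
    Lp k r (\<lambda>i. a * f i + b * h i) = (\<lambda>i. a * Lp k r f i + b * Lp k r h i)"
  by (induction r) (auto simp: L_lin[OF Lp_in Lp_in])

lemma Dp_lin: "f \<in> M k \<Longrightarrow> h \<in> M k \<Longrightarrow>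
    Dp k r (\<lambda>i. a * f i + b * h i) = (\<lambda>i. a * Dp k r f i + b * Dp k r h i)"
  by (induction r) (auto simp: D_lin[OF Dp_in Dp_in])

lemma Dp_scale: "f \<in> M k \<Longrightarrow> Dp k r (\<lambda>i. a * f i) = (\<lambda>i. a * Dp k r f i)"
  using Dp_lin[of f k f r a 0] by simp

lemma Lp_scale: "f \<in> M k \<Longrightarrow> Lp k r (\<lambda>i. a * f i) = (\<lambda>i. a * Lp k r f i)"
  using Lp_lin[of f k f r a 0] by simp

lemma Dp_add: "Dp k (a + b) f = Dp (k - 2 * a) b (Dp k a f)"
  by (induction b) (auto simp: algebra_simps)

lemma Lp_add: "Lp k (a + b) f = Lp (k + 2 * a) b (Lp k a f)"
  by (induction b) (auto simp: algebra_simps)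

lemma Dp_Suc': "Dp k (Suc r) f = Dp (k - 2) r (D k f)"
  using Dp_add[of k 1 r f] by simp

section \<open>Commutation of powers, and injectivity in high degrees\<close>

lemma Dp_high:
  assumes "f \<in> M k" "k < 2 * r" shows "Dp k r f = (\<lambda>_. 0)"
  using assms
proof (induction r)
  case (Suc r)
  show ?case
  proof (cases "k < 2 * r")
    case True
    with Suc show ?thesis by simp
  next
    case False
    then have "k - 2 * r < 2" using Suc.prems by simp
    then show ?thesis using D_low[OF Dp_in[OF Suc.prems(1)]] by simp
  qed
qed simp

text \<open>Moving D past r + 1 factors L collects the commutators k + 2s - m for s = 0, ..., r,
  whose sum is (r + 1)(k - m + r). The remaining term contains D f = 0.\<close>

lemma D_Lp:
  assumes "f \<in> M k" "D k f = (\<lambda>_. 0)"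
  shows "D (k + 2 * Suc r) (Lp k (Suc r) f) =
    (\<lambda>i. (real r + 1) * (real k - real m + real r) * Lp k r f i)"
proof (induction r)
  case 0
  show ?case using comm[OF assms(1)] assms(2) by simp
next
  case (Suc r)
  have e: "k + 2 * Suc (Suc r) = (k + 2 * Suc r) + 2" by simp
  have "D (k + 2 * Suc (Suc r)) (Lp k (Suc (Suc r)) f) =
    (\<lambda>i. L (k + 2 * Suc r - 2) (D (k + 2 * Suc r) (Lp k (Suc r) f)) i
      + (real (k + 2 * Suc r) - real m) * Lp k (Suc r) f i)"
    unfolding e Lp.simps(2)[of k "Suc r"] by (rule comm[OF Lp_in[OF assms(1)]])
  also have "L (k + 2 * Suc r - 2) (D (k + 2 * Suc r) (Lp k (Suc r) f)) =
      (\<lambda>i. (real r + 1) * (real k - real m + real r) * Lp k (Suc r) f i)"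
    unfolding Suc using L_scale[OF Lp_in[OF assms(1)], of r] by simp
  finally show ?case by (simp add: fun_eq_iff algebra_simps)
qed

text \<open>Here the commutators are k - 2s - m for s = 0, ..., p, with sum (p + 1)(k - m - p). The
  bound 2p \<le> k keeps the subtraction of degrees exact.\<close>

lemma Dp_L:
  assumes "f \<in> M k" "2 * p \<le> k"
  shows "Dp (k + 2) (Suc p) (L k f) = (\<lambda>i. L (k - 2 * Suc p) (Dp k (Suc p) f) i
    + (real p + 1) * (real k - real m - real p) * Dp k p f i)"
  using assms(2)
proof (induction p)
  case 0
  show ?case using comm[OF assms(1)] by simp
next
  case (Suc p)
  let ?c = "(real p + 1) * (real k - real m - real p)"
  have k: "k - 2 * p = (k - 2 * Suc p) + 2" using Suc.prems by simp
  have in1: "L (k - 2 * Suc p) (Dp k (Suc p) f) \<in> M (k - 2 * p)"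
    using L_in[OF Dp_in[OF assms(1)], of "Suc p"] k by simp
  have in2: "Dp k p f \<in> M (k - 2 * p)" by (rule Dp_in[OF assms(1)])
  have "Dp (k + 2) (Suc (Suc p)) (L k f) = D (k - 2 * p) (Dp (k + 2) (Suc p) (L k f))"
    by simp
  also have "\<dots> = D (k - 2 * p) (\<lambda>i. 1 * L (k - 2 * Suc p) (Dp k (Suc p) f) i + ?c * Dp k p f i)"
    using Suc by simp
  also have "\<dots> = (\<lambda>i. 1 * D (k - 2 * p) (L (k - 2 * Suc p) (Dp k (Suc p) f)) i + ?c * D (k - 2 * p) (Dp k p f) i)"
    by (rule D_lin[OF in1 in2])
  also have "D (k - 2 * p) (L (k - 2 * Suc p) (Dp k (Suc p) f)) =
      (\<lambda>i. L (k - 2 * Suc p - 2) (D (k - 2 * Suc p) (Dp k (Suc p) f)) i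
        + (real (k - 2 * Suc p) - real m) * Dp k (Suc p) f i)"
    unfolding k by (rule comm[OF Dp_in[OF assms(1)]])
  finally show ?case using Suc.prems
    by (simp add: fun_eq_iff algebra_simps of_nat_diff)
qed

text \<open>Downward induction on the degree: \<open>L f\<close> satisfies the hypothesis two degrees higher, so
  \<open>L f = 0\<close>, and then \<open>L\<close> leads back from \<open>D^p f = 0\<close> to \<open>f = 0\<close>.\<close>

lemma Dp_inj:
  assumes "f \<in> M k" "m + p \<le> k" "Dp k p f = (\<lambda>_. 0)"
  shows "f = (\<lambda>_. 0)"
proof -
  obtain K where K: "\<And>k. k \<ge> K \<Longrightarrow> M k \<subseteq> {\<lambda>_. 0}" using bounded by auto
  show ?thesis
    using assms
  proof (induction "K - k" arbitrary: k f p rule: less_induct)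
    case less
    show ?case
    proof (cases "k \<ge> K")
      case True
      then show ?thesis using K less.prems(1) by auto
    next
      case False
      have "Dp (k + 2) (Suc p) (L k f) = (\<lambda>_. 0)"
      proof (cases "2 * p \<le> k")
        case True
        show ?thesis unfolding Dp_L[OF less.prems(1) True] using less.prems(3) by simp
      next
        case False
        then show ?thesis by (intro Dp_high[OF L_in[OF less.prems(1)]]) simp
      qed
      then have Lf: "L k f = (\<lambda>_. 0)"
        using less.hyps[of "k + 2" "L k f" "Suc p"] L_in[OF less.prems(1)] less.prems(2) False by simp
      have "Dp k (p - q) f = (\<lambda>_. 0)" if "q \<le> p" for q
        using that
      proof (induction q)
        case (Suc q)
        let ?r = "p - Suc q"
        have r: "p - q = Suc ?r" using Suc.prems by simp
        have IH: "Dp k (Suc ?r) f = (\<lambda>_. 0)" using Suc r by simp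
        show ?case
        proof (cases "2 * ?r \<le> k")
          case True
          \<comment> \<open>k - m is at least p, which is larger than
            \<open>p - Suc q\<close>.\<close>
          have "(real ?r + 1) * (real k - real m - real ?r) \<noteq> 0"
            using less.prems(2) Suc.prems by auto
          moreover have "(\<lambda>i. (real ?r + 1) * (real k - real m - real ?r) * Dp k ?r f i) = (\<lambda>_. 0)"
            using Dp_L[OF less.prems(1) True] unfolding IH Lf by simp
          ultimately show ?thesis by (auto simp: fun_eq_iff)
        next
          case False
          then show ?thesis by (intro Dp_high[OF less.prems(1)]) simp
        qed
      qed (use less.prems in simp)
      from this[of p] show ?thesis by simp
    qed
  qed
qed

text \<open>For s = m - j the factor in \<open>D_Lp\<close> is zero, so L^(s + 1) f is again
  primitive, of degree m + s + 2. Above degree m a primitive element is zero by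
  \<open>Dp_inj\<close> with exponent 1; if j > m this applies to f itself.\<close>

lemma Lp_vanish:
  assumes f: "f \<in> M j" "D j f = (\<lambda>_. 0)" and r: "m < j + r"
  shows "Lp j r f = (\<lambda>_. 0)"
proof (cases "m < j")
  case True
  then have "f = (\<lambda>_. 0)" using Dp_inj[of f j 1] f by simp
  then show ?thesis by simp
next
  case False
  define s where "s = m - j"
  have "D (j + 2 * Suc s) (Lp j (Suc s) f) = (\<lambda>_. 0)"
    unfolding D_Lp[OF f] using False by (simp add: s_def of_nat_diff)
  then have "Lp j (Suc s) f = (\<lambda>_. 0)"
    using Dp_inj[OF Lp_in[OF f(1)], of 1 "Suc s"] False by (simp add: s_def)
  moreover have "r = Suc s + (r - Suc s)" using r False by (simp add: s_def)
  ultimately show ?thesis using Lp_add[of j "Suc s" "r - Suc s" f] by simp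
qed

text \<open>The product of the factors from \<open>D_Lp\<close>: the scalar by which D^t L^t acts on
  primitive elements of degree j.\<close>

definition dl_coeff :: "nat \<Rightarrow> nat \<Rightarrow> real" where
  "dl_coeff t j = (\<Prod>s<t. (real s + 1) * (real j - real m + real s))"

lemma Dp_Lp:
  assumes f: "f \<in> M j" "D j f = (\<lambda>_. 0)"
  shows "Dp (j + 2 * t) t (Lp j t f) = (\<lambda>i. dl_coeff t j * f i)"
proof (induction t)
  case 0
  show ?case by (simp add: dl_coeff_def)
next
  case (Suc t)
  have "Dp (j + 2 * Suc t) (Suc t) (Lp j (Suc t) f) =
      Dp (j + 2 * t) t (D (j + 2 * Suc t) (Lp j (Suc t) f))"
    unfolding Dp_Suc' by simp
  also have "\<dots> = (\<lambda>i. (real t + 1) * (real j - real m + real t) * Dp (j + 2 * t) t (Lp j t f) i)"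
    unfolding D_Lp[OF f] by (rule Dp_scale[OF Lp_in[OF f(1)]])
  finally show ?case unfolding Suc by (simp add: dl_coeff_def fun_eq_iff algebra_simps)
qed

lemma Dp_Lp_low:
  assumes f: "f \<in> M j" "D j f = (\<lambda>_. 0)" and "r < t"
  shows "Dp (j + 2 * r) t (Lp j r f) = (\<lambda>_. 0)"
proof -
  have "Dp (j + 2 * r) (Suc r) (Lp j r f) = D j (\<lambda>i. dl_coeff r j * f i)"
    using Dp_Lp[OF f, of r] by simp
  also have "\<dots> = (\<lambda>_. 0)" using D_scale[OF f(1)] f(2) by simp
  finally have "Dp (j + 2 * r) (Suc r) (Lp j r f) = (\<lambda>_. 0)" .
  moreover have "t = Suc r + (t - Suc r)" using assms(3) by simp
  ultimately show ?thesis using Dp_add[of "j + 2 * r" "Suc r" "t - Suc r" "Lp j r f"] by simp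
qed

lemma dl_coeff_zeroE:
  assumes "dl_coeff t j = 0" obtains s where "s < t" "j + s = m"
proof -
  obtain s where "s < t" "real j - real m + real s = 0"
    using assms by (auto simp: dl_coeff_def)
  then have "s < t" "j + s = m" by linarith+
  then show ?thesis by (rule that)
qed

text \<open>If the scalar vanishes, there is s < t with k - 2t + s = m. For i = t - s - 1 the
  element D^i f has degree m + s + 2 and is killed by D^(s + 2), since i + (s + 2) = t + 1. This is
  exactly the degree from which D^(s + 2) is injective, so D^i f = 0, and t > i.\<close>

lemma Dp_top_zero:
  assumes f: "f \<in> M k" and t: "2 * t \<le> k" and z: "Dp k (Suc t) f = (\<lambda>_. 0)"
    and c: "dl_coeff t (k - 2 * t) = 0"
  shows "Dp k t f = (\<lambda>_. 0)"
proof -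
  obtain s where s: "s < t" "k - 2 * t + s = m" using dl_coeff_zeroE[OF c] .
  define i where "i = t - Suc s"
  have "Suc t = i + (s + 2)" using s by (simp add: i_def)
  then have "Dp (k - 2 * i) (s + 2) (Dp k i f) = (\<lambda>_. 0)" using z Dp_add[of k i "s + 2" f] by simp
  then have "Dp k i f = (\<lambda>_. 0)"
    by (rule Dp_inj[OF Dp_in[OF f], rotated]) (use s t in \<open>simp add: i_def\<close>)
  moreover have "t = i + Suc s" using s by (simp add: i_def)
  ultimately show ?thesis using Dp_add[of k i "Suc s" f] by simp
qed

text \<open>D^t f is primitive, so D^t L^t multiplies it by the scalar, which the division undoes.
  If the scalar is zero, the quotient is zero and nothing is subtracted, but then D^t f is already
  zero by \<open>Dp_top_zero\<close>.\<close>

lemma peel_top: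
  assumes f: "f \<in> M k" and t: "2 * t \<le> k" and z: "Dp k (Suc t) f = (\<lambda>_. 0)"
  shows "Dp k t (\<lambda>i. f i - Lp (k - 2 * t) t (\<lambda>i. Dp k t f i / dl_coeff t (k - 2 * t)) i) = (\<lambda>_. 0)"
proof -
  define j where "j = k - 2 * t"
  have k: "k = j + 2 * t" using t by (simp add: j_def)
  let ?b = "Dp k t f" let ?c = "dl_coeff t j"
  have b: "?b \<in> M j" using Dp_in[OF f, of t] by (simp add: j_def)
  have Db: "D j ?b = (\<lambda>_. 0)" using z by (simp add: j_def)
  have Lb: "Lp j t ?b \<in> M k" using Lp_in[OF b] k by simp
  have "Lp j t (\<lambda>i. ?b i / ?c) = (\<lambda>i. (1 / ?c) * Lp j t ?b i)"
    using Lp_scale[OF b, of t "1 / ?c"] by simp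
  then have "Dp k t (\<lambda>i. f i - Lp j t (\<lambda>i. ?b i / ?c) i)
      = Dp k t (\<lambda>i. 1 * f i + (- (1 / ?c)) * Lp j t ?b i)" by simp
  also have "\<dots> = (\<lambda>i. 1 * ?b i + (- (1 / ?c)) * Dp k t (Lp j t ?b) i)"
    by (rule Dp_lin[OF f Lb])
  also have "Dp k t (Lp j t ?b) = (\<lambda>i. ?c * ?b i)"
    using Dp_Lp[OF b Db, of t] k by simp
  also have "(\<lambda>i. 1 * ?b i + (- (1 / ?c)) * (?c * ?b i)) = (\<lambda>_. 0)"
    using Dp_top_zero[OF f t z] by (cases "?c = 0") (auto simp: fun_eq_iff j_def)
  finally show ?thesis by (simp add: j_def)
qed

lemma sum_in: "finite R \<Longrightarrow> (\<And>r. r \<in> R \<Longrightarrow> f r \<in> M k) \<Longrightarrow> (\<lambda>i. \<Sum>r\<in>R. f r i) \<in> M k"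
proof (induction R rule: finite_induct)
  case (insert x F)
  then show ?case using comb[of "f x" k "\<lambda>i. \<Sum>r\<in>F. f r i" 1 1] by simp
qed (simp add: zero)

lemma Dp_sum: "finite R \<Longrightarrow> (\<And>r. r \<in> R \<Longrightarrow> f r \<in> M k) \<Longrightarrow>
    Dp k t (\<lambda>i. \<Sum>r\<in>R. f r i) = (\<lambda>i. \<Sum>r\<in>R. Dp k t (f r) i)"
proof (induction R rule: finite_induct)
  case (insert x F)
  then show ?case using Dp_lin[of "f x" k "\<lambda>i. \<Sum>r\<in>F. f r i" t 1 1] sum_in[of F f k] by simp
qed simp

text \<open>D^T kills all summands with r < T and turns the last one into a multiple of
  \<open>f T\<close>. Either the multiple is nonzero and \<open>f T = 0\<close>, or it is zero and
  L^T kills \<open>f T\<close> by \<open>Lp_vanish\<close>. Hence the vanishing of the summands, and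
  not of the \<open>f r\<close>, is what can be concluded.\<close>

lemma direct_sum:
  assumes "2 * T \<le> k"
    and "\<And>r. r \<le> T \<Longrightarrow> f r \<in> M (k - 2 * r)" "\<And>r. r \<le> T \<Longrightarrow> D (k - 2 * r) (f r) = (\<lambda>_. 0)"
    and "(\<lambda>i. \<Sum>r\<le>T. Lp (k - 2 * r) r (f r) i) = (\<lambda>_. 0)"
    and "r \<le> T"
  shows "Lp (k - 2 * r) r (f r) = (\<lambda>_. 0)"
  using assms
proof (induction T)
  case 0
  then show ?case by simp
next
  case (Suc T)
  let ?l = "\<lambda>r. Lp (k - 2 * r) r (f r)" and ?S = "Suc T"
  have inM: "?l r \<in> M k" if "r \<le> ?S" for r
    using Lp_in[OF Suc.prems(2)[OF that], of r] that Suc.prems(1) by simp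
  have "(\<lambda>i. \<Sum>r\<le>?S. Dp k ?S (?l r) i) = Dp k ?S (\<lambda>i. \<Sum>r\<le>?S. ?l r i)"
    using inM by (subst Dp_sum) auto
  also have "\<dots> = (\<lambda>_. 0)" using Suc.prems(4) by simp
  finally have 1: "(\<Sum>r\<le>?S. Dp k ?S (?l r) i) = 0" for i by (simp add: fun_eq_iff)
  have low: "Dp k ?S (?l r) = (\<lambda>_. 0)" if "r < ?S" for r
    using Dp_Lp_low[OF Suc.prems(2)[of r] Suc.prems(3)[of r] that] that Suc.prems(1) by simp
  have top: "Dp k ?S (?l ?S) = (\<lambda>i. dl_coeff ?S (k - 2 * ?S) * f ?S i)"
    using Dp_Lp[OF Suc.prems(2)[of ?S] Suc.prems(3)[of ?S], of ?S]
    unfolding le_add_diff_inverse2[OF Suc.prems(1)] by (simp del: Dp.simps Lp.simps)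
  have z: "dl_coeff ?S (k - 2 * ?S) * f ?S i = 0" for i
  proof -
    have "(\<Sum>r\<le>T. Dp k ?S (?l r) i) = 0" using low by (intro sum.neutral) (auto simp: less_Suc_eq_le)
    then show ?thesis using 1[of i] top by (simp del: Dp.simps Lp.simps)
  qed
  have l: "?l ?S = (\<lambda>_. 0)"
  proof (cases "dl_coeff ?S (k - 2 * ?S) = 0")
    case True
    then obtain s where "s < ?S" "k - 2 * ?S + s = m" by (rule dl_coeff_zeroE)
    then show ?thesis by (intro Lp_vanish Suc.prems) auto
  next
    case False
    then have "f ?S = (\<lambda>_. 0)" using z by auto
    then show ?thesis by (simp del: Lp.simps)
  qed
  show ?case
  proof (cases "r = ?S")
    case True
    then show ?thesis using l by simp
  next
    case False
    have "(\<lambda>i. \<Sum>r\<le>T. ?l r i) = (\<lambda>_. 0)" using Suc.prems(4) l by (simp del: Lp.simps)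
    then show ?thesis using Suc.IH Suc.prems False by simp
  qed
qed

end

section \<open>Exterior powers of a symplectic vector space\<close>

lemma sum_lessThan_add: "(\<Sum>i<M + N. f i) = (\<Sum>i<M. f i) + (\<Sum>i<N. f (M + i :: nat))"
  for f :: "nat \<Rightarrow> real"
  by (induction N) (auto simp: add.assoc)

lemma ext_powerE:
  assumes "\<xi> \<in> ext_power V k"
  obtains M c vs where "\<forall>i<M::nat. length (vs i) = k \<and> set (vs i) \<subseteq> vcarrier V"
    "\<xi> = (\<lambda>A. \<Sum>i<M. c i * wedge V (vs i) A)"
  using assms unfolding ext_power_def by blast

lemma ext_power_zero: "(\<lambda>_. 0) \<in> ext_power V k"
  unfolding ext_power_def by (auto intro!: exI[of _ 0])

lemma ext_power_comb:
  assumes "\<xi> \<in> ext_power V k" "\<eta> \<in> ext_power V k"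
  shows "(\<lambda>A. a * \<xi> A + b * \<eta> A) \<in> ext_power V k"
proof -
  obtain M c vs where 1: "\<forall>i<M::nat. length (vs i) = k \<and> set (vs i) \<subseteq> vcarrier V"
    "\<xi> = (\<lambda>A. \<Sum>i<M. c i * wedge V (vs i) A)" using assms(1) by (rule ext_powerE)
  obtain N d ws where 2: "\<forall>i<N::nat. length (ws i) = k \<and> set (ws i) \<subseteq> vcarrier V"
    "\<eta> = (\<lambda>A. \<Sum>i<N. d i * wedge V (ws i) A)" using assms(2) by (rule ext_powerE)
  let ?vs = "\<lambda>i. if i < M then vs i else ws (i - M)"
  let ?c = "\<lambda>i. if i < M then a * c i else b * d (i - M)"
  have "(\<lambda>A. a * \<xi> A + b * \<eta> A) = (\<lambda>A. \<Sum>i<M + N. ?c i * wedge V (?vs i) A)"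
    unfolding 1(2) 2(2) sum_lessThan_add by (simp add: sum_distrib_left mult.assoc)
  moreover have "\<forall>i<M + N. length (?vs i) = k \<and> set (?vs i) \<subseteq> vcarrier V" using 1(1) 2(1) by auto
  ultimately show ?thesis unfolding ext_power_def by (intro CollectI exI conjI)
qed

lemma ext_power_wedge:
  assumes "length vs = k" "set vs \<subseteq> vcarrier V" shows "(\<lambda>A. c * wedge V vs A) \<in> ext_power V k"
  unfolding ext_power_def using assms by (auto intro!: exI[of _ 1] exI[of _ "\<lambda>_. c"] exI[of _ "\<lambda>_. vs"])

lemma ext_power_sum:
  assumes "finite I" "\<And>i. i \<in> I \<Longrightarrow> \<xi> i \<in> ext_power V k"
  shows "(\<lambda>A. \<Sum>i\<in>I. \<xi> i A) \<in> ext_power V k"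
  using assms
proof (induction I rule: finite_induct)
  case (insert x F)
  then show ?case using ext_power_comb[of "\<xi> x" V k "\<lambda>A. \<Sum>i\<in>F. \<xi> i A" 1 1] by simp
qed (simp add: ext_power_zero)

lemma ext_power_out:
  assumes "\<xi> \<in> ext_power V k" "A \<notin> alt_forms V k" shows "\<xi> A = 0"
  using assms by (auto simp: ext_power_def wedge_def)

text \<open>A multivector is zero off \<open>alt_forms\<close> by convention, so it is additive only
  on alternating arguments.\<close>

lemma ext_power_lin:
  assumes "\<xi> \<in> ext_power V k" "A \<in> alt_forms V k" "B \<in> alt_forms V k"
  shows "\<xi> (\<lambda>vs. a * A vs + b * B vs) = a * \<xi> A + b * \<xi> B"
proof -
  obtain M c vs where 1: "\<forall>i<M::nat. length (vs i) = k \<and> set (vs i) \<subseteq> vcarrier V"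
    "\<xi> = (\<lambda>A. \<Sum>i<M. c i * wedge V (vs i) A)" using assms(1) by (rule ext_powerE)
  show ?thesis unfolding 1(2) using 1(1) assms alt_forms_comb[OF assms(2,3), of a b]
    by (simp add: wedge_def sum_distrib_left sum.distrib[symmetric] algebra_simps)
qed

lemma ext_power_lin_sum:
  assumes "\<xi> \<in> ext_power V k" "finite I" "\<And>i. i \<in> I \<Longrightarrow> A i \<in> alt_forms V k"
  shows "\<xi> (\<lambda>vs. \<Sum>i\<in>I. c i * A i vs) = (\<Sum>i\<in>I. c i * \<xi> (A i))"
  using assms(2,3)
proof (induction I rule: finite_induct)
  case empty
  show ?case using ext_power_lin[OF assms(1) alt_forms_zero alt_forms_zero, of 0 0] by simp
next
  case (insert x F)
  then show ?case
    using ext_power_lin[OF assms(1), of "A x" "\<lambda>vs. \<Sum>i\<in>F. c i * A i vs" "c x" 1]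
      alt_forms_sum[of F A V k c] by simp
qed

text \<open>Allows an argument to be replaced by one that agrees with it at lists of length k only,
  as for a formula in which \<open>k\<close> stands for \<open>length vs\<close>.\<close>

lemma ext_power_cong:
  assumes V: "vclosed V" and "\<xi> \<in> ext_power V k"
    and "\<And>vs. length vs = k \<Longrightarrow> set vs \<subseteq> vcarrier V \<Longrightarrow> A vs = B vs"
  shows "\<xi> A = \<xi> B"
proof -
  have "A \<in> alt_forms V k \<longleftrightarrow> B \<in> alt_forms V k" by (rule alt_forms_cong[OF assms(3) V])
  then show ?thesis using assms(2,3) by (auto simp: ext_power_def wedge_def intro!: sum.cong)
qed

lemma alt_forms_append:
  assumes "A \<in> alt_forms V (j + k)" "length ws = k" "set ws \<subseteq> vcarrier V"
  shows "(\<lambda>us. A (us @ ws)) \<in> alt_forms V j"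
  unfolding alt_forms_def mem_Collect_eq
proof (intro allI impI)
  fix vs assume vs: "length vs = j \<and> set vs \<subseteq> vcarrier V"
  then have *: "length (vs @ ws) = j + k \<and> set (vs @ ws) \<subseteq> vcarrier V" using assms by auto
  have A: "(\<forall>i<j + k. \<forall>u\<in>vcarrier V. \<forall>w\<in>vcarrier V.
        A ((vs @ ws)[i := vadd V u w]) = A ((vs @ ws)[i := u]) + A ((vs @ ws)[i := w])) \<and>
     (\<forall>i<j + k. \<forall>c. \<forall>u\<in>vcarrier V. A ((vs @ ws)[i := vscale V c u]) = c * A ((vs @ ws)[i := u])) \<and>
     (\<forall>i i'. i < i' \<and> i' < j + k \<and> (vs @ ws) ! i = (vs @ ws) ! i' \<longrightarrow> A (vs @ ws) = 0)"
    using assms(1) * unfolding alt_forms_def by blast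
  have "\<forall>i i'. i < i' \<and> i' < j \<and> vs ! i = vs ! i' \<longrightarrow> A (vs @ ws) = 0"
    using A[THEN conjunct2, THEN conjunct2] vs by (metis nth_append order.strict_trans trans_less_add1)
  then show "(\<forall>i<j. \<forall>u\<in>vcarrier V. \<forall>w\<in>vcarrier V.
        A (vs[i := vadd V u w] @ ws) = A (vs[i := u] @ ws) + A (vs[i := w] @ ws)) \<and>
     (\<forall>i<j. \<forall>c. \<forall>u\<in>vcarrier V. A (vs[i := vscale V c u] @ ws) = c * A (vs[i := u] @ ws)) \<and>
     (\<forall>i i'. i < i' \<and> i' < j \<and> vs ! i = vs ! i' \<longrightarrow> A (vs @ ws) = 0)"
    using A vs by (auto simp: list_update_append1[symmetric])
qed

lemma alt_forms_move:
  assumes V: "vclosed V" and "A \<in> alt_forms V (length vs)" "set vs \<subseteq> vcarrier V" "j < length vs"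
  shows "A (vs ! j # nths vs (- {j})) = (-1) ^ j * A vs"
  using assms(2-)
proof (induction vs arbitrary: A j)
  case (Cons v vs)
  show ?case
  proof (cases j)
    case 0
    then show ?thesis by (simp add: nths_Cons_compl)
  next
    case (Suc i)
    then have i: "i < length vs" using Cons.prems by simp
    then obtain l where l: "length vs = Suc l" by (cases "length vs") auto
    have "length (nths vs (- {i})) = l"
    proof -
      have "{j. j < length vs \<and> j \<in> - {i}} = {..<length vs} - {i}" by auto
      then show ?thesis using i l by (simp add: length_nths)
    qed
    moreover have "set (nths vs (- {i})) \<subseteq> vcarrier V" "vs ! i \<in> vcarrier V"
      using Cons.prems set_nths_subset[of vs] i by auto
    ultimately have "A (vs ! i # v # nths vs (- {i})) = - A (v # vs ! i # nths vs (- {i}))"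
      using Cons.prems l by (intro alt_forms_swap[OF V]) auto
    also have "A (v # vs ! i # nths vs (- {i})) = (-1) ^ i * A (v # vs)"
      by (rule Cons.IH) (use Cons.prems i in \<open>auto intro!: alt_forms_tl\<close>)
    finally show ?thesis using Suc by (simp add: nths_Cons_compl)
  qed
qed simp

lemma delete2_length: "i < j \<Longrightarrow> j < length xs \<Longrightarrow> length (delete2 i j xs) = length xs - 2"
proof -
  assume "i < j" "j < length xs"
  moreover have "{l. l < length xs \<and> l \<noteq> i \<and> l \<noteq> j} = {..<length xs} - {i, j}" by auto
  ultimately show ?thesis by (simp add: delete2_def length_nths card_Diff_subset)
qed

text \<open>In terms of a symplectic form \<open>w = \<Sum> a_p u_p \<and> v_p\<close>, the reproducing property says that the
  endomorphism \<open>w \<circ> G\<close> of \<open>V\<close> is the identity, whence \<open>m\<close> is half the dimension of \<open>V\<close>.\<close>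

locale symplectic_point =
  fixes V :: "'v vspace" and w :: "'v multivector" and g :: "('v \<Rightarrow> real) multivector"
    and P m :: nat and a :: "nat \<Rightarrow> real" and u v :: "nat \<Rightarrow> 'v" and G :: "'v \<Rightarrow> 'v \<Rightarrow> real"
  defines "G \<equiv> bivector_eval g"
  assumes V: "vclosed V"
    and uv: "\<And>p. p < P \<Longrightarrow> u p \<in> vcarrier V" "\<And>p. p < P \<Longrightarrow> v p \<in> vcarrier V"
    and w: "w = (\<lambda>A. \<Sum>p<P. a p * wedge V [u p, v p] A)"
    and G: "alternating_on V G"
    and reproducing: "\<And>l z. linear_on V l \<Longrightarrow> z \<in> vcarrier V \<Longrightarrow>
      (\<Sum>p<P. a p * (G (v p) z * l (u p) - G (u p) z * l (v p))) = l z"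
    and trace: "(\<Sum>p<P. a p * G (u p) (v p)) = - real m"
begin

text \<open>The transpose of the wedge product with w: contraction of the first two arguments of A
  with w.\<close>

definition lef :: "('v list \<Rightarrow> real) \<Rightarrow> 'v list \<Rightarrow> real" where
  "lef A vs = (\<Sum>p<P. a p * A (u p # v p # vs))"

lemma tl2_alt_forms:
  assumes "A \<in> alt_forms V (2 + k)" "x \<in> vcarrier V" "y \<in> vcarrier V"
  shows "(\<lambda>vs. A (x # y # vs)) \<in> alt_forms V k"
  using alt_forms_tl[OF alt_forms_tl] assms by (simp add: eval_nat_numeral)

lemma lef_alt_forms: "A \<in> alt_forms V (2 + k) \<Longrightarrow> lef A \<in> alt_forms V k"
  unfolding lef_def using uv by (intro alt_forms_sum tl2_alt_forms) auto

text \<open>In \<open>wedge_product\<close> the multivector w is evaluated at a function of two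
  vectors, which it notices only if that function is alternating. Expanding \<xi> into decomposable
  elements exhibits it as a combination of forms \<open>A (us @ vs i)\<close>.\<close>

lemma wedge_product_eq:
  assumes "\<xi> \<in> ext_power V k"
  shows "wedge_product V 2 k w \<xi> A = (if A \<in> alt_forms V (2 + k) then \<xi> (lef A) else 0)"
proof (cases "A \<in> alt_forms V (2 + k)")
  case True
  let ?B = "\<lambda>us. \<xi> (\<lambda>vs. A (us @ vs))"
  obtain M c vs where 1: "\<forall>i<M::nat. length (vs i) = k \<and> set (vs i) \<subseteq> vcarrier V"
    "\<xi> = (\<lambda>A. \<Sum>i<M. c i * wedge V (vs i) A)" using assms(1) by (rule ext_powerE)
  have "?B \<in> alt_forms V 2 \<longleftrightarrow> (\<lambda>us. \<Sum>i<M. c i * A (us @ vs i)) \<in> alt_forms V 2"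
  proof (rule alt_forms_cong[OF _ V])
    fix us :: "'v list" assume "length us = 2" "set us \<subseteq> vcarrier V"
    then obtain x y where "us = [x, y]" "x \<in> vcarrier V" "y \<in> vcarrier V"
      by (auto simp: length_Suc_conv eval_nat_numeral)
    then show "?B us = (\<Sum>i<M. c i * A (us @ vs i))"
      using tl2_alt_forms[OF True] 1 by (simp add: wedge_def)
  qed
  moreover have "(\<lambda>us. \<Sum>i<M. c i * A (us @ vs i)) \<in> alt_forms V 2"
    using 1(1) by (intro alt_forms_sum alt_forms_append[OF True]) auto
  ultimately have "wedge_product V 2 k w \<xi> A = (\<Sum>p<P. a p * \<xi> (\<lambda>vs. A (u p # v p # vs)))"
    using True by (simp add: wedge_product_def w wedge_def numeral_2_eq_2)
  also have "\<dots> = \<xi> (lef A)"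
    unfolding lef_def using uv
    by (intro ext_power_lin_sum[OF assms, symmetric] tl2_alt_forms[OF True]) auto
  finally show ?thesis using True by simp
qed (simp add: wedge_product_def)

lemma wedge_product_sum:
  assumes 1: "\<forall>i<M. length (vs i) = k \<and> set (vs i) \<subseteq> vcarrier V"
  shows "wedge_product V 2 k w (\<lambda>A. \<Sum>i<M. c i * wedge V (vs i) A) =
    (\<lambda>A. \<Sum>i<(M::nat). \<Sum>p<P. (c i * a p) * wedge V (u p # v p # vs i) A)"
proof
  fix A
  have xi: "(\<lambda>A. \<Sum>i<M. c i * wedge V (vs i) A) \<in> ext_power V k"
    using 1 by (intro ext_power_sum ext_power_wedge) auto
  show "wedge_product V 2 k w (\<lambda>A. \<Sum>i<M. c i * wedge V (vs i) A) A =
      (\<Sum>i<M. \<Sum>p<P. (c i * a p) * wedge V (u p # v p # vs i) A)"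
    using lef_alt_forms[of A k] 1
    unfolding wedge_product_eq[OF xi]
    by (auto simp: wedge_def lef_def sum_distrib_left mult.assoc)
qed

lemma wedge_product_in:
  assumes "\<xi> \<in> ext_power V k" shows "wedge_product V 2 k w \<xi> \<in> ext_power V (k + 2)"
proof -
  obtain M c vs where 1: "\<forall>i<M::nat. length (vs i) = k \<and> set (vs i) \<subseteq> vcarrier V"
    "\<xi> = (\<lambda>A. \<Sum>i<M. c i * wedge V (vs i) A)" using assms(1) by (rule ext_powerE)
  show ?thesis unfolding 1(2) wedge_product_sum[OF 1(1)]
    using 1(1) uv by (intro ext_power_sum ext_power_wedge) auto
qed

lemma contraction_eq:
  assumes "\<xi> \<in> ext_power V k"
  shows "contraction V k g \<xi> A = (if 2 \<le> k \<and> A \<in> alt_forms V (k - 2) then \<xi> (con G A) else 0)"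
  unfolding contraction_def
  by (auto intro!: ext_power_cong[OF V assms] simp: con_eq_sum G_def)

lemma contraction_sum:
  assumes 1: "\<forall>q<M. length (vs q) = k \<and> set (vs q) \<subseteq> vcarrier V" and k: "2 \<le> k"
  shows "contraction V k g (\<lambda>A. \<Sum>q<M. c q * wedge V (vs q) A) = (\<lambda>A. \<Sum>q<(M::nat). \<Sum>j<k. \<Sum>i<j.
      (c q * (-1) ^ (i + j + 1) * G (vs q ! i) (vs q ! j)) * wedge V (delete2 i j (vs q)) A)"
proof
  fix A
  have xi: "(\<lambda>A. \<Sum>q<M. c q * wedge V (vs q) A) \<in> ext_power V k"
    using 1 by (intro ext_power_sum ext_power_wedge) auto
  show "contraction V k g (\<lambda>A. \<Sum>q<M. c q * wedge V (vs q) A) A = (\<Sum>q<M. \<Sum>j<k. \<Sum>i<j.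
      (c q * (-1) ^ (i + j + 1) * G (vs q ! i) (vs q ! j)) * wedge V (delete2 i j (vs q)) A)"
    using con_alt_forms[OF V G, of k A] 1 k
    unfolding contraction_eq[OF xi]
    by (auto simp: wedge_def con_eq_sum sum_distrib_left mult.assoc delete2_length intro!: sum.cong)
qed

lemma contraction_in:
  assumes "\<xi> \<in> ext_power V k" shows "contraction V k g \<xi> \<in> ext_power V (k - 2)"
proof (cases "2 \<le> k")
  case False
  then show ?thesis by (simp add: contraction_def ext_power_zero)
next
  case True
  obtain M c vs where 1: "\<forall>i<M::nat. length (vs i) = k \<and> set (vs i) \<subseteq> vcarrier V"
    "\<xi> = (\<lambda>A. \<Sum>i<M. c i * wedge V (vs i) A)" using assms(1) by (rule ext_powerE)
  have "set (delete2 i j xs) \<subseteq> set xs" for i j and xs :: "'v list"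
    by (simp add: delete2_def set_nths_subset)
  then show ?thesis unfolding 1(2) contraction_sum[OF 1(1) True]
    using 1(1) by (intro ext_power_sum ext_power_wedge) (fastforce simp: delete2_length)+
qed

text \<open>By the reproducing property the sum over p replaces one entry of vs by itself, so each
  of the k positions contributes \<open>A vs\<close>. This is the identity of V extended as a
  derivation, which multiplies by the degree.\<close>

lemma ins_sum_eq:
  assumes A: "A \<in> alt_forms V k" and vs: "length vs = k" "set vs \<subseteq> vcarrier V"
  shows "(\<Sum>p<P. a p * (ins (G (v p)) (\<lambda>ws. A (u p # ws)) vs - ins (G (u p)) (\<lambda>ws. A (v p # ws)) vs)) =
    real k * A vs"
proof -
  have "(\<Sum>p<P. a p * (ins (G (v p)) (\<lambda>ws. A (u p # ws)) vs - ins (G (u p)) (\<lambda>ws. A (v p # ws)) vs)) =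
      (\<Sum>j<k. (-1) ^ j * (\<Sum>p<P. a p * (G (v p) (vs ! j) * A (u p # nths vs (- {j}))
        - G (u p) (vs ! j) * A (v p # nths vs (- {j})))))"
    unfolding ins_eq_sum vs(1) sum_subtractf[symmetric] sum_distrib_left
    by (subst sum.swap) (simp add: algebra_simps)
  also have "\<dots> = (\<Sum>j<k. A vs)"
  proof (rule sum.cong[OF refl])
    fix j assume j: "j \<in> {..<k}"
    have zj: "vs ! j \<in> vcarrier V" using vs j by auto
    have "{i. i < length vs \<and> i \<in> - {j}} = {..<length vs} - {j}" by auto
    then have len: "Suc (length (nths vs (- {j}))) = k" using j vs by (simp add: length_nths)
    have l: "linear_on V (\<lambda>z. A (z # nths vs (- {j})))"
      using A len vs set_nths_subset[of vs "- {j}"] by (intro alt_forms_hd_linear[OF _ refl]) auto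
    have "(\<Sum>p<P. a p * (G (v p) (vs ! j) * A (u p # nths vs (- {j}))
        - G (u p) (vs ! j) * A (v p # nths vs (- {j})))) = (-1) ^ j * A vs"
      using reproducing[OF l zj] alt_forms_move[OF V, of A vs j] A vs j by simp
    then show "(-1) ^ j * (\<Sum>p<P. a p * (G (v p) (vs ! j) * A (u p # nths vs (- {j}))
        - G (u p) (vs ! j) * A (v p # nths vs (- {j})))) = A vs"
      by (simp add: power_mult_distrib[symmetric])
  qed
  finally show ?thesis by simp
qed

text \<open>A contraction of u_p, v_p, vs with G removes both new vectors, one of them, or none. The
  three cases give the trace -m, the degree k of \<open>ins_sum_eq\<close>, and
  \<open>con G (lef A)\<close>.\<close>

lemma lef_con:
  assumes A: "A \<in> alt_forms V k" and vs: "length vs = k" "set vs \<subseteq> vcarrier V"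
  shows "lef (con G A) vs = con G (lef A) vs + (real k - real m) * A vs"
proof -
  have "lef (con G A) vs = (\<Sum>p<P. a p * G (u p) (v p)) * A vs
      + (\<Sum>p<P. a p * (ins (G (v p)) (\<lambda>ws. A (u p # ws)) vs - ins (G (u p)) (\<lambda>ws. A (v p # ws)) vs))
      + (\<Sum>p<P. a p * con G (\<lambda>ws. A (u p # v p # ws)) vs)"
    by (simp add: lef_def sum_distrib_left sum.distrib sum_subtractf algebra_simps)
  also have "(\<Sum>p<P. a p * con G (\<lambda>ws. A (u p # v p # ws)) vs) = con G (lef A) vs"
    unfolding lef_def by (simp add: con_sum)
  finally show ?thesis unfolding ins_sum_eq[OF assms] trace by (simp add: algebra_simps)
qed

lemma con_short: "length vs < 2 \<Longrightarrow> con G A vs = 0"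
  by (cases vs) auto

text \<open>The transpose of \<open>lef_con\<close>, whence the order of the operators is reversed.
  The case distinctions reconcile the truncated degree k - 2 with the value zero off
  \<open>alt_forms\<close>.\<close>

lemma commutator:
  assumes xi: "\<xi> \<in> ext_power V k"
  shows "contraction V (k + 2) g (wedge_product V 2 k w \<xi>) A =
    wedge_product V 2 (k - 2) w (contraction V k g \<xi>) A + (real k - real m) * \<xi> A"
proof (cases "A \<in> alt_forms V k")
  case False
  then have "wedge_product V 2 (k - 2) w (contraction V k g \<xi>) A = 0"
  proof (cases "2 \<le> k")
    case True
    then have "2 + (k - 2) = k" by simp
    then show ?thesis using False unfolding wedge_product_def by (simp only: if_False)
  next
    case f: False
    then have "contraction V k g \<xi> = (\<lambda>_. 0)" by (simp add: contraction_def)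
    then show ?thesis using f by (simp add: wedge_product_eq[OF ext_power_zero])
  qed
  then show ?thesis using False ext_power_out[OF xi False] by (simp add: contraction_def)
next
  case A: True
  have cA: "con G A \<in> alt_forms V (2 + k)" using A by (intro con_alt_forms[OF V G]) simp
  have lA: "lef A \<in> alt_forms V (k - 2)" if "2 \<le> k"
  proof -
    have "2 + (k - 2) = k" using that by simp
    then show ?thesis using lef_alt_forms[of A "k - 2"] A by (simp only:)
  qed
  have clA: "con G (lef A) \<in> alt_forms V k" by (intro con_alt_forms[OF V G] lA)
  have "contraction V (k + 2) g (wedge_product V 2 k w \<xi>) A = \<xi> (lef (con G A))"
    unfolding contraction_eq[OF wedge_product_in[OF xi]] wedge_product_eq[OF xi]
    using A cA by simp
  also have "\<dots> = \<xi> (\<lambda>vs. 1 * con G (lef A) vs + (real k - real m) * A vs)"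
    by (rule ext_power_cong[OF V xi]) (simp add: lef_con[OF A])
  also have "\<dots> = 1 * \<xi> (con G (lef A)) + (real k - real m) * \<xi> A"
    by (rule ext_power_lin[OF xi clA A])
  also have "\<xi> (con G (lef A)) = wedge_product V 2 (k - 2) w (contraction V k g \<xi>) A"
  proof (cases "2 \<le> k")
    case True
    then have "2 + (k - 2) = k" by simp
    then show ?thesis using A lA True
      unfolding wedge_product_eq[OF contraction_in[OF xi]] contraction_eq[OF xi] by simp
  next
    case False
    then have "\<xi> (con G (lef A)) = \<xi> (\<lambda>vs. 0 * A vs + 0 * A vs)"
      by (intro ext_power_cong[OF V xi]) (simp add: con_short)
    also have "\<dots> = 0" unfolding ext_power_lin[OF xi A A] by simp
    also have "\<dots> = wedge_product V 2 (k - 2) w (contraction V k g \<xi>) A"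
      by (simp add: wedge_product_eq[OF contraction_in[OF xi]] contraction_eq[OF xi] False)
    finally show ?thesis .
  qed
  finally show ?thesis by simp
qed

text \<open>By the reproducing property a linear form is determined by its values at the u_p and
  v_p; this is applied to one argument after the other.\<close>

lemma alt_forms_gens:
  assumes "A \<in> alt_forms V k"
    and "\<And>vs. length vs = k \<Longrightarrow> set vs \<subseteq> u ` {..<P} \<union> v ` {..<P} \<Longrightarrow> A vs = 0"
    and "length vs = k" "set vs \<subseteq> vcarrier V"
  shows "A vs = 0"
  using assms
proof (induction k arbitrary: A vs)
  case 0
  then show ?case by simp
next
  case (Suc k)
  obtain z zs where vs: "vs = z # zs" using Suc.prems by (cases vs) auto
  have zs: "length zs = k" "set zs \<subseteq> vcarrier V" and z: "z \<in> vcarrier V" using vs Suc.prems by auto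
  have *: "A (x # zs) = 0" if x: "x \<in> u ` {..<P} \<union> v ` {..<P}" for x
  proof (rule Suc.IH[OF alt_forms_tl[OF Suc.prems(1)] _ zs])
    show "x \<in> vcarrier V" using uv x by auto
    show "A (x # vs) = 0" if "length vs = k" "set vs \<subseteq> u ` {..<P} \<union> v ` {..<P}" for vs
      using that x by (intro Suc.prems(2)) auto
  qed
  have "A (z # zs) = (\<Sum>p<P. a p * (G (v p) z * A (u p # zs) - G (u p) z * A (v p # zs)))"
    using reproducing[OF alt_forms_hd_linear[OF Suc.prems(1) zs] z] by simp
  also have "\<dots> = 0" using * by (intro sum.neutral) auto
  finally show ?case using vs by simp
qed

text \<open>A list of more than 2P entries taken from the 2P vectors u_p, v_p has a repetition. The
  number of generators serves as the bound, which suffices for \<open>bounded\<close>.\<close>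

lemma ext_power_trivial:
  assumes "2 * P < k" "\<xi> \<in> ext_power V k" shows "\<xi> = (\<lambda>_. 0)"
proof -
  have "A vs = 0" if "A \<in> alt_forms V k" "length vs = k" "set vs \<subseteq> vcarrier V" for A vs
  proof (rule alt_forms_gens[OF that(1) _ that(2,3)])
    fix vs assume vs: "length vs = k" "set vs \<subseteq> u ` {..<P} \<union> v ` {..<P}"
    have "card (set vs) \<le> card (u ` {..<P} \<union> v ` {..<P})" using vs by (intro card_mono) auto
    also have "\<dots> \<le> card (u ` {..<P}) + card (v ` {..<P})" by (rule card_Un_le)
    also have "\<dots> \<le> 2 * P" using card_image_le[of "{..<P}" u] card_image_le[of "{..<P}" v] by simp
    finally have "\<not> distinct vs" using vs assms(1) distinct_card[of vs] by auto
    moreover have "set vs \<subseteq> vcarrier V" using vs uv by auto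
    ultimately show "A vs = 0" by (intro alt_forms_eq0[OF that(1) vs(1)])
  qed
  then show ?thesis using assms(2)
    by (auto simp: ext_power_def wedge_def fun_eq_iff intro!: sum.neutral)
qed

sublocale lefschetz_module "ext_power V" "\<lambda>k. wedge_product V 2 k w" "\<lambda>k. contraction V k g" m
proof
  fix k a b and \<xi> \<eta> :: "'v multivector"
  assume xi: "\<xi> \<in> ext_power V k"
  show "wedge_product V 2 k w \<xi> \<in> ext_power V (k + 2)" "contraction V k g \<xi> \<in> ext_power V (k - 2)"
    using xi by (rule wedge_product_in contraction_in)+
  show "contraction V k g \<xi> = (\<lambda>_. 0)" if "k < 2" using that by (simp add: contraction_def)
  show "contraction V (k + 2) g (wedge_product V 2 k w \<xi>) =
    (\<lambda>A. wedge_product V 2 (k - 2) w (contraction V k g \<xi>) A + (real k - real m) * \<xi> A)"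
    using commutator[OF xi] by (simp add: fun_eq_iff)
  assume eta: "\<eta> \<in> ext_power V k"
  show c: "(\<lambda>A. a * \<xi> A + b * \<eta> A) \<in> ext_power V k" using xi eta by (rule ext_power_comb)
  show "wedge_product V 2 k w (\<lambda>A. a * \<xi> A + b * \<eta> A) =
      (\<lambda>A. a * wedge_product V 2 k w \<xi> A + b * wedge_product V 2 k w \<eta> A)"
    by (simp add: fun_eq_iff wedge_product_eq[OF xi] wedge_product_eq[OF eta] wedge_product_eq[OF c])
  show "contraction V k g (\<lambda>A. a * \<xi> A + b * \<eta> A) =
      (\<lambda>A. a * contraction V k g \<xi> A + b * contraction V k g \<eta> A)"
    by (simp add: fun_eq_iff contraction_def)
next
  show "\<exists>K. \<forall>k\<ge>K. ext_power V k \<subseteq> {\<lambda>_. 0}"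
    by (intro exI[of _ "2 * P + 1"]) (auto dest!: ext_power_trivial[rotated])
qed (rule ext_power_zero)

end

section \<open>Smooth functions\<close>

abbreviation (input) cube :: "nat \<Rightarrow> (nat \<Rightarrow> real) \<Rightarrow> real \<Rightarrow> (nat \<Rightarrow> real) set" where
  "cube n y e \<equiv> {z \<in> topspace (Euclidean_space n). \<forall>i<n. \<bar>z i - y i\<bar> < e}"

lemma openin_Euclidean_boxD:
  assumes "openin (Euclidean_space n) W" "y \<in> W"
  shows "\<exists>e>0. cube n y e \<subseteq> W"
proof -
  obtain O' where O': "openin (powertop_real UNIV) O'" "W = O' \<inter> {x. \<forall>i\<ge>n. x i = 0}"
    using assms(1) unfolding Euclidean_space_def openin_subtopology by auto
  then obtain U where U: "finite {i. U i \<noteq> UNIV}" "\<And>i. open (U i)" "y \<in> Pi\<^sub>E UNIV U" "Pi\<^sub>E UNIV U \<subseteq> O'"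
    using assms(2) unfolding openin_product_topology_alt by auto
  have "\<exists>e>0. \<forall>t. \<bar>t - y i\<bar> < e \<longrightarrow> t \<in> U i" for i
    using U(2)[of i] U(3) unfolding open_dist by (auto simp: dist_real_def PiE_def)
  then obtain e where e: "\<And>i. e i > 0" "\<And>i t. \<bar>t - y i\<bar> < e i \<Longrightarrow> t \<in> U i" by metis
  let ?e = "Min (insert 1 (e ` {..<n}))"
  have "?e > 0" using e by auto
  moreover have "cube n y ?e \<subseteq> W"
  proof
    fix z assume z: "z \<in> cube n y ?e"
    have "z i \<in> U i" for i
    proof (cases "i < n")
      case True
      then have "?e \<le> e i" by (intro Min_le) auto
      then show ?thesis using z True by (intro e(2)) (auto intro: less_le_trans)
    next
      case False
      then have "z i = y i" using z O'(2) assms(2) by (auto simp: topspace_Euclidean_space)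
      then show ?thesis using e by simp
    qed
    then have "z \<in> O'" using U(4) by (auto simp: PiE_def)
    then show "z \<in> W" using z O'(2) by (auto simp: topspace_Euclidean_space)
  qed
  ultimately show ?thesis by blast
qed

lemma openin_Euclidean_box: "openin (Euclidean_space n) (cube n y e)"
proof -
  let ?X = "\<lambda>i. if i < n then {y i - e<..<y i + e} else UNIV"
  have "openin (powertop_real UNIV) (Pi\<^sub>E UNIV ?X)"
    by (rule product_topology_basis) (auto intro: finite_subset[of _ "{..<n}"])
  moreover have "x i \<in> ?X i \<longleftrightarrow> (i < n \<longrightarrow> \<bar>x i - y i\<bar> < e)" for x i by auto
  then have "cube n y e = Pi\<^sub>E UNIV ?X \<inter> {x. \<forall>i\<ge>n. x i = 0}"
    by (simp only: set_eq_iff PiE_iff) (auto simp: topspace_Euclidean_space)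
  ultimately show ?thesis unfolding Euclidean_space_def openin_subtopology by blast
qed

lemma openin_EuclideanI:
  assumes "W \<subseteq> topspace (Euclidean_space n)" "\<And>y. y \<in> W \<Longrightarrow> \<exists>e>0. cube n y e \<subseteq> W"
  shows "openin (Euclidean_space n) W"
proof (subst openin_subopen, intro ballI)
  fix y assume y: "y \<in> W"
  then obtain e where "e > 0" "cube n y e \<subseteq> W" using assms(2) by blast
  moreover have "y \<in> cube n y e" using y assms(1) \<open>e > 0\<close> by auto
  ultimately show "\<exists>T. openin (Euclidean_space n) T \<and> y \<in> T \<and> T \<subseteq> W"
    using openin_Euclidean_box by (intro exI[of _ "cube n y e"] conjI)
qed

lemma continuous_Euclidean_iff:
  assumes W: "openin (Euclidean_space n) W"
  shows "continuous_map (subtopology (Euclidean_space n) W) euclideanreal f \<longleftrightarrow>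
    (\<forall>y\<in>W. \<forall>e>0. \<exists>d>0. \<forall>z\<in>cube n y d. z \<in> W \<and> \<bar>f z - f y\<bar> < e)"
proof -
  have top: "topspace (subtopology (Euclidean_space n) W) = W"
    using openin_subset[OF W] by auto
  show ?thesis
  proof (intro iffI ballI allI impI)
    fix y and e :: real assume f: "continuous_map (subtopology (Euclidean_space n) W) euclideanreal f"
      and y: "y \<in> W" and e: "e > 0"
    have "openin (subtopology (Euclidean_space n) W) {z \<in> W. f z \<in> ball (f y) e}"
      using f unfolding continuous_map_def top by auto
    then have "openin (Euclidean_space n) {z \<in> W. f z \<in> ball (f y) e}"
      using W by (simp add: openin_open_subtopology)
    then obtain d where "d > 0" "cube n y d \<subseteq> {z \<in> W. f z \<in> ball (f y) e}"
      using openin_Euclidean_boxD[of n "{z \<in> W. f z \<in> ball (f y) e}" y] y e by auto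
    then show "\<exists>d>0. \<forall>z\<in>cube n y d. z \<in> W \<and> \<bar>f z - f y\<bar> < e"
      by (auto simp: dist_real_def abs_minus_commute)
  next
    assume R: "\<forall>y\<in>W. \<forall>e>0. \<exists>d>0. \<forall>z\<in>cube n y d. z \<in> W \<and> \<bar>f z - f y\<bar> < e"
    show "continuous_map (subtopology (Euclidean_space n) W) euclideanreal f"
      unfolding continuous_map_def top
    proof (intro conjI allI impI)
      fix O' :: "real set" assume "openin euclideanreal O'"
      then have O': "open O'" by simp
      have "openin (Euclidean_space n) {x \<in> W. f x \<in> O'}"
      proof (rule openin_EuclideanI)
        fix y assume "y \<in> {x \<in> W. f x \<in> O'}"
        then obtain e where e: "e > 0" "ball (f y) e \<subseteq> O'" "y \<in> W" using O'[unfolded open_contains_ball] by auto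
        then obtain d where "d > 0" "\<forall>z\<in>cube n y d. z \<in> W \<and> \<bar>f z - f y\<bar> < e" using R by blast
        then show "\<exists>d>0. cube n y d \<subseteq> {x \<in> W. f x \<in> O'}"
          using e by (intro exI[of _ d]) (auto simp: dist_real_def abs_minus_commute subset_iff)
      qed (use openin_subset[OF W] in auto)
      then show "openin (subtopology (Euclidean_space n) W) {x \<in> W. f x \<in> O'}"
        using W by (simp add: openin_open_subtopology)
    qed simp
  qed
qed

section \<open>Partial derivatives and functions of class C^k\<close>

lemma eventually_line_in:
  assumes W: "openin (Euclidean_space n) W" and y: "y \<in> W" and i: "i < n"
  shows "\<forall>\<^sub>F t in nhds (y i). y(i := t) \<in> W"
proof -
  obtain e where e: "e > 0" "cube n y e \<subseteq> W" using openin_Euclidean_boxD[OF W y] by blast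
  have "y(i := t) \<in> W" if "dist t (y i) < e" for t
    using that openin_subset[OF W] y i e by (auto simp: dist_real_def topspace_Euclidean_space subset_iff)
  then show ?thesis using e(1) unfolding eventually_nhds_metric by blast
qed

text \<open>A relation, so that a derivative can be supplied as a formula d; on W it determines
  \<open>partial_deriv\<close>.\<close>

definition partial_on :: "nat \<Rightarrow> (nat \<Rightarrow> real) set \<Rightarrow> ((nat \<Rightarrow> real) \<Rightarrow> real) \<Rightarrow> nat \<Rightarrow> ((nat \<Rightarrow> real) \<Rightarrow> real) \<Rightarrow> bool" where
  "partial_on n W f i d \<longleftrightarrow> (\<forall>y\<in>W. ((\<lambda>t. f (y(i := t))) has_real_derivative d y) (at (y i)))"

lemma C_k_on_SucD:
  assumes "C_k_on (Suc k) n W f" "i < n"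
  shows "partial_on n W f i (partial_deriv i f)" "C_k_on k n W (partial_deriv i f)"
  using assms
  by (auto simp: partial_on_def partial_deriv_def DERIV_deriv_iff_real_differentiable)

lemma partial_on_unique:
  "partial_on n W f i d \<Longrightarrow> y \<in> W \<Longrightarrow> partial_deriv i f y = d y"
  by (auto simp: partial_on_def partial_deriv_def intro!: DERIV_imp_deriv)

text \<open>Functions are total, but values off W have no influence on derivatives: W is open, so a
  coordinate line through a point of W stays in W for a while.\<close>

lemma partial_on_cong:
  assumes W: "openin (Euclidean_space n) W" and i: "i < n" and eq: "\<And>y. y \<in> W \<Longrightarrow> f y = h y"
    and f: "partial_on n W f i d"
  shows "partial_on n W h i d"
  unfolding partial_on_def
proof
  fix y assume y: "y \<in> W"
  have "\<forall>\<^sub>F t in nhds (y i). f (y(i := t)) = h (y(i := t))"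
    using eventually_line_in[OF W y i] by (rule eventually_mono) (rule eq)
  from DERIV_cong_ev[OF refl this refl, THEN iffD1] f y
  show "((\<lambda>t. h (y(i := t))) has_real_derivative d y) (at (y i))" unfolding partial_on_def by blast
qed

lemma C_k_on_cont: "C_k_on k n W f \<Longrightarrow> continuous_map (subtopology (Euclidean_space n) W) euclideanreal f"
  by (cases k) auto

lemma continuous_map_cong_on:
  assumes "\<And>y. y \<in> W \<Longrightarrow> f y = h y" "continuous_map (subtopology T W) Y f"
  shows "continuous_map (subtopology T W) Y h"
  by (rule continuous_map_eq[OF assms(2)]) (use assms(1) in auto)

lemma C_k_on_cong:
  assumes W: "openin (Euclidean_space n) W" and "C_k_on k n W f" "\<And>y. y \<in> W \<Longrightarrow> f y = h y"
  shows "C_k_on k n W h"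
  using assms(2,3)
proof (induction k arbitrary: f h)
  case 0
  then show ?case using continuous_map_cong_on[of W f h] by simp
next
  case (Suc k)
  have p: "partial_on n W h i (partial_deriv i f)" if "i < n" for i
    using partial_on_cong[OF W that Suc.prems(2) C_k_on_SucD(1)[OF Suc.prems(1) that]] .
  have "C_k_on k n W (partial_deriv i h)" if "i < n" for i
    by (rule Suc.IH[OF C_k_on_SucD(2)[OF Suc.prems(1) that]]) (rule partial_on_unique[OF p[OF that], symmetric])
  moreover have "(\<lambda>t. h (y(i := t))) differentiable at (y i)" if "i < n" "y \<in> W" for i y
    using p[OF that(1)] that(2) by (auto simp: partial_on_def real_differentiable_def)
  moreover have "continuous_map (subtopology (Euclidean_space n) W) euclideanreal h"
    using continuous_map_cong_on[of W f h] C_k_on_cont[OF Suc.prems(1)] Suc.prems(2) by blast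
  ultimately show ?case by simp
qed

lemma C_k_on_SucI:
  assumes W: "openin (Euclidean_space n) W"
    and "continuous_map (subtopology (Euclidean_space n) W) euclideanreal f"
    and "\<And>i. i < n \<Longrightarrow> partial_on n W f i (d i)" "\<And>i. i < n \<Longrightarrow> C_k_on k n W (d i)"
  shows "C_k_on (Suc k) n W f"
proof -
  have "C_k_on k n W (partial_deriv i f)" if "i < n" for i
    by (rule C_k_on_cong[OF W assms(4)[OF that]]) (rule partial_on_unique[OF assms(3)[OF that], symmetric])
  then show ?thesis using assms(2,3) by (auto simp: partial_on_def real_differentiable_def)
qed

lemma C_k_on_Suc_le: "C_k_on (Suc k) n W f \<Longrightarrow> C_k_on k n W f"
  by (induction k arbitrary: f) auto

lemma C_k_on_subset:
  assumes "openin (Euclidean_space n) W'" "W' \<subseteq> W" "C_k_on k n W f"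
  shows "C_k_on k n W' f"
  using assms(3)
proof (induction k arbitrary: f)
  case 0
  then show ?case using continuous_map_from_subtopology_mono[OF _ assms(2)] by auto
next
  case (Suc k)
  then show ?case using continuous_map_from_subtopology_mono[OF _ assms(2)] assms(2) by auto
qed

lemma C_k_on_local:
  assumes W: "openin (Euclidean_space n) W"
    and "\<And>y. y \<in> W \<Longrightarrow> \<exists>W'. openin (Euclidean_space n) W' \<and> y \<in> W' \<and> W' \<subseteq> W \<and> C_k_on k n W' f"
  shows "C_k_on k n W f"
  using assms(2)
proof (induction k arbitrary: f)
  case 0
  show ?case unfolding C_k_on.simps continuous_Euclidean_iff[OF W]
  proof (intro ballI allI impI)
    fix y and e :: real assume y: "y \<in> W" and e: "e > 0"
    obtain W' where W': "openin (Euclidean_space n) W'" "y \<in> W'" "W' \<subseteq> W" "C_k_on 0 n W' f"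
      using 0[OF y] by blast
    show "\<exists>d>0. \<forall>z\<in>cube n y d. z \<in> W \<and> \<bar>f z - f y\<bar> < e"
      using W'(4)[unfolded C_k_on.simps continuous_Euclidean_iff[OF W'(1)], rule_format, OF W'(2) e] W'(3)
      by blast
  qed
next
  case (Suc k)
  have "continuous_map (subtopology (Euclidean_space n) W) euclideanreal f"
    unfolding continuous_Euclidean_iff[OF W]
  proof (intro ballI allI impI)
    fix y and e :: real assume y: "y \<in> W" and e: "e > 0"
    obtain W' where W': "openin (Euclidean_space n) W'" "y \<in> W'" "W' \<subseteq> W" "C_k_on (Suc k) n W' f"
      using Suc.prems[OF y] by blast
    show "\<exists>d>0. \<forall>z\<in>cube n y d. z \<in> W \<and> \<bar>f z - f y\<bar> < e"
      using C_k_on_cont[OF W'(4), unfolded continuous_Euclidean_iff[OF W'(1)], rule_format, OF W'(2) e] W'(3)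
      by blast
  qed
  moreover have "C_k_on k n W (partial_deriv i f)" if "i < n" for i
  proof (rule Suc.IH)
    fix y assume y: "y \<in> W"
    show "\<exists>W'. openin (Euclidean_space n) W' \<and> y \<in> W' \<and> W' \<subseteq> W \<and> C_k_on k n W' (partial_deriv i f)"
      using Suc.prems[OF y] that by auto
  qed
  moreover have "(\<lambda>t. f (y(i := t))) differentiable at (y i)" if "i < n" "y \<in> W" for i y
    using Suc.prems[OF that(2)] that(1) by auto
  ultimately show ?case by simp
qed

lemma C_k_on_const: "openin (Euclidean_space n) W \<Longrightarrow> C_k_on k n W (\<lambda>_. c)"
proof (induction k arbitrary: c)
  case (Suc k)
  show ?case by (rule C_k_on_SucI[OF Suc.prems, where d = "\<lambda>_ _. 0"])
      (auto simp: partial_on_def intro!: Suc)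
qed simp

lemma C_k_on_add:
  assumes W: "openin (Euclidean_space n) W" and "C_k_on k n W f" "C_k_on k n W h"
  shows "C_k_on k n W (\<lambda>y. f y + h y)"
  using assms(2,3)
proof (induction k arbitrary: f h)
  case 0
  then show ?case by (simp add: continuous_map_add)
next
  case (Suc k)
  show ?case
  proof (rule C_k_on_SucI[OF W, where d = "\<lambda>i y. partial_deriv i f y + partial_deriv i h y"])
    show "continuous_map (subtopology (Euclidean_space n) W) euclideanreal (\<lambda>y. f y + h y)"
      by (intro continuous_map_add C_k_on_cont[OF Suc.prems(1)] C_k_on_cont[OF Suc.prems(2)])
    fix i assume "i < n"
    note D = C_k_on_SucD[OF Suc.prems(1) this] C_k_on_SucD[OF Suc.prems(2) this]
    show "C_k_on k n W (\<lambda>y. partial_deriv i f y + partial_deriv i h y)" using D by (intro Suc.IH)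
    show "partial_on n W (\<lambda>y. f y + h y) i (\<lambda>y. partial_deriv i f y + partial_deriv i h y)"
      using D(1,3) by (auto simp: partial_on_def intro!: DERIV_add)
  qed
qed

lemma C_k_on_mult:
  assumes W: "openin (Euclidean_space n) W" and "C_k_on k n W f" "C_k_on k n W h"
  shows "C_k_on k n W (\<lambda>y. f y * h y)"
  using assms(2,3)
proof (induction k arbitrary: f h)
  case 0
  then show ?case by (simp add: continuous_map_real_mult)
next
  case (Suc k)
  show ?case
  proof (rule C_k_on_SucI[OF W, where d = "\<lambda>i y. partial_deriv i f y * h y + partial_deriv i h y * f y"])
    show "continuous_map (subtopology (Euclidean_space n) W) euclideanreal (\<lambda>y. f y * h y)"
      by (intro continuous_map_real_mult C_k_on_cont[OF Suc.prems(1)] C_k_on_cont[OF Suc.prems(2)])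
    fix i assume "i < n"
    note D = C_k_on_SucD[OF Suc.prems(1) this] C_k_on_SucD[OF Suc.prems(2) this]
    show "C_k_on k n W (\<lambda>y. partial_deriv i f y * h y + partial_deriv i h y * f y)"
      by (intro C_k_on_add[OF W] Suc.IH D C_k_on_Suc_le[OF Suc.prems(1)] C_k_on_Suc_le[OF Suc.prems(2)])
    show "partial_on n W (\<lambda>y. f y * h y) i (\<lambda>y. partial_deriv i f y * h y + partial_deriv i h y * f y)"
      using D(1,3) unfolding partial_on_def
      by (auto intro!: DERIV_mult[where x = "_ i" and f = "\<lambda>t. f (_(_ := t))", THEN DERIV_cong])
  qed
qed

lemma C_k_on_sum:
  assumes "openin (Euclidean_space n) W" "finite I" "\<And>i. i \<in> I \<Longrightarrow> C_k_on k n W (f i)"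
  shows "C_k_on k n W (\<lambda>y. \<Sum>i\<in>I. f i y)"
  using assms(2,3)
  by (induction I rule: finite_induct) (auto intro!: C_k_on_const C_k_on_add assms(1))

lemma continuous_map_coord: "continuous_map (subtopology (Euclidean_space n) W) euclideanreal (\<lambda>y. y i)"
  unfolding Euclidean_space_def
  by (intro continuous_map_from_subtopology) (rule continuous_map_product_projection, simp)

lemma C_k_on_coord:
  assumes W: "openin (Euclidean_space n) W"
  shows "C_k_on k n W (\<lambda>y. y j)"
proof (cases k)
  case 0
  then show ?thesis by (simp add: continuous_map_coord)
next
  case (Suc l)
  show ?thesis unfolding Suc
  proof (rule C_k_on_SucI[OF W, where d = "\<lambda>i _. if i = j then 1 else 0"])
    show "partial_on n W (\<lambda>y. y j) i (\<lambda>_. if i = j then 1 else 0)" for i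
      by (auto simp: partial_on_def)
  qed (auto intro: C_k_on_const[OF W] continuous_map_coord)
qed

section \<open>The chain rule and composition\<close>

lemma mvt_segment:
  fixes f :: "real \<Rightarrow> real"
  assumes "\<And>x. x \<in> closed_segment a b \<Longrightarrow> (f has_real_derivative f' x) (at x)" "a \<noteq> b"
  shows "\<exists>z \<in> closed_segment a b. f b - f a = (b - a) * f' z"
proof (cases "a < b")
  case True
  then obtain z where "a < z" "z < b" "f b - f a = (b - a) * f' z"
    using MVT2[of a b f f'] assms(1) by (auto simp: closed_segment_eq_real_ivl)
  then show ?thesis using True by (auto simp: closed_segment_eq_real_ivl)
next
  case False
  then have "b < a" using assms(2) by simp
  then obtain z where "b < z" "z < a" "f a - f b = (a - b) * f' z"
    using MVT2[of b a f f'] assms(1) by (auto simp: closed_segment_eq_real_ivl)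
  then show ?thesis using False
    by (intro bexI[of _ z]) (auto simp: closed_segment_eq_real_ivl algebra_simps)
qed

text \<open>The coordinates of \<open>c t0\<close> are replaced by those of \<open>c t\<close> one
  after the other. Each increment is governed by the mean value theorem in one variable, and
  continuity of the partial derivatives takes the intermediate points to
  \<open>c t0\<close>.\<close>

lemma chain_rule_curve:
  fixes c :: "real \<Rightarrow> nat \<Rightarrow> real"
  assumes W: "openin (Euclidean_space n) W"
    and part: "\<And>i. i < n \<Longrightarrow> partial_on n W f i (d i)"
    and cont: "\<And>i. i < n \<Longrightarrow> continuous_map (subtopology (Euclidean_space n) W) euclideanreal (d i)"
    and c: "\<forall>\<^sub>F t in nhds t0. c t \<in> W"
    and c': "\<And>i. i < n \<Longrightarrow> ((\<lambda>t. c t i) has_real_derivative c' i) (at t0)"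
  shows "((\<lambda>t. f (c t)) has_real_derivative (\<Sum>i<n. d i (c t0) * c' i)) (at t0)"
proof -
  let ?y = "c t0"
  define p where "p j t = (\<lambda>l. if l < j then c t l else ?y l)" for j t
  \<comment> \<open>With the default value for an unmoved coordinate, the increment is always
    \<open>q i t * (c t i - ?y i)\<close>, and q i still tends to \<open>d i ?y\<close>.\<close>
  define q where "q i t = (if c t i = ?y i then d i ?y else (f (p (Suc i) t) - f (p i t)) / (c t i - ?y i))" for i t
  have y: "?y \<in> W" using c by (rule eventually_nhds_x_imp_x)
  have topW: "\<And>z. z \<in> W \<Longrightarrow> z \<in> topspace (Euclidean_space n)" using openin_subset[OF W] by auto
  have p_Suc: "p (Suc i) t = (p i t)(i := c t i)" for i t by (auto simp: p_def)
  have p_i: "p i t i = ?y i" for i t by (simp add: p_def)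
  have close: "\<forall>\<^sub>F t in at t0. \<forall>i<n. \<bar>c t i - ?y i\<bar> < e" if "e > 0" for e
  proof -
    have "\<forall>\<^sub>F t in at t0. \<bar>c t i - ?y i\<bar> < e" if "i < n" for i
    proof -
      have "((\<lambda>t. c t i) \<longlongrightarrow> ?y i) (at t0)" using DERIV_isCont[OF c'[OF that]] by (simp add: isCont_def)
      from tendstoD[OF this \<open>e > 0\<close>] show ?thesis by (simp add: dist_real_def)
    qed
    then have "\<forall>\<^sub>F t in at t0. \<forall>i\<in>{..<n}. \<bar>c t i - ?y i\<bar> < e" by (intro eventually_ball_finite) auto
    then show ?thesis by (rule eventually_mono) auto
  qed
  have q: "((\<lambda>t. q i t) \<longlongrightarrow> d i ?y) (at t0)" if i: "i < n" for i
  proof (rule tendstoI)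
    fix e :: real assume "e > 0"
    from cont[OF i, unfolded continuous_Euclidean_iff[OF W], rule_format, OF y this]
    obtain r where r: "r > 0" "\<And>z. z \<in> cube n ?y r \<Longrightarrow> z \<in> W \<and> \<bar>d i z - d i ?y\<bar> < e"
      by auto
    show "\<forall>\<^sub>F t in at t0. dist (q i t) (d i ?y) < e"
      using close[OF r(1)]
    proof (rule eventually_mono)
      fix t assume t: "\<forall>i<n. \<bar>c t i - ?y i\<bar> < r"
      show "dist (q i t) (d i ?y) < e"
      proof (cases "c t i = ?y i")
        case True
        then show ?thesis using \<open>e > 0\<close> by (simp add: q_def)
      next
        case False
        have in_box: "(p i t)(i := s) \<in> cube n ?y r" if "s \<in> closed_segment (?y i) (c t i)" for s
        proof -
          have "\<bar>s - ?y i\<bar> < r" using that t[rule_format, OF i]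
            by (auto simp: closed_segment_eq_real_ivl split: if_splits)
          then show ?thesis using t r(1) topW[OF y] i by (auto simp: p_def topspace_Euclidean_space)
        qed
        have D: "((\<lambda>s. f ((p i t)(i := s))) has_real_derivative d i ((p i t)(i := s))) (at s)"
          if "s \<in> closed_segment (?y i) (c t i)" for s
        proof -
          have "(p i t)(i := s) \<in> W" using r(2)[OF in_box[OF that]] by blast
          from part[OF i, unfolded partial_on_def, rule_format, OF this] show ?thesis by simp
        qed
        have "\<exists>s\<in>closed_segment (?y i) (c t i).
            f ((p i t)(i := c t i)) - f ((p i t)(i := ?y i)) = (c t i - ?y i) * d i ((p i t)(i := s))"
          by (rule mvt_segment[where f = "\<lambda>s. f ((p i t)(i := s))", OF D]) (use False in auto)
        then obtain s where s: "s \<in> closed_segment (?y i) (c t i)"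
          "f ((p i t)(i := c t i)) - f ((p i t)(i := ?y i)) = (c t i - ?y i) * d i ((p i t)(i := s))"
          by auto
        have "(p i t)(i := ?y i) = p i t" by (auto simp: p_def)
        then have "q i t = d i ((p i t)(i := s))" using s(2) False by (simp add: q_def p_Suc)
        then show ?thesis using r(2)[OF in_box[OF s(1)]] by (simp add: dist_real_def)
      qed
    qed
  qed
  have "((\<lambda>t. (f (c t) - f ?y) / (t - t0)) \<longlongrightarrow> (\<Sum>i<n. d i ?y * c' i)) (at t0)"
  proof (rule Lim_transform_eventually)
    show "((\<lambda>t. \<Sum>i<n. q i t * ((c t i - ?y i) / (t - t0))) \<longlongrightarrow> (\<Sum>i<n. d i ?y * c' i)) (at t0)"
      using q c' by (intro tendsto_sum tendsto_mult) (auto simp: has_field_derivative_iff)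
    have "\<forall>\<^sub>F t in at t0. c t \<in> W" using c by (auto simp: eventually_nhds eventually_at_filter)
    then show "\<forall>\<^sub>F t in at t0. (\<Sum>i<n. q i t * ((c t i - ?y i) / (t - t0))) = (f (c t) - f ?y) / (t - t0)"
    proof (rule eventually_mono)
      fix t assume "c t \<in> W"
      then have "p n t = c t" using topW[OF y] topW[of "c t"] by (auto simp: p_def topspace_Euclidean_space)
      moreover have "p 0 t = ?y" by (auto simp: p_def)
      ultimately have "f (c t) - f ?y = (\<Sum>i<n. f (p (Suc i) t) - f (p i t))"
        using sum_lessThan_telescope[of "\<lambda>j. f (p j t)" n] by simp
      also have "\<dots> = (\<Sum>i<n. q i t * (c t i - ?y i))"
      proof (rule sum.cong[OF refl])
        fix i
        have "p (Suc i) t = p i t" if "c t i = ?y i" using that p_i[of i t] by (auto simp: p_Suc)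
        then show "f (p (Suc i) t) - f (p i t) = q i t * (c t i - ?y i)" by (simp add: q_def)
      qed
      finally show "(\<Sum>i<n. q i t * ((c t i - ?y i) / (t - t0))) = (f (c t) - f ?y) / (t - t0)"
        by (simp add: sum_divide_distrib)
    qed
  qed
  then show ?thesis by (simp add: has_field_derivative_iff)
qed

definition pad :: "nat \<Rightarrow> (nat \<Rightarrow> real) \<Rightarrow> nat \<Rightarrow> real" where
  "pad n x = (\<lambda>i. if i < n then x i else 0)"

lemma pad_in_topspace [simp]: "pad n x \<in> topspace (Euclidean_space n)"
  by (simp add: pad_def topspace_Euclidean_space)

lemma pad_id: "x \<in> topspace (Euclidean_space n) \<Longrightarrow> pad n x = x"
  by (auto simp: pad_def topspace_Euclidean_space)

lemma C_k_on_compose: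
  assumes W: "openin (Euclidean_space n) W" and W': "openin (Euclidean_space m) W'"
    and "C_k_on k n W f" "\<And>i. i < n \<Longrightarrow> C_k_on k m W' (\<phi> i)"
    and sub: "\<And>y. y \<in> W' \<Longrightarrow> pad n (\<lambda>i. \<phi> i y) \<in> W"
  shows "C_k_on k m W' (\<lambda>y. f (pad n (\<lambda>i. \<phi> i y)))"
  using assms(3,4)
proof (induction k arbitrary: f)
  case k: 0
  have "continuous_map (subtopology (Euclidean_space m) W') (subtopology (Euclidean_space n) W) (\<lambda>y. pad n (\<lambda>i. \<phi> i y))"
    unfolding continuous_map_in_subtopology Euclidean_space_def[of n]
  proof (intro conjI)
    show "continuous_map (subtopology (Euclidean_space m) W') (powertop_real UNIV) (\<lambda>y. pad n (\<lambda>i. \<phi> i y))"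
      unfolding continuous_map_componentwise_UNIV
    proof
      fix i
      show "continuous_map (subtopology (Euclidean_space m) W') euclideanreal (\<lambda>y. pad n (\<lambda>i. \<phi> i y) i)"
        using k(2)[of i] by (cases "i < n") (auto simp: pad_def)
    qed
  qed (use sub in \<open>auto simp: pad_def\<close>)
  from continuous_map_compose[OF this k(1)[unfolded C_k_on.simps]] show ?case by (simp add: o_def)
next
  case (Suc k)
  let ?\<Phi> = "\<lambda>y. pad n (\<lambda>i. \<phi> i y)"
  have C: "C_k_on k n W f" "\<And>i. i < n \<Longrightarrow> C_k_on k m W' (\<phi> i)"
    using Suc.prems by (auto intro: C_k_on_Suc_le)
  show ?case
  proof (rule C_k_on_SucI[OF W', where d = "\<lambda>j y. \<Sum>i<n. partial_deriv i f (?\<Phi> y) * partial_deriv j (\<phi> i) y"])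
    show "continuous_map (subtopology (Euclidean_space m) W') euclideanreal (\<lambda>y. f (?\<Phi> y))"
      by (rule C_k_on_cont[OF Suc.IH[OF C]])
    fix j assume j: "j < m"
    show "C_k_on k m W' (\<lambda>y. \<Sum>i<n. partial_deriv i f (?\<Phi> y) * partial_deriv j (\<phi> i) y)"
      using C_k_on_SucD(2)[OF Suc.prems(1)] C_k_on_SucD(2)[OF Suc.prems(2) j] C(2)
      by (intro C_k_on_sum[OF W'] C_k_on_mult[OF W'] Suc.IH) auto
    show "partial_on m W' (\<lambda>y. f (?\<Phi> y)) j (\<lambda>y. \<Sum>i<n. partial_deriv i f (?\<Phi> y) * partial_deriv j (\<phi> i) y)"
      unfolding partial_on_def
    proof
      fix y assume y: "y \<in> W'"
      have "((\<lambda>t. f (?\<Phi> (y(j := t)))) has_real_derivative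
          (\<Sum>i<n. partial_deriv i f (?\<Phi> (y(j := y j))) * partial_deriv j (\<phi> i) y)) (at (y j))"
      proof (rule chain_rule_curve[OF W])
        show "\<forall>\<^sub>F t in nhds (y j). ?\<Phi> (y(j := t)) \<in> W"
          using eventually_line_in[OF W' y j] by (rule eventually_mono) (rule sub)
        fix i assume i: "i < n"
        show "partial_on n W f i (partial_deriv i f)" by (rule C_k_on_SucD(1)[OF Suc.prems(1) i])
        show "continuous_map (subtopology (Euclidean_space n) W) euclideanreal (partial_deriv i f)"
          by (rule C_k_on_cont[OF C_k_on_SucD(2)[OF Suc.prems(1) i]])
        show "((\<lambda>t. ?\<Phi> (y(j := t)) i) has_real_derivative partial_deriv j (\<phi> i) y) (at (y j))"
          using C_k_on_SucD(1)[OF Suc.prems(2)[OF i] j] y i by (simp add: partial_on_def pad_def)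
      qed
      then show "((\<lambda>t. f (?\<Phi> (y(j := t)))) has_real_derivative
          (\<Sum>i<n. partial_deriv i f (?\<Phi> y) * partial_deriv j (\<phi> i) y)) (at (y j))" by simp
    qed
  qed
qed

section \<open>Rules for smooth functions\<close>

lemma smooth_on_compose:
  assumes "smooth_on n W f" "openin (Euclidean_space m) W'" "\<And>i. i < n \<Longrightarrow> smooth_on m W' (\<phi> i)"
    and "\<And>y. y \<in> W' \<Longrightarrow> pad n (\<lambda>i. \<phi> i y) \<in> W"
  shows "smooth_on m W' (\<lambda>y. f (pad n (\<lambda>i. \<phi> i y)))"
  using assms unfolding smooth_on_def by (auto intro!: C_k_on_compose)

lemma smooth_on_cong:
  assumes "smooth_on n W f" "\<And>y. y \<in> W \<Longrightarrow> f y = h y" shows "smooth_on n W h"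
  using assms C_k_on_cong unfolding smooth_on_def by blast

lemma smooth_on_subset:
  assumes "smooth_on n W f" "openin (Euclidean_space n) W'" "W' \<subseteq> W" shows "smooth_on n W' f"
  using assms C_k_on_subset unfolding smooth_on_def by blast

lemma smooth_on_local:
  assumes "\<And>y. y \<in> W \<Longrightarrow> \<exists>W'. y \<in> W' \<and> W' \<subseteq> W \<and> smooth_on n W' f"
  shows "smooth_on n W f"
proof -
  have "openin (Euclidean_space n) W"
    using assms unfolding smooth_on_def by (subst openin_subopen) blast
  then show ?thesis using assms unfolding smooth_on_def by (meson C_k_on_local)
qed

lemma smooth_on_const: "openin (Euclidean_space n) W \<Longrightarrow> smooth_on n W (\<lambda>_. c)"
  by (simp add: smooth_on_def C_k_on_const)

lemma smooth_on_coord: "openin (Euclidean_space n) W \<Longrightarrow> smooth_on n W (\<lambda>y. y j)"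
  by (simp add: smooth_on_def C_k_on_coord)

lemma smooth_on_add: "smooth_on n W f \<Longrightarrow> smooth_on n W h \<Longrightarrow> smooth_on n W (\<lambda>y. f y + h y)"
  by (simp add: smooth_on_def C_k_on_add)

lemma smooth_on_mult: "smooth_on n W f \<Longrightarrow> smooth_on n W h \<Longrightarrow> smooth_on n W (\<lambda>y. f y * h y)"
  by (simp add: smooth_on_def C_k_on_mult)

lemma smooth_on_curve:
  fixes c :: "real \<Rightarrow> nat \<Rightarrow> real"
  assumes "smooth_on n W f" "\<forall>\<^sub>F t in nhds t0. c t \<in> W"
    and "\<And>i. i < n \<Longrightarrow> (\<lambda>t. c t i) differentiable at t0"
  shows "(\<lambda>t. f (c t)) differentiable at t0"
proof -
  obtain c' where c': "\<And>i. i < n \<Longrightarrow> ((\<lambda>t. c t i) has_real_derivative c' i) (at t0)"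
    using assms(3) unfolding real_differentiable_def by metis
  have W: "openin (Euclidean_space n) W" and C: "C_k_on (Suc 0) n W f"
    using assms(1) by (auto simp: smooth_on_def)
  from chain_rule_curve[OF W C_k_on_SucD(1)[OF C] C_k_on_cont[OF C_k_on_SucD(2)[OF C]] assms(2) c']
  show ?thesis unfolding real_differentiable_def by blast
qed

text \<open>The function exp(-1/t) extended by zero, together with its products with powers of 1/t:
  the derivative of a member of this family is a combination of two members.\<close>

definition flat :: "nat \<Rightarrow> real \<Rightarrow> real" where
  "flat k t = (if t > 0 then (1 / t) ^ k * exp (- (1 / t)) else 0)"

lemma flat_tendsto: "((\<lambda>t. flat k t) \<longlongrightarrow> 0) (at_right 0)"
proof -
  have "((\<lambda>x::real. x ^ k / exp x) \<longlongrightarrow> 0) at_top" by (rule tendsto_power_div_exp_0)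
  then have "((\<lambda>t::real. inverse t ^ k / exp (inverse t)) \<longlongrightarrow> 0) (at_right 0)"
    by (rule filterlim_compose[OF _ filterlim_inverse_at_top_right])
  then show ?thesis
    by (rule Lim_transform_eventually)
      (auto simp: flat_def eventually_at_filter exp_minus divide_simps)
qed

lemma DERIV_flat: "(flat k has_real_derivative (- real k) * flat (Suc k) t + flat (k + 2) t) (at t)"
proof -
  consider "t > 0" | "t < 0" | "t = 0" by linarith
  then show ?thesis
  proof cases
    case 1
    have D: "((\<lambda>t. 1 / t) has_real_derivative - ((1 / t) * (1 / t))) (at t)"
      using 1 by (auto intro!: derivative_eq_intros simp: divide_simps)
    have d: "((\<lambda>t. (1 / t) ^ k * exp (- (1 / t))) has_real_derivative
        (- real k) * flat (Suc k) t + flat (k + 2) t) (at t)"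
      by (rule DERIV_cong[OF DERIV_mult[OF DERIV_power[OF D]
              DERIV_chain2[OF DERIV_exp DERIV_minus[OF D]]]])
        (use 1 in \<open>cases k; simp add: flat_def del: power_one_over; simp add: algebra_simps add_divide_distrib diff_divide_distrib\<close>)
    have ev: "\<forall>\<^sub>F s in nhds t. (1 / s) ^ k * exp (- (1 / s)) = flat k s"
      using eventually_nhds_in_open[of "{0<..}" t] 1 by (auto simp: flat_def elim!: eventually_mono)
    show ?thesis by (rule DERIV_cong_ev[OF refl ev refl, THEN iffD1, OF d])
  next
    case 2
    have ev: "\<forall>\<^sub>F s in nhds t. 0 = flat k s"
      using eventually_nhds_in_open[of "{..<0}" t] 2 by (auto simp: flat_def elim!: eventually_mono)
    have d: "((\<lambda>_. 0) has_real_derivative (- real k) * flat (Suc k) t + flat (k + 2) t) (at t)"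
      using 2 by (simp add: flat_def)
    show ?thesis by (rule DERIV_cong_ev[OF refl ev refl, THEN iffD1, OF d])
  next
    case 3
    \<comment> \<open>To the right of 0 the difference quotient of \<open>flat k\<close> is
      \<open>flat (Suc k)\<close>.\<close>
    have "((\<lambda>h. flat k h / h) \<longlongrightarrow> 0) (at 0)"
    proof (rule filterlim_split_at_real)
      have "((\<lambda>h. 0::real) \<longlongrightarrow> 0) (at_left 0)" by simp
      then show "((\<lambda>h. flat k h / h) \<longlongrightarrow> 0) (at_left 0)"
        by (rule Lim_transform_eventually) (auto simp: flat_def eventually_at_filter)
      show "((\<lambda>h. flat k h / h) \<longlongrightarrow> 0) (at_right 0)"
        using flat_tendsto[of "Suc k"]
        by (rule Lim_transform_eventually) (auto simp: flat_def eventually_at_filter)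
    qed
    then show ?thesis unfolding 3 DERIV_def by (simp add: flat_def)
  qed
qed

lemma smooth_on_flat: "smooth_on 1 (topspace (Euclidean_space 1)) (\<lambda>y. flat k (y 0))"
proof -
  let ?W = "topspace (Euclidean_space 1)"
  have W: "openin (Euclidean_space 1) ?W" by simp
  have "C_k_on s 1 ?W (\<lambda>y. flat k (y 0))" for s
  proof (induction s arbitrary: k)
    case (0 k)
    have "continuous_map euclideanreal euclideanreal (flat k)"
      using DERIV_isCont[OF DERIV_flat] by (auto intro: continuous_at_imp_continuous_on)
    from continuous_map_compose[OF continuous_map_coord[of 1 ?W 0] this] show ?case by (simp add: o_def)
  next
    case (Suc s)
    show ?case
    proof (rule C_k_on_SucI[OF W, where d = "\<lambda>_ y. (- real k) * flat (Suc k) (y 0) + flat (k + 2) (y 0)"])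
      show "continuous_map (subtopology (Euclidean_space 1) ?W) euclideanreal (\<lambda>y. flat k (y 0))"
        by (rule C_k_on_cont[OF Suc])
      show "C_k_on s 1 ?W (\<lambda>y. (- real k) * flat (Suc k) (y 0) + flat (k + 2) (y 0))"
        by (intro C_k_on_add[OF W] C_k_on_mult[OF W] C_k_on_const[OF W] Suc)
      show "partial_on 1 ?W (\<lambda>y. flat k (y 0)) i (\<lambda>y. (- real k) * flat (Suc k) (y 0) + flat (k + 2) (y 0))"
        if "i < 1" for i
        using that DERIV_flat by (auto simp: partial_on_def)
    qed
  qed
  then show ?thesis by (simp add: smooth_on_def)
qed

lemma smooth_on_flat_compose:
  assumes "smooth_on n W f" shows "smooth_on n W (\<lambda>y. flat k (f y))"
  using smooth_on_compose[OF smooth_on_flat[of k], of n W "\<lambda>_. f"] assms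
  by (simp add: pad_def smooth_on_def topspace_Euclidean_space)

text \<open>Gaussian elimination: an equation with a nonzero coefficient at i0 is solved for that
  unknown and substituted into the others. It bounds the number of independent covectors later
  on.\<close>

lemma homogeneous_system:
  fixes a :: "'j \<Rightarrow> 'i \<Rightarrow> real"
  assumes "finite J" "finite I" "card J < card I"
  shows "\<exists>c. (\<exists>i\<in>I. c i \<noteq> 0) \<and> (\<forall>j\<in>J. (\<Sum>i\<in>I. a j i * c i) = 0)"
  using assms
proof (induction J arbitrary: I a rule: finite_induct)
  case empty
  then obtain i where "i \<in> I" by (auto simp: card_gt_0_iff)
  then show ?case by (intro exI[of _ "\<lambda>_. 1"]) auto
next
  case (insert j0 J)
  show ?case
  proof (cases "\<forall>i\<in>I. a j0 i = 0")
    case True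
    obtain c where "\<exists>i\<in>I. c i \<noteq> 0" "\<forall>j\<in>J. (\<Sum>i\<in>I. a j i * c i) = 0"
      using insert.IH[of I a] insert.prems insert.hyps by auto
    then show ?thesis using True by (intro exI[of _ c]) simp
  next
    case False
    then obtain i0 where i0: "i0 \<in> I" "a j0 i0 \<noteq> 0" by auto
    let ?I = "I - {i0}" and ?a = "\<lambda>j i. a j i - a j i0 * a j0 i / a j0 i0"
    have "card J < card ?I" using insert.prems insert.hyps i0 by simp
    then obtain c where c: "\<exists>i\<in>?I. c i \<noteq> 0" "\<forall>j\<in>J. (\<Sum>i\<in>?I. ?a j i * c i) = 0"
      using insert.IH[of ?I ?a] insert.prems by auto
    define S where "S = (\<Sum>i\<in>?I. a j0 i * c i)"
    define c' where "c' = c(i0 := - S / a j0 i0)"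
    have split: "(\<Sum>i\<in>I. a j i * c' i) = a j i0 * (- S / a j0 i0) + (\<Sum>i\<in>?I. a j i * c i)" for j
      using insert.prems i0 by (subst sum.remove[of I i0]) (auto simp: c'_def intro!: sum.cong)
    have e: "(\<Sum>i\<in>?I. ?a j i * c i) = (\<Sum>i\<in>?I. a j i * c i) - a j i0 / a j0 i0 * S" for j
      unfolding S_def sum_distrib_left sum_subtractf[symmetric] by (intro sum.cong) (auto simp: algebra_simps)
    have "(\<Sum>i\<in>I. a j i * c' i) = 0" if "j \<in> J" for j
    proof -
      have "(\<Sum>i\<in>?I. a j i * c i) = a j i0 / a j0 i0 * S"
        using e[of j] c(2)[rule_format, OF that] by linarith
      then show ?thesis unfolding split by simp
    qed
    moreover have "(\<Sum>i\<in>I. a j0 i * c' i) = 0" unfolding split using i0 by (simp add: S_def)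
    moreover have "\<exists>i\<in>I. c' i \<noteq> 0" using c(1) by (auto simp: c'_def)
    ultimately show ?thesis by (intro exI[of _ c']) auto
  qed
qed

section \<open>Smooth functions on manifolds\<close>

text \<open>The part of \<open>smooth_manifold\<close> that does not refer to an ambient topology,
  so that it can be asserted of restrictions and of products as well.\<close>

definition atlas :: "'a mfd \<Rightarrow> bool" where
  "atlas M \<longleftrightarrow> pts M = (\<Union>(U, \<phi>) \<in> charts M. U) \<and>
     (\<forall>(U, \<phi>) \<in> charts M. inj_on \<phi> U \<and> openin (Euclidean_space (dim M)) (\<phi> ` U))"

lemma atlasD:
  assumes "atlas M" "(U, \<phi>) \<in> charts M"
  shows "inj_on \<phi> U" "openin (Euclidean_space (dim M)) (\<phi> ` U)" "U \<subseteq> pts M"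
    "\<And>x. x \<in> U \<Longrightarrow> pad (dim M) (\<phi> x) = \<phi> x"
proof -
  show 1: "inj_on \<phi> U" "openin (Euclidean_space (dim M)) (\<phi> ` U)" "U \<subseteq> pts M"
    using assms by (auto simp: atlas_def)
  show "\<And>x. x \<in> U \<Longrightarrow> pad (dim M) (\<phi> x) = \<phi> x" using openin_subset[OF 1(2)] by (intro pad_id) auto
qed

lemma atlas_chartE:
  assumes "atlas M" "x \<in> pts M" obtains U \<phi> where "(U, \<phi>) \<in> charts M" "x \<in> U"
  using assms by (auto simp: atlas_def)

lemma smooth_manifold_atlas:
  assumes "smooth_manifold T M" shows "atlas M"
  unfolding atlas_def
proof (intro conjI ballI)
  show "pts M = (\<Union>(U, \<phi>) \<in> charts M. U)" using assms by (simp add: smooth_manifold_def)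
  fix c assume c: "c \<in> charts M"
  obtain U \<phi> where c': "c = (U, \<phi>)" by (cases c)
  then have "is_chart T M U \<phi>" using assms c by (auto simp: smooth_manifold_def)
  moreover have "topspace (subtopology T U) = U"
    using assms c c' by (fastforce simp: smooth_manifold_def)
  ultimately show "case c of (U, \<phi>) \<Rightarrow> inj_on \<phi> U \<and> openin (Euclidean_space (dim M)) (\<phi> ` U)"
    by (auto simp: is_chart_def c' dest!: homeomorphic_imp_injective_map)
qed

lemma smooth_manifold_chart_open:
  assumes M: "smooth_manifold T M" and c: "(U, \<phi>) \<in> charts M"
    and W: "openin (subtopology T (pts M)) (pts M \<inter> W)"
  shows "openin (Euclidean_space (dim M)) (\<phi> ` (U \<inter> W))"
proof -
  have ch: "is_chart T M U \<phi>" and U: "U \<subseteq> pts M" using M c by (auto simp: smooth_manifold_def)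
  obtain O' where O': "openin T O'" "pts M \<inter> W = O' \<inter> pts M" using W by (auto simp: openin_subtopology)
  then have "openin (subtopology T U) (U \<inter> W)" using U by (auto simp: openin_subtopology intro!: exI[of _ O'])
  moreover have "open_map (subtopology T U) (subtopology (Euclidean_space (dim M)) (\<phi> ` U)) \<phi>"
    using ch by (auto simp: is_chart_def homeomorphic_imp_open_map)
  ultimately have "openin (subtopology (Euclidean_space (dim M)) (\<phi> ` U)) (\<phi> ` (U \<inter> W))"
    unfolding open_map_def by blast
  moreover have "openin (Euclidean_space (dim M)) (\<phi> ` U)" using ch by (simp add: is_chart_def)
  ultimately show ?thesis by (simp add: openin_open_subtopology)
qed

lemma charts_mfd_restrict: "c \<in> charts (mfd_restrict M W) \<longleftrightarrow> (\<exists>U \<phi>. (U, \<phi>) \<in> charts M \<and> c = (U \<inter> W, \<phi>))"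
  by (force simp: mfd_restrict_def)

lemma mfd_restrict_simps [simp]: "pts (mfd_restrict M W) = pts M \<inter> W" "dim (mfd_restrict M W) = dim M"
  by (simp_all add: mfd_restrict_def)

lemma atlas_restrict:
  assumes M: "smooth_manifold T M" and W: "openin (subtopology T (pts M)) (pts M \<inter> W)"
  shows "atlas (mfd_restrict M W)"
  unfolding atlas_def
proof (intro conjI ballI)
  note A = smooth_manifold_atlas[OF M]
  show "pts (mfd_restrict M W) = (\<Union>(U, \<phi>) \<in> charts (mfd_restrict M W). U)"
    using A by (auto simp: atlas_def mfd_restrict_def)
  fix c assume "c \<in> charts (mfd_restrict M W)"
  then obtain U \<phi> where c: "(U, \<phi>) \<in> charts M" "c = (U \<inter> W, \<phi>)" by (auto simp: charts_mfd_restrict)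
  then show "case c of (U, \<phi>) \<Rightarrow> inj_on \<phi> U \<and> openin (Euclidean_space (dim (mfd_restrict M W))) (\<phi> ` U)"
    using smooth_manifold_chart_open[OF M c(1) W] atlasD(1)[OF A c(1)] by (auto intro: inj_on_subset)
qed

lemma openin_pts_Int: "openin T W \<Longrightarrow> openin (subtopology T S) (S \<inter> W)"
  by (metis inf.commute openin_subtopology_Int)

lemma mfd_smoothD:
  "f \<in> mfd_smooth M \<Longrightarrow> (U, \<phi>) \<in> charts M \<Longrightarrow> smooth_on (dim M) (\<phi> ` U) (\<lambda>y. f (inv_into U \<phi> y))"
  by (auto simp: mfd_smooth_def)

lemma mfd_smooth_compose:
  assumes M: "atlas M" and G: "smooth_on n (topspace (Euclidean_space n)) G"
    and f: "\<And>i. i < n \<Longrightarrow> f i \<in> mfd_smooth M"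
  shows "(\<lambda>x. G (\<lambda>i. if i < n then f i x else 0)) \<in> mfd_smooth M"
  unfolding mfd_smooth_def
proof (intro CollectI ballI)
  fix c assume "c \<in> charts M"
  moreover obtain U \<phi> where c: "c = (U, \<phi>)" by (cases c)
  ultimately have ch: "(U, \<phi>) \<in> charts M" by simp
  have "smooth_on (dim M) (\<phi> ` U) (\<lambda>y. G (pad n (\<lambda>i. f i (inv_into U \<phi> y))))"
    using mfd_smoothD[OF f ch] atlasD(2)[OF M ch] by (intro smooth_on_compose[OF G]) auto
  then show "case c of (U, \<phi>) \<Rightarrow> smooth_on (dim M) (\<phi> ` U) (\<lambda>y. G (\<lambda>i. if i < n then f i (inv_into U \<phi> y) else 0))"
    by (simp add: c pad_def)
qed

lemma real_subalgebra_mfd_smooth: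
  assumes M: "atlas M" shows "real_subalgebra (mfd_smooth M)"
  unfolding real_subalgebra_def
proof (intro conjI allI ballI)
  note O = atlasD(2)[OF M]
  show "(\<lambda>_. c) \<in> mfd_smooth M" for c
    using O by (auto simp: mfd_smooth_def intro!: smooth_on_const)
  fix f h assume "f \<in> mfd_smooth M" "h \<in> mfd_smooth M"
  then show "(\<lambda>x. f x + h x) \<in> mfd_smooth M" "(\<lambda>x. f x * h x) \<in> mfd_smooth M"
    by (auto simp: mfd_smooth_def intro!: smooth_on_add smooth_on_mult)
qed

lemma inv_into_subset: "inj_on \<phi> U \<Longrightarrow> V \<subseteq> U \<Longrightarrow> y \<in> \<phi> ` V \<Longrightarrow> inv_into V \<phi> y = inv_into U \<phi> y"
  by (auto simp: inv_into_f_f inj_on_subset subset_iff)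

lemma mfd_smooth_cong:
  assumes "atlas M" "f \<in> mfd_smooth M" "\<And>x. x \<in> pts M \<Longrightarrow> f x = h x"
  shows "h \<in> mfd_smooth M"
  unfolding mfd_smooth_def
proof (intro CollectI ballI)
  fix c assume "c \<in> charts M"
  moreover obtain U \<phi> where c: "c = (U, \<phi>)" by (cases c)
  ultimately have ch: "(U, \<phi>) \<in> charts M" by simp
  have "smooth_on (dim M) (\<phi> ` U) (\<lambda>y. h (inv_into U \<phi> y))"
    by (rule smooth_on_cong[OF mfd_smoothD[OF assms(2) ch]])
      (metis assms(3) atlasD(3)[OF assms(1) ch] inv_into_into subsetD)
  then show "case c of (U, \<phi>) \<Rightarrow> smooth_on (dim M) (\<phi> ` U) (\<lambda>y. h (inv_into U \<phi> y))" by (simp add: c)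
qed

lemma mfd_smooth_restrict:
  assumes M: "atlas M" and W: "atlas (mfd_restrict M W)" and f: "f \<in> mfd_smooth M"
  shows "f \<in> mfd_smooth (mfd_restrict M W)"
  unfolding mfd_smooth_def
proof (intro CollectI ballI)
  fix c assume c0: "c \<in> charts (mfd_restrict M W)"
  then obtain U \<phi> where ch: "(U, \<phi>) \<in> charts M" and c: "c = (U \<inter> W, \<phi>)" by (auto simp: charts_mfd_restrict)
  have "smooth_on (dim M) (\<phi> ` (U \<inter> W)) (\<lambda>y. f (inv_into U \<phi> y))"
    using atlasD(2)[OF W c0[unfolded c]] by (intro smooth_on_subset[OF mfd_smoothD[OF f ch]]) auto
  then have "smooth_on (dim M) (\<phi> ` (U \<inter> W)) (\<lambda>y. f (inv_into (U \<inter> W) \<phi> y))"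
    by (rule smooth_on_cong) (simp add: inv_into_subset[OF atlasD(1)[OF M ch], of "U \<inter> W"])
  then show "case c of (U, \<phi>) \<Rightarrow> smooth_on (dim (mfd_restrict M W)) (\<phi> ` U) (\<lambda>y. f (inv_into U \<phi> y))"
    by (simp add: c)
qed

lemma mfd_smooth_local:
  assumes M: "atlas M"
    and loc: "\<And>x. x \<in> pts M \<Longrightarrow> \<exists>W. x \<in> W \<and> f \<in> mfd_smooth (mfd_restrict M W)"
  shows "f \<in> mfd_smooth M"
  unfolding mfd_smooth_def
proof (intro CollectI ballI)
  fix c assume "c \<in> charts M"
  moreover obtain U \<phi> where c: "c = (U, \<phi>)" by (cases c)
  ultimately have ch: "(U, \<phi>) \<in> charts M" by simp
  have "smooth_on (dim M) (\<phi> ` U) (\<lambda>y. f (inv_into U \<phi> y))"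
  proof (rule smooth_on_local)
    fix y assume "y \<in> \<phi> ` U"
    then obtain x where x: "x \<in> U" "y = \<phi> x" by auto
    then obtain W where W: "x \<in> W" "f \<in> mfd_smooth (mfd_restrict M W)"
      using loc atlasD(3)[OF M ch] by blast
    have "(U \<inter> W, \<phi>) \<in> charts (mfd_restrict M W)" using ch by (auto simp: charts_mfd_restrict)
    from mfd_smoothD[OF W(2) this]
    have "smooth_on (dim M) (\<phi> ` (U \<inter> W)) (\<lambda>y. f (inv_into (U \<inter> W) \<phi> y))" by simp
    then have "smooth_on (dim M) (\<phi> ` (U \<inter> W)) (\<lambda>y. f (inv_into U \<phi> y))"
      by (rule smooth_on_cong) (simp add: inv_into_subset[OF atlasD(1)[OF M ch], of "U \<inter> W"])
    then show "\<exists>W'. y \<in> W' \<and> W' \<subseteq> \<phi> ` U \<and> smooth_on (dim M) W' (\<lambda>y. f (inv_into U \<phi> y))"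
      using x W(1) by (intro exI[of _ "\<phi> ` (U \<inter> W)"]) auto
  qed
  then show "case c of (U, \<phi>) \<Rightarrow> smooth_on (dim M) (\<phi> ` U) (\<lambda>y. f (inv_into U \<phi> y))" by (simp add: c)
qed

text \<open>If \<open>dim N = 0\<close> then \<^const>\<open>smooth_map\<close> says nothing, not even that \<open>h\<close> is continuous.\<close>

lemma mfd_smooth_pullback:
  assumes M: "atlas M" and N: "atlas N" and dims: "dim N = 0 \<Longrightarrow> dim M = 0"
    and h: "smooth_map M N h" and a: "a \<in> mfd_smooth N"
  shows "(\<lambda>x. a (h x)) \<in> mfd_smooth M"
  unfolding mfd_smooth_def
proof (intro CollectI ballI)
  fix c assume "c \<in> charts M"
  moreover obtain U \<phi> where c: "c = (U, \<phi>)" by (cases c)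
  ultimately have ch: "(U, \<phi>) \<in> charts M" by simp
  have "smooth_on (dim M) (\<phi> ` U) (\<lambda>y. a (h (inv_into U \<phi> y)))"
  proof (rule smooth_on_local)
    fix y assume "y \<in> \<phi> ` U"
    then obtain x where x: "x \<in> U" "y = \<phi> x" by auto
    then have "h x \<in> pts N" using h atlasD(3)[OF M ch] by (auto simp: smooth_map_def)
    then obtain V \<psi> where V: "(V, \<psi>) \<in> charts N" "h x \<in> V" using atlas_chartE[OF N] by blast
    let ?W = "\<phi> ` {x \<in> U. h x \<in> V}"
    have sm: "smooth_on (dim M) ?W (\<lambda>y. \<psi> (h (inv_into U \<phi> y)) i)" if "i < dim N" for i
      using h ch V(1) that unfolding smooth_map_def by blast
    have W: "openin (Euclidean_space (dim M)) ?W"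
    proof (cases "dim N = 0")
      case True
      have sub: "?W \<subseteq> topspace (Euclidean_space (dim M))" using openin_subset[OF atlasD(2)[OF M ch]] by auto
      moreover have "topspace (Euclidean_space (dim M)) \<subseteq> {\<lambda>_. 0}"
        using dims True by (auto simp: topspace_Euclidean_space)
      ultimately consider "?W = {}" | "?W = topspace (Euclidean_space (dim M))"
        by (metis subset_antisym subset_singletonD subset_trans)
      then show ?thesis by cases (simp_all only: openin_empty openin_topspace)
    next
      case False
      then show ?thesis using sm[of 0] by (simp add: smooth_on_def)
    qed
    have inv: "inv_into U \<phi> z \<in> U" "h (inv_into U \<phi> z) \<in> V" if "z \<in> ?W" for z
      using that atlasD(1)[OF M ch] by auto
    have pd: "pad (dim N) (\<lambda>i. \<psi> (h (inv_into U \<phi> z)) i) = \<psi> (h (inv_into U \<phi> z))" if "z \<in> ?W" for z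
      using atlasD(4)[OF N V(1) inv(2)[OF that]] .
    have "smooth_on (dim M) ?W (\<lambda>z. a (inv_into V \<psi> (pad (dim N) (\<lambda>i. \<psi> (h (inv_into U \<phi> z)) i))))"
      by (rule smooth_on_compose[OF mfd_smoothD[OF a V(1)] W sm]) (use pd inv in auto)
    then have "smooth_on (dim M) ?W (\<lambda>z. a (h (inv_into U \<phi> z)))"
      by (rule smooth_on_cong) (simp only: pd inv_into_f_f[OF atlasD(1)[OF N V(1)] inv(2)])
    then show "\<exists>W'. y \<in> W' \<and> W' \<subseteq> \<phi> ` U \<and> smooth_on (dim M) W' (\<lambda>y. a (h (inv_into U \<phi> y)))"
      using x V(2) by (intro exI[of _ ?W]) auto
  qed
  then show "case c of (U, \<phi>) \<Rightarrow> smooth_on (dim M) (\<phi> ` U) (\<lambda>y. a (h (inv_into U \<phi> y)))" by (simp add: c)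
qed

section \<open>The product of a manifold with the apex\<close>

lemma prod_apex_chart:
  assumes M: "atlas M" and ch: "(U, \<phi>) \<in> charts M"
  defines "\<kappa> \<equiv> \<lambda>p i. if i < dim M then \<phi> (fst p) i else (0::real)"
  shows "\<kappa> ` (U \<times> {None}) = \<phi> ` U" "inj_on \<kappa> (U \<times> {None})"
    "y \<in> \<phi> ` U \<Longrightarrow> inv_into (U \<times> {None}) \<kappa> y = (inv_into U \<phi> y, None)"
proof -
  have eq: "\<kappa> (x, z) = \<phi> x" if "x \<in> U" for x z
    using atlasD(4)[OF M ch that] unfolding \<kappa>_def fst_conv by (simp add: pad_def)
  show "\<kappa> ` (U \<times> {None}) = \<phi> ` U" using eq by (force simp: image_iff)
  show inj: "inj_on \<kappa> (U \<times> {None})"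
    using atlasD(1)[OF M ch] by (auto simp: inj_on_def eq)
  show "inv_into (U \<times> {None}) \<kappa> y = (inv_into U \<phi> y, None)" if "y \<in> \<phi> ` U"
  proof -
    have "inv_into U \<phi> y \<in> U" "\<phi> (inv_into U \<phi> y) = y"
      using that by (auto intro: inv_into_into f_inv_into_f)
    then show ?thesis by (intro inv_into_f_eq[OF inj]) (auto simp: eq)
  qed
qed

lemma charts_prod_apex:
  "c \<in> charts (mfd_prod M apex_mfd) \<longleftrightarrow>
    (\<exists>U \<phi>. (U, \<phi>) \<in> charts M \<and> c = (U \<times> {None}, \<lambda>p i. if i < dim M then \<phi> (fst p) i else 0))"
  by (auto simp: mfd_prod_def apex_mfd_def)

lemma mfd_prod_apex_simps: "pts (mfd_prod M apex_mfd) = pts M \<times> {None}" "dim (mfd_prod M apex_mfd) = dim M"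
  by (simp_all add: mfd_prod_def apex_mfd_def)

lemma atlas_prod_apex:
  assumes M: "atlas M" shows "atlas (mfd_prod M apex_mfd)"
  unfolding atlas_def
proof (intro conjI ballI)
  show "pts (mfd_prod M apex_mfd) = (\<Union>(U, \<phi>)\<in>charts (mfd_prod M apex_mfd). U)"
    using M by (auto simp: atlas_def mfd_prod_def apex_mfd_def)
  fix c assume "c \<in> charts (mfd_prod M apex_mfd)"
  then obtain U \<phi> where ch: "(U, \<phi>) \<in> charts M"
    and c: "c = (U \<times> {None}, \<lambda>p i. if i < dim M then \<phi> (fst p) i else 0)"
    unfolding charts_prod_apex by blast
  show "case c of (U, \<phi>) \<Rightarrow> inj_on \<phi> U \<and> openin (Euclidean_space (dim (mfd_prod M apex_mfd))) (\<phi> ` U)"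
    unfolding c by (simp add: mfd_prod_apex_simps prod_apex_chart(1,2)[OF M ch] atlasD(2)[OF M ch])
qed

text \<open>The apex contributes no coordinate, so the charts of the product are those of M read
  through \<open>fst\<close>.\<close>

lemma mfd_smooth_prod_apex_iff:
  fixes f :: "'a \<times> ('b \<times> real) option \<Rightarrow> real"
  assumes M: "atlas M"
  shows "f \<in> mfd_smooth (mfd_prod M apex_mfd) \<longleftrightarrow> (\<lambda>x. f (x, None)) \<in> mfd_smooth M"
proof -
  let ?\<kappa> = "\<lambda>\<phi> (p :: 'a \<times> ('b \<times> real) option) i. if i < dim M then \<phi> (fst p) i else (0::real)"
  have key: "smooth_on (dim M) (?\<kappa> \<phi> ` (U \<times> {None})) (\<lambda>y. f (inv_into (U \<times> {None}) (?\<kappa> \<phi>) y)) \<longleftrightarrow>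
    smooth_on (dim M) (\<phi> ` U) (\<lambda>y. f (inv_into U \<phi> y, None))" if "(U, \<phi>) \<in> charts M" for U \<phi>
    unfolding prod_apex_chart(1)[OF M that]
    by (intro iffI; erule smooth_on_cong) (simp_all add: prod_apex_chart(3)[OF M that])
  have charts: "charts (mfd_prod M apex_mfd) = (\<lambda>c. (fst c \<times> {None}, ?\<kappa> (snd c))) ` charts M"
    by (simp add: set_eq_iff charts_prod_apex image_iff Bex_def split_paired_Ex cong: if_cong)
  have "f \<in> mfd_smooth (mfd_prod M apex_mfd) \<longleftrightarrow>
      (\<forall>c\<in>charts M. smooth_on (dim M) (?\<kappa> (snd c) ` (fst c \<times> {None}))
        (\<lambda>y. f (inv_into (fst c \<times> {None}) (?\<kappa> (snd c)) y)))"
    unfolding mfd_smooth_def charts mfd_prod_apex_simps by simp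
  also have "\<dots> \<longleftrightarrow> (\<forall>c\<in>charts M. smooth_on (dim M) (snd c ` fst c) (\<lambda>y. f (inv_into (fst c) (snd c) y, None)))"
    by (intro ball_cong refl key) simp
  also have "\<dots> \<longleftrightarrow> (\<lambda>x. f (x, None)) \<in> mfd_smooth M"
    by (simp add: mfd_smooth_def case_prod_unfold)
  finally show ?thesis .
qed

section \<open>Cotangent spaces of algebras of functions\<close>

text \<open>The common setting for two cotangent spaces at x: that of the whole space with its
  algebra C, and that of a stratum with all its smooth functions.\<close>

locale germ_algebra =
  fixes T :: "'a topology" and C :: "('a \<Rightarrow> real) set" and x :: 'a
  assumes C: "real_subalgebra C" and x: "x \<in> topspace T"
begin

abbreviation d where "d \<equiv> diff_at T C x"
abbreviation cot where "cot \<equiv> cotangent T C x"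
abbreviation msq where "msq \<equiv> max_ideal_sq T C x"

lemma C_const: "(\<lambda>_. c) \<in> C"
  using C by (simp add: real_subalgebra_def)

lemma C_add: "f \<in> C \<Longrightarrow> h \<in> C \<Longrightarrow> (\<lambda>y. f y + h y) \<in> C"
  using C by (simp add: real_subalgebra_def)

lemma C_mult: "f \<in> C \<Longrightarrow> h \<in> C \<Longrightarrow> (\<lambda>y. f y * h y) \<in> C"
  using C by (simp add: real_subalgebra_def)

lemma C_scale: "f \<in> C \<Longrightarrow> (\<lambda>y. c * f y) \<in> C"
  by (rule C_mult[OF C_const])

lemma C_shift: "f \<in> C \<Longrightarrow> (\<lambda>y. f y - c) \<in> C"
  using C_add[OF _ C_const, of f "- c"] by simp

lemma C_sum: "finite I \<Longrightarrow> (\<And>i. i \<in> I \<Longrightarrow> f i \<in> C) \<Longrightarrow> (\<lambda>y. \<Sum>i\<in>I. c i * f i y) \<in> C"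
  by (induction I rule: finite_induct) (simp_all add: C_const C_add C_scale)

section \<open>The square of the maximal ideal and the classes modulo it\<close>

lemma msqI:
  assumes "openin T U" "x \<in> U" "\<And>i. i < n \<Longrightarrow> a i \<in> C \<and> a i x = 0 \<and> b i \<in> C \<and> b i x = 0"
    "\<And>y. y \<in> U \<Longrightarrow> h y = (\<Sum>i<(n::nat). a i y * b i y)"
  shows "h \<in> msq"
  unfolding max_ideal_sq_def mem_Collect_eq
  by (rule exI[of _ U], rule exI[of _ n], rule exI[of _ a], rule exI[of _ b]) (simp add: assms(1-3) assms(4)[symmetric])

lemma msqE:
  assumes "h \<in> msq"
  obtains U n a b where "openin T U" "x \<in> U" "\<And>i. i < (n::nat) \<Longrightarrow> a i \<in> C \<and> a i x = 0 \<and> b i \<in> C \<and> b i x = 0"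
    "\<And>y. y \<in> U \<Longrightarrow> h y = (\<Sum>i<n. a i y * b i y)"
  using assms unfolding max_ideal_sq_def by blast

lemma msq_zero: "(\<lambda>_. 0) \<in> msq"
  by (rule msqI[where n = 0, OF openin_topspace x]) auto

lemma msq_scale: assumes "h \<in> msq" shows "(\<lambda>y. c * h y) \<in> msq"
proof -
  from assms obtain U n a b where "openin T U" "x \<in> U"
    "\<And>i. i < (n::nat) \<Longrightarrow> a i \<in> C \<and> a i x = 0 \<and> b i \<in> C \<and> b i x = 0"
    "\<And>y. y \<in> U \<Longrightarrow> h y = (\<Sum>i<n. a i y * b i y)" by (rule msqE) blast
  then show ?thesis
    by (intro msqI[of U n "\<lambda>i y. c * a i y" b]) (auto simp: C_scale sum_distrib_left mult.assoc)
qed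

lemma msq_add: assumes "h \<in> msq" "h' \<in> msq" shows "(\<lambda>y. h y + h' y) \<in> msq"
proof -
  from assms(1) obtain U n a b where 1: "openin T U" "x \<in> U"
    "\<And>i. i < (n::nat) \<Longrightarrow> a i \<in> C \<and> a i x = 0 \<and> b i \<in> C \<and> b i x = 0"
    "\<And>y. y \<in> U \<Longrightarrow> h y = (\<Sum>i<n. a i y * b i y)" by (rule msqE) blast
  from assms(2) obtain U' n' a' b' where 2: "openin T U'" "x \<in> U'"
    "\<And>i. i < (n'::nat) \<Longrightarrow> a' i \<in> C \<and> a' i x = 0 \<and> b' i \<in> C \<and> b' i x = 0"
    "\<And>y. y \<in> U' \<Longrightarrow> h' y = (\<Sum>i<n'. a' i y * b' i y)" by (rule msqE) blast
  show ?thesis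
  proof (rule msqI[of "U \<inter> U'" "n + n'" "\<lambda>i. if i < n then a i else a' (i - n)" "\<lambda>i. if i < n then b i else b' (i - n)"])
    show "h y + h' y = (\<Sum>i<n + n'. (if i < n then a i else a' (i - n)) y * (if i < n then b i else b' (i - n)) y)"
      if "y \<in> U \<inter> U'" for y
      using that 1(4) 2(4) by (simp add: sum_lessThan_add)
  qed (use 1 2 in auto)
qed

lemma msq_cong:
  assumes "h \<in> msq" "openin T U" "x \<in> U" "\<And>y. y \<in> U \<Longrightarrow> h y = h' y" shows "h' \<in> msq"
proof -
  from assms(1) obtain U' n a b where "openin T U'" "x \<in> U'"
    "\<And>i. i < (n::nat) \<Longrightarrow> a i \<in> C \<and> a i x = 0 \<and> b i \<in> C \<and> b i x = 0"
    "\<And>y. y \<in> U' \<Longrightarrow> h y = (\<Sum>i<n. a i y * b i y)" by (rule msqE) blast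
  then show ?thesis using assms(2-) by (intro msqI[of "U \<inter> U'" n a b]) (auto simp flip: assms(4))
qed

lemma shift_in_d: "f \<in> C \<Longrightarrow> (\<lambda>y. f y - f x) \<in> d f"
  by (simp add: diff_at_def C_shift msq_zero)

lemma d_memD: "g \<in> d f \<Longrightarrow> g \<in> C \<and> g x = 0 \<and> (\<lambda>y. (f y - f x) - g y) \<in> msq"
  by (simp add: diff_at_def)

lemma d_eq_iff:
  assumes "f \<in> C" "h \<in> C"
  shows "d f = d h \<longleftrightarrow> (\<lambda>y. (f y - f x) - (h y - h x)) \<in> msq"
proof
  assume "d f = d h"
  then have "(\<lambda>y. h y - h x) \<in> d f" using shift_in_d[OF assms(2)] by simp
  then show "(\<lambda>y. (f y - f x) - (h y - h x)) \<in> msq" by (auto dest: d_memD)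
next
  assume m: "(\<lambda>y. (f y - f x) - (h y - h x)) \<in> msq"
  have "(\<lambda>y. (h y - h x) - g y) \<in> msq \<longleftrightarrow> (\<lambda>y. (f y - f x) - g y) \<in> msq" for g
    using msq_add[OF m, of "\<lambda>y. (h y - h x) - g y"]
      msq_add[OF msq_scale[OF m, of "-1"], of "\<lambda>y. (f y - f x) - g y"] by (auto simp: algebra_simps)
  then show "d f = d h" by (simp add: diff_at_def)
qed

lemma d_cong:
  assumes "f \<in> C" "h \<in> C" "openin T U" "x \<in> U" "\<And>y. y \<in> U \<Longrightarrow> f y = h y"
  shows "d f = d h"
  unfolding d_eq_iff[OF assms(1,2)] by (rule msq_cong[OF msq_zero assms(3,4)]) (use assms(4,5) in simp)

lemma d_mem_eq: assumes "f \<in> C" "g \<in> d f" shows "d g = d f" "g \<in> C"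
proof -
  show g: "g \<in> C" using d_memD[OF assms(2)] by simp
  have "(\<lambda>y. (f y - f x) - (g y - g x)) \<in> msq" using d_memD[OF assms(2)] by simp
  then show "d g = d f" using d_eq_iff[OF assms(1) g] by simp
qed

lemma vcarrier_cot [simp]: "vcarrier cot = d ` C" by (simp add: cotangent_def)

lemma d_add_cong:
  assumes "f \<in> C" "f' \<in> C" "h \<in> C" "h' \<in> C" "d f = d f'" "d h = d h'"
  shows "d (\<lambda>y. f y + h y) = d (\<lambda>y. f' y + h' y)"
  using msq_add[OF assms(5)[unfolded d_eq_iff[OF assms(1,2)]] assms(6)[unfolded d_eq_iff[OF assms(3,4)]]]
  by (subst d_eq_iff) (auto simp: C_add assms algebra_simps)

lemma d_scale_cong:
  assumes "f \<in> C" "f' \<in> C" "d f = d f'" shows "d (\<lambda>y. c * f y) = d (\<lambda>y. c * f' y)"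
  using msq_scale[OF assms(3)[unfolded d_eq_iff[OF assms(1,2)]], of c]
  by (subst d_eq_iff) (auto simp: C_scale assms algebra_simps)

text \<open>In the definition of \<open>vadd\<close> the union runs over representatives. All its
  members are the same class, and there is at least one, given by \<open>f - f x\<close> and
  \<open>h - h x\<close>.\<close>

lemma vadd_cot: assumes "f \<in> C" "h \<in> C" shows "vadd cot (d f) (d h) = d (\<lambda>y. f y + h y)"
proof -
  have "d (\<lambda>y. f' y + h' y) = d (\<lambda>y. f y + h y)" if "f' \<in> d f" "h' \<in> d h" for f' h'
    using d_mem_eq[OF assms(1) that(1)] d_mem_eq[OF assms(2) that(2)] assms by (intro d_add_cong) auto
  then show ?thesis using shift_in_d[OF assms(1)] shift_in_d[OF assms(2)]
    by (simp add: cotangent_def) blast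
qed

lemma vscale_cot: assumes "f \<in> C" shows "vscale cot c (d f) = d (\<lambda>y. c * f y)"
proof -
  have "d (\<lambda>y. c * f' y) = d (\<lambda>y. c * f y)" if "f' \<in> d f" for f'
    using d_mem_eq[OF assms(1) that(1)] assms by (intro d_scale_cong) auto
  then show ?thesis using shift_in_d[OF assms(1)] by (simp add: cotangent_def) blast
qed

lemma vclosed_cot: "vclosed cot"
  by (auto simp: vclosed_def vadd_cot vscale_cot C_add C_scale)

lemma linear_on_cotI:
  assumes "\<And>f h. f \<in> C \<Longrightarrow> h \<in> C \<Longrightarrow> l (d (\<lambda>y. f y + h y)) = l (d f) + l (d h)"
    "\<And>c f. f \<in> C \<Longrightarrow> l (d (\<lambda>y. c * f y)) = c * l (d f)"
  shows "linear_on cot l"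
  using assms by (auto simp: linear_on_def vadd_cot vscale_cot)

lemma linear_on_cotD:
  assumes "linear_on cot l"
  shows "f \<in> C \<Longrightarrow> h \<in> C \<Longrightarrow> l (d (\<lambda>y. f y + h y)) = l (d f) + l (d h)"
    "f \<in> C \<Longrightarrow> l (d (\<lambda>y. c * f y)) = c * l (d f)"
proof -
  show "l (d (\<lambda>y. f y + h y)) = l (d f) + l (d h)" if "f \<in> C" "h \<in> C"
    unfolding vadd_cot[OF that, symmetric] using assms that by (simp add: linear_on_def)
  show "l (d (\<lambda>y. c * f y)) = c * l (d f)" if "f \<in> C"
    unfolding vscale_cot[OF that, symmetric] using assms that by (simp add: linear_on_def)
qed

lemma linear_on_cot_sum:
  assumes l: "linear_on cot l" and "finite I" "\<And>i. i \<in> I \<Longrightarrow> f i \<in> C"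
  shows "l (d (\<lambda>y. \<Sum>i\<in>I. c i * f i y)) = (\<Sum>i\<in>I. c i * l (d (f i)))"
  using assms(2,3)
proof (induction I rule: finite_induct)
  case empty
  show ?case using linear_on_cotD(2)[OF l C_const, of 0 0] by simp
next
  case (insert i I)
  then show ?case
    by (simp add: linear_on_cotD[OF l] C_scale C_sum)
qed

lemma lincomb_cot:
  assumes "length cs = length fs" "set fs \<subseteq> C"
  shows "lincomb cot cs (map d fs) = d (\<lambda>y. \<Sum>i<length fs. cs ! i * (fs ! i) y)"
  using assms
proof (induction cs fs rule: list_induct2)
  case Nil
  then show ?case by (simp add: lincomb_def cotangent_def)
next
  case (Cons c cs f fs)
  then have IH: "lincomb cot cs (map d fs) = d (\<lambda>y. \<Sum>i<length fs. cs ! i * (fs ! i) y)" by simp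
  have s: "(\<lambda>y. \<Sum>i<length fs. cs ! i * (fs ! i) y) \<in> C"
    using Cons.prems by (intro C_sum) auto
  have "lincomb cot (c # cs) (map d (f # fs)) = vadd cot (vscale cot c (d f)) (lincomb cot cs (map d fs))"
    by (simp add: lincomb_def)
  also have "\<dots> = d (\<lambda>y. c * f y + (\<Sum>i<length fs. cs ! i * (fs ! i) y))"
    unfolding IH using Cons.prems s by (simp add: vscale_cot vadd_cot C_scale)
  finally show ?case by (simp add: sum.lessThan_Suc_shift del: sum.lessThan_Suc)
qed

end

section \<open>Symplectic bases of a cotangent space\<close>

lemma alternating_on_alt_forms:
  assumes V: "vclosed V" and b: "alternating_on V b"
  shows "(\<lambda>vs. b (vs ! 0) (vs ! 1)) \<in> alt_forms V 2"
proof -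
  have "(\<lambda>vs. b (vs ! 0) (vs ! 1)) \<in> alt_forms V (Suc (Suc 0))"
  proof (rule alt_forms_SucI[OF V])
    show "(\<lambda>vs. b ((v # vs) ! 0) ((v # vs) ! 1)) \<in> alt_forms V (Suc 0)" if "v \<in> vcarrier V" for v
      by (rule alt_forms_SucI[OF V]) (use b that in \<open>auto simp: alternating_on_def\<close>)
  qed (use b in \<open>auto simp: alternating_on_def length_Suc_conv\<close>)
  then show ?thesis by (simp add: numeral_2_eq_2)
qed

text \<open>The brackets of the coordinates x_1, ..., x_m, y_1, ..., y_m in this order, with the
  sign convention {y_j, x_j} = 1.\<close>

definition gram :: "nat \<Rightarrow> nat \<Rightarrow> nat \<Rightarrow> real" where
  "gram m i j = (if i = m + j then 1 else if j = m + i then - 1 else 0)"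

context germ_algebra begin

text \<open>Here F lists x_1, ..., x_m, y_1, ..., y_m. The last two clauses say that the dF_i span
  and that any 2m + 1 covectors are dependent. Both are tested against linear functionals, which is
  the form in which they are applied.\<close>

definition darboux :: "('a covector \<Rightarrow> 'a covector \<Rightarrow> real) \<Rightarrow> 'a covector multivector \<Rightarrow> nat \<Rightarrow> (nat \<Rightarrow> 'a \<Rightarrow> real) \<Rightarrow> bool" where
  "darboux G w m F \<longleftrightarrow> alternating_on cot G \<and> (\<forall>i<2 * m. F i \<in> C) \<and>
     w = (\<lambda>A. \<Sum>j<m. wedge cot [d (F j), d (F (m + j))] A) \<and>
     (\<forall>i<2 * m. \<forall>j<2 * m. G (d (F i)) (d (F j)) = gram m i j) \<and>
     (\<forall>l u. linear_on cot l \<longrightarrow> u \<in> vcarrier cot \<longrightarrow>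
       (\<Sum>j<m. G (d (F (m + j))) u * l (d (F j)) - G (d (F j)) u * l (d (F (m + j)))) = l u) \<and>
     (\<forall>us. (\<forall>i\<le>2 * m. us i \<in> vcarrier cot) \<longrightarrow>
       (\<exists>c. (\<exists>i\<le>2 * m. c i \<noteq> 0) \<and> (\<forall>l. linear_on cot l \<longrightarrow> (\<Sum>i\<le>2 * m. c i * l (us i)) = 0)))"

text \<open>Coordinates are unique, hence they are linear functionals, and all clauses but the last
  follow from the coordinate expressions. The last one is a homogeneous system of 2m equations, one
  for each coordinate, in 2m + 1 unknowns.\<close>

lemma symplectic_bivector_darboux:
  assumes "symplectic_bivector cot w G"
  obtains m F where "darboux G w m F"
proof -
  from assms obtain m xs ys where len: "length xs = m" "length ys = m" and basis: "is_basis cot (xs @ ys)"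
    and w: "w = (\<lambda>A. \<Sum>j<m. wedge cot [xs ! j, ys ! j] A)"
    and G: "\<forall>u\<in>vcarrier cot. \<forall>v\<in>vcarrier cot.
           G u v = (let a = coords cot (xs @ ys) u; b = coords cot (xs @ ys) v
                    in \<Sum>j<m. a ! (m + j) * b ! j - a ! j * b ! (m + j))"
    unfolding symplectic_bivector_def by blast
  have "set (xs @ ys) \<subseteq> d ` C" using basis unfolding is_basis_def vcarrier_cot by blast
  then have "xs @ ys \<in> lists (d ` C)" by auto
  then obtain fs where fs: "xs @ ys = map d fs" "set fs \<subseteq> C" unfolding lists_image by auto
  define F where "F i = fs ! i" for i
  have N: "length fs = 2 * m" using len arg_cong[OF fs(1), of length] by simp
  have FC: "F i \<in> C" if "i < 2 * m" for i using fs(2) N that by (auto simp: F_def)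
  have xs: "xs ! j = d (F j)" "ys ! j = d (F (m + j))" if "j < m" for j
  proof -
    have "(xs @ ys) ! j = d (F j)" "(xs @ ys) ! (m + j) = d (F (m + j))"
      using that N unfolding fs(1) by (simp_all add: F_def)
    then show "xs ! j = d (F j)" "ys ! j = d (F (m + j))" using that len by (auto simp: nth_append)
  qed
  have lc: "lincomb cot cs (xs @ ys) = d (\<lambda>y. \<Sum>i<2 * m. cs ! i * F i y)" if "length cs = 2 * m" for cs
    using lincomb_cot[of cs fs] fs(2) N that unfolding fs(1) by (simp add: F_def)
  have ex1: "\<exists>!cs. length cs = 2 * m \<and> u = lincomb cot cs (xs @ ys)" if "u \<in> vcarrier cot" for u
    using basis that len unfolding is_basis_def by (simp add: mult_2 del: vcarrier_cot)
  define co where "co u i = coords cot (xs @ ys) u ! i" for u i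
  have coords_eq: "coords cot (xs @ ys) u = cs"
    if "u \<in> vcarrier cot" "length cs = 2 * m" "u = lincomb cot cs (xs @ ys)" for u cs
    unfolding coords_def using the1_equality[OF ex1[OF that(1)], of cs] that len by (simp add: mult_2)
  have co_eq: "co (d (\<lambda>y. \<Sum>i<2 * m. c i * F i y)) j = c j" if "j < 2 * m" for c j
  proof -
    let ?cs = "map c [0..<2 * m]"
    have "(\<lambda>y. \<Sum>i<2 * m. c i * F i y) \<in> C" using FC by (intro C_sum) auto
    moreover have "d (\<lambda>y. \<Sum>i<2 * m. c i * F i y) = lincomb cot ?cs (xs @ ys)"
      by (subst lc) (auto intro!: arg_cong[of _ _ d] sum.cong)
    ultimately have "coords cot (xs @ ys) (d (\<lambda>y. \<Sum>i<2 * m. c i * F i y)) = ?cs"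
      by (intro coords_eq) auto
    then show ?thesis using that by (simp add: co_def)
  qed
  have u_eq: "u = d (\<lambda>y. \<Sum>i<2 * m. co u i * F i y)" if u: "u \<in> vcarrier cot" for u
  proof -
    obtain cs where cs: "length cs = 2 * m" "u = lincomb cot cs (xs @ ys)" using ex1[OF u] by blast
    then have "coords cot (xs @ ys) u = cs" using coords_eq[OF u] by blast
    then show ?thesis using cs lc by (simp add: co_def)
  qed
  have sumC: "(\<lambda>y. \<Sum>i<2 * m. c i * F i y) \<in> C" for c using FC by (intro C_sum) auto
  have co_lin: "linear_on cot (\<lambda>u. co u j)" if "j < 2 * m" for j
    unfolding linear_on_def
  proof (intro conjI ballI allI)
    fix u c assume u: "u \<in> vcarrier cot"
    have "vscale cot c u = d (\<lambda>y. c * (\<Sum>i<2 * m. co u i * F i y))"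
      by (subst u_eq[OF u]) (rule vscale_cot[OF sumC])
    also have "\<dots> = d (\<lambda>y. \<Sum>i<2 * m. (c * co u i) * F i y)" by (simp add: sum_distrib_left mult.assoc)
    finally show "co (vscale cot c u) j = c * co u j" using co_eq[OF that] by simp
    fix v assume v: "v \<in> vcarrier cot"
    have "vadd cot u v = d (\<lambda>y. (\<Sum>i<2 * m. co u i * F i y) + (\<Sum>i<2 * m. co v i * F i y))"
      by (subst u_eq[OF u], subst u_eq[OF v]) (rule vadd_cot[OF sumC sumC])
    also have "\<dots> = d (\<lambda>y. \<Sum>i<2 * m. (co u i + co v i) * F i y)" by (simp add: sum.distrib distrib_right)
    finally show "co (vadd cot u v) j = co u j + co v j" using co_eq[OF that] by simp
  qed
  have G_eq: "G u v = (\<Sum>j<m. co u (m + j) * co v j - co u j * co v (m + j))"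
    if "u \<in> vcarrier cot" "v \<in> vcarrier cot" for u v
    using G[rule_format, OF that] by (simp add: co_def Let_def)
  have cl: "vadd cot u v \<in> vcarrier cot" "vscale cot c u \<in> vcarrier cot"
    if "u \<in> vcarrier cot" "v \<in> vcarrier cot" for u v c
    using vclosed_cot that by (auto simp: vclosed_def simp del: vcarrier_cot)
  have co_add: "co (vadd cot u v) j = co u j + co v j" "co (vscale cot c u) j = c * co u j"
    if "u \<in> vcarrier cot" "v \<in> vcarrier cot" "j < 2 * m" for u v c j
    using co_lin[OF that(3)] that by (auto simp: linear_on_def simp del: vcarrier_cot)
  have alt: "alternating_on cot G"
    unfolding alternating_on_def linear_on_def
    by (intro ballI conjI allI)
      (simp_all add: G_eq cl co_add sum.distrib sum_subtractf sum_distrib_left algebra_simps del: vcarrier_cot)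
  have co_F: "co (d (F i)) j = (if j = i then 1 else 0)" if "i < 2 * m" "j < 2 * m" for i j
  proof -
    have "(\<Sum>k<2 * m. (if k = i then 1 else 0) * F k y) = F i y" for y
      using that by (simp add: if_distrib[of "\<lambda>c. c * _"] sum.delta cong: if_cong)
    then show ?thesis using co_eq[OF that(2), of "\<lambda>k. if k = i then 1 else 0"] by simp
  qed
  have dF: "d (F i) \<in> vcarrier cot" if "i < 2 * m" for i using FC[OF that] by simp
  have gr: "G (d (F i)) (d (F j)) = gram m i j" if "i < 2 * m" "j < 2 * m" for i j
  proof -
    have "G (d (F i)) (d (F j)) = (\<Sum>k<m. (if k = j then (if i = m + j then 1 else 0) else 0)
        - (if k = i then (if j = m + i then 1 else 0) else 0))"
      unfolding G_eq[OF dF[OF that(1)] dF[OF that(2)]]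
      by (intro sum.cong refl) (use that in \<open>auto simp: co_F\<close>)
    also have "\<dots> = gram m i j" using that by (auto simp: sum_subtractf gram_def)
    finally show ?thesis .
  qed
  have l_eq: "l u = (\<Sum>i<2 * m. co u i * l (d (F i)))" if "linear_on cot l" "u \<in> vcarrier cot" for l u
    by (subst u_eq[OF that(2)]) (rule linear_on_cot_sum[OF that(1)], auto intro: FC)
  have rep: "(\<Sum>j<m. G (d (F (m + j))) u * l (d (F j)) - G (d (F j)) u * l (d (F (m + j)))) = l u"
    if l: "linear_on cot l" and u: "u \<in> vcarrier cot" for l u
  proof -
    have 1: "G (d (F (m + j))) u = co u j" "G (d (F j)) u = - co u (m + j)" if "j < m" for j
    proof -
      have mj: "m + j < 2 * m" "j < 2 * m" using that by simp_all
      have "G (d (F (m + j))) u = (\<Sum>k<m. if k = j then co u j else 0)"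
        unfolding G_eq[OF dF[OF mj(1)] u] by (intro sum.cong refl) (use mj in \<open>auto simp: co_F\<close>)
      then show "G (d (F (m + j))) u = co u j" using that by simp
      have "G (d (F j)) u = (\<Sum>k<m. if k = j then - co u (m + j) else 0)"
        unfolding G_eq[OF dF[OF mj(2)] u] by (intro sum.cong refl) (use mj in \<open>auto simp: co_F\<close>)
      then show "G (d (F j)) u = - co u (m + j)" using that by simp
    qed
    show ?thesis unfolding l_eq[OF l u] mult_2 sum_lessThan_add
      by (simp add: 1 sum.distrib[symmetric])
  qed
  have dep: "\<exists>c. (\<exists>i\<le>2 * m. c i \<noteq> 0) \<and> (\<forall>l. linear_on cot l \<longrightarrow> (\<Sum>i\<le>2 * m. c i * l (us i)) = 0)"
    if us: "\<forall>i\<le>2 * m. us i \<in> vcarrier cot" for us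
  proof -
    obtain c where c: "\<exists>i\<in>{..2 * m}. c i \<noteq> 0" "\<forall>j\<in>{..<2 * m}. (\<Sum>i\<in>{..2 * m}. co (us i) j * c i) = 0"
      using homogeneous_system[of "{..<2 * m}" "{..2 * m}" "\<lambda>j i. co (us i) j"] by auto
    have "(\<Sum>i\<le>2 * m. c i * l (us i)) = 0" if l: "linear_on cot l" for l
    proof -
      have "(\<Sum>i\<le>2 * m. c i * l (us i)) = (\<Sum>i\<le>2 * m. \<Sum>j<2 * m. (co (us i) j * c i) * l (d (F j)))"
        using us by (intro sum.cong refl) (simp add: l_eq[OF l] sum_distrib_left algebra_simps del: vcarrier_cot)
      also have "\<dots> = (\<Sum>j<2 * m. (\<Sum>i\<le>2 * m. co (us i) j * c i) * l (d (F j)))"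
        by (subst sum.swap) (simp add: sum_distrib_right)
      also have "\<dots> = 0" using c(2) by simp
      finally show ?thesis .
    qed
    then show ?thesis using c(1) by auto
  qed
  have "w = (\<lambda>A. \<Sum>j<m. wedge cot [d (F j), d (F (m + j))] A)" unfolding w using xs by simp
  then have "darboux G w m F" unfolding darboux_def using alt FC gr rep dep by blast
  then show ?thesis by (rule that)
qed

text \<open>The reproducing property and the trace depend on \<open>w\<close> only, so they hold for every other
  expansion of \<open>w\<close> into decomposable elements.\<close>

lemma darboux_expansion:
  assumes D: "darboux G w m F" and uv: "\<And>p. p < P \<Longrightarrow> u p \<in> vcarrier cot" "\<And>p. p < P \<Longrightarrow> v p \<in> vcarrier cot"
    and w: "\<And>A. A \<in> alt_forms cot 2 \<Longrightarrow> w A = (\<Sum>p<P. a p * A [u p, v p])"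
  shows "linear_on cot l \<Longrightarrow> z \<in> vcarrier cot \<Longrightarrow>
      (\<Sum>p<P. a p * (G (v p) z * l (u p) - G (u p) z * l (v p))) = l z"
    and "(\<Sum>p<P. a p * G (u p) (v p)) = - real m"
proof -
  have G: "alternating_on cot G" and w': "w = (\<lambda>A. \<Sum>j<m. wedge cot [d (F j), d (F (m + j))] A)"
    using D by (auto simp: darboux_def)
  have eq: "(\<Sum>p<P. a p * b (u p) (v p)) = (\<Sum>j<m. b (d (F j)) (d (F (m + j))))"
    if "alternating_on cot b" for b
  proof -
    note A = alternating_on_alt_forms[OF vclosed_cot that]
    have "w (\<lambda>vs. b (vs ! 0) (vs ! 1)) = (\<Sum>j<m. b (d (F j)) (d (F (m + j))))"
      using A by (simp add: w' wedge_def numeral_2_eq_2)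
    then show ?thesis using w[OF A] by simp
  qed
  show "(\<Sum>p<P. a p * G (u p) (v p)) = - real m"
    using D unfolding eq[OF G] by (simp add: darboux_def gram_def)
  assume l: "linear_on cot l" and z: "z \<in> vcarrier cot"
  have "linear_on cot (\<lambda>u. G u z)" using G z by (simp add: alternating_on_def del: vcarrier_cot)
  \<comment> \<open>The wedge product of l with \<open>G u z\<close> as a function of u: evaluating
    w on it produces the sum of the reproducing property.\<close>
  then have "alternating_on cot (\<lambda>u v. G v z * l u - G u z * l v)"
    using l unfolding alternating_on_def linear_on_def by (auto simp: algebra_simps)
  from eq[OF this] show "(\<Sum>p<P. a p * (G (v p) z * l (u p) - G (u p) z * l (v p))) = l z"
    using D l z by (simp add: darboux_def)
qed

end

section \<open>Local models of smooth structures\<close>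

lemma topspace_cone_topology: "topspace (cone_topology T) = cone_points (topspace T)"
proof -
  have "openin (cone_topology T) (cone_points (topspace T))"
  proof -
    have "{p \<in> topspace T \<times> {0..<1::real}. cone_proj p \<in> cone_points (topspace T)} =
        topspace (prod_topology T (top_of_set {0..<1}))"
      by (auto simp: cone_proj_def cone_points_def)
    then show ?thesis unfolding openin_cone_topology by (metis openin_topspace subset_refl)
  qed
  then show ?thesis using openin_subset[of "cone_topology T"] openin_cone_topology[of T "topspace (cone_topology T)"]
    by auto
qed

lemma continuous_map_cone_ray:
  assumes "z \<in> topspace T"
  shows "continuous_map (top_of_set {0..<1}) (cone_topology T) (\<lambda>t. cone_proj (z, t))"
  unfolding continuous_map_def
proof (intro conjI allI impI)
  show "(\<lambda>t. cone_proj (z, t)) \<in> topspace (top_of_set {0..<1}) \<rightarrow> topspace (cone_topology T)"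
    using assms by (auto simp: topspace_cone_topology cone_points_def cone_proj_def)
  fix W assume "openin (cone_topology T) W"
  then have W: "openin (prod_topology T (top_of_set {0..<1})) {p \<in> topspace T \<times> {0..<1}. cone_proj p \<in> W}"
    by (simp add: openin_cone_topology)
  have "continuous_map (top_of_set {0..<1::real}) (prod_topology T (top_of_set {0..<1})) (\<lambda>t. (z, t))"
    using assms by (auto simp: continuous_map_pairwise o_def)
  from openin_continuous_map_preimage[OF this W]
  show "openin (top_of_set {0..<1}) {t \<in> topspace (top_of_set {0..<1}). cone_proj (z, t) \<in> W}"
    using assms by (simp add: conj_commute cong: conj_cong)
qed

lemma mfd_restrict_restrict: "mfd_restrict (mfd_restrict M U) N = mfd_restrict M (U \<inter> N)"
  by (simp add: mfd_restrict_def image_image case_prod_unfold Int_assoc)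

lemma differentiable_cong_ev:
  fixes f :: "real \<Rightarrow> real"
  assumes "f differentiable at t" "\<forall>\<^sub>F s in nhds t. f s = h s" shows "h differentiable at t"
proof -
  obtain D where "(f has_real_derivative D) (at t)" using assms(1) by (auto simp: real_differentiable_def)
  from DERIV_cong_ev[OF refl assms(2) refl, THEN iffD1, OF this] show ?thesis
    by (auto simp: real_differentiable_def)
qed

lemma pts_cone_mfd: "pts (cone_mfd M) = Some ` (pts M \<times> {0<..<1})"
  by (simp add: cone_mfd_def mfd_prod_def unit_interval_mfd_def Let_def)

section \<open>Strata of a smooth space and its trivializations\<close>

locale smooth_space =
  fixes X :: "'a dspace" and C :: "('a \<Rightarrow> real) set"
  assumes ss: "smooth_structure X C"
begin

abbreviation T where "T \<equiv> dtop X"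

lemma decomposed: "decomposed_space X"
  using ss unfolding smooth_structure_def by (auto elim: stratified_space.cases)

lemma stratum_manifold: "S \<in> strata X \<Longrightarrow> smooth_manifold T S"
  using decomposed by (simp add: decomposed_space_def)

lemma stratum_atlas: "S \<in> strata X \<Longrightarrow> atlas S"
  by (rule smooth_manifold_atlas[OF stratum_manifold])

lemma stratum_subset: "S \<in> strata X \<Longrightarrow> pts S \<subseteq> topspace T"
  using stratum_manifold by (auto simp: smooth_manifold_def)

lemma strata_disjoint: "S \<in> strata X \<Longrightarrow> R \<in> strata X \<Longrightarrow> y \<in> pts S \<Longrightarrow> y \<in> pts R \<Longrightarrow> R = S"
  using decomposed unfolding decomposed_space_def by blast

lemma strata_cover: "y \<in> topspace T \<Longrightarrow> \<exists>S\<in>strata X. y \<in> pts S"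
proof -
  have "(\<Union>S\<in>strata X. pts S) = topspace T" using decomposed by (simp add: decomposed_space_def)
  then show "y \<in> topspace T \<Longrightarrow> \<exists>S\<in>strata X. y \<in> pts S" by auto
qed

lemma algebra_C: "real_subalgebra C" "f \<in> C \<Longrightarrow> continuous_map T euclideanreal f"
  using ss by (auto simp: smooth_structure_def germ_defined_Cinf_algebra_def)

end

text \<open>One trivialization at x. Of the smooth structure on the cone it records that
  \<open>CC\<close> is a subalgebra that contains the radial bump functions.\<close>

locale local_model = smooth_space X C
  for X :: "'a dspace" and C +
  fixes x :: 'a and U :: "'a set" and B :: "'a mfd" and L :: "'a dspace"
    and h :: "'a \<Rightarrow> 'a \<times> ('a \<times> real) option" and CC :: "(('a \<times> real) option \<Rightarrow> real) set" and S :: "'a mfd"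
  assumes U: "openin (dtop X) U" "x \<in> U"
    and S: "S \<in> strata X" "x \<in> pts S"
    and B: "openin (subtopology (dtop X) (pts S)) (pts B)" "x \<in> pts B" "B = mfd_restrict S (pts B)"
    and hom: "homeomorphic_map (subtopology (dtop X) U)
      (prod_topology (subtopology (dtop X) (pts B)) (cone_topology (dtop L))) h"
    and hx: "h x = (x, None)"
    and pieces: "\<And>R. R \<in> strata X \<Longrightarrow> pts R \<inter> U \<noteq> {} \<Longrightarrow>
      \<exists>S'\<in>insert apex_mfd (cone_mfd ` strata L). diffeo (mfd_restrict R U) (mfd_prod B S') h"
    and decL: "decomposed_space L"
    and CC: "real_subalgebra CC"
    and bumps: "\<And>\<rho> K. \<rho> \<in> mfd_smooth unit_interval_mfd \<Longrightarrow> compact K \<Longrightarrow> K \<subseteq> {0<..<1} \<Longrightarrow>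
      (\<And>t. t \<notin> K \<Longrightarrow> \<rho> t = 0) \<Longrightarrow> (\<lambda>p. case p of None \<Rightarrow> 0 | Some (z, t) \<Rightarrow> \<rho> t) \<in> CC"
    and loc: "\<And>f. f \<in> local_functions (dtop X) C U \<longleftrightarrow>
      (\<exists>g \<in> prod_smooth (subtopology (dtop X) (pts B)) (mfd_smooth B) (cone_topology (dtop L)) CC.
        \<forall>y\<in>U. f y = g (h y))"

lemma (in smooth_space) local_model_exists:
  assumes x: "x \<in> topspace T" "S \<in> strata X" "x \<in> pts S"
  obtains U B L h CC where "local_model X C x U B L h CC S"
proof -
  from ss x(1) have "locally_modelled (cone_smooth_structure :: 'a dspace \<Rightarrow> _) X C x"
    by (simp add: smooth_structure_def)
  then obtain U B and L :: "'a dspace" and h CL CC where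
    tr: "trivialization X x U B L h" and css: "cone_smooth_structure L CL CC" and
    loc: "\<And>f. f \<in> local_functions (dtop X) C U \<longleftrightarrow>
      (\<exists>g \<in> prod_smooth (subtopology (dtop X) (pts B)) (mfd_smooth B) (cone_topology (dtop L)) CC.
        \<forall>y\<in>U. f y = g (h y))"
    unfolding locally_modelled_def by blast
  from tr obtain S' where S': "S' \<in> strata X" "x \<in> pts S'" "open_ball T S' x (pts B)" "B = mfd_restrict S' (pts B)"
    unfolding trivialization_def by blast
  have eq: "S' = S" using strata_disjoint[OF x(2) S'(1) x(3) S'(2)] .
  have iso: "ds_iso (ds_restrict X U) (ds_prod (ds_single (dtop X) B) (ds_cone L)) h"
    using tr by (simp add: trivialization_def)
  have "decomposed_space L" "real_subalgebra CC"
    and bumps: "\<forall>\<rho> \<in> mfd_smooth unit_interval_mfd. \<forall>K. compact K \<and> K \<subseteq> {0<..<1} \<and> (\<forall>t. t \<notin> K \<longrightarrow> \<rho> t = 0) \<longrightarrow>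
      (\<lambda>p. case p of None \<Rightarrow> 0 | Some (z, t) \<Rightarrow> \<rho> t) \<in> CC"
    using css by (auto elim!: cone_smooth_structure.cases stratified_space.cases
        simp: germ_defined_Cinf_algebra_def)
  moreover have "\<exists>S'\<in>insert apex_mfd (cone_mfd ` strata L). diffeo (mfd_restrict R U) (mfd_prod B S') h"
    if "R \<in> strata X" "pts R \<inter> U \<noteq> {}" for R
  proof -
    have "mfd_restrict R U \<in> strata (ds_restrict X U)" using that by (auto simp: ds_restrict_def)
    then obtain Q where "Q \<in> strata (ds_prod (ds_single (dtop X) B) (ds_cone L))" "diffeo (mfd_restrict R U) Q h"
      using iso unfolding ds_iso_def by blast
    then show ?thesis by (auto simp: ds_prod_def ds_single_def ds_cone_def)
  qed
  ultimately have "local_model X C x U B L h CC S"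
    using tr S' x(2,3) iso loc unfolding eq
    by unfold_locales
      (auto simp: trivialization_def open_ball_def is_chart_def ds_iso_def ds_restrict_def ds_prod_def
        ds_single_def ds_cone_def simp del: insert_iff)
  then show ?thesis by (rule that)
qed

context local_model begin

lemma x_top: "x \<in> topspace T" using stratum_subset S by auto

lemma B_sub: "pts B \<subseteq> pts S" using openin_subset[OF B(1)] by auto

lemma B_Int: "pts S \<inter> pts B = pts B" using B_sub by blast

lemma B_atlas: "atlas B"
  using atlas_restrict[OF stratum_manifold[OF S(1)], of "pts B"] B by (simp add: B_Int)

lemma B_dim: "dim B = dim S" using B(3) by (metis mfd_restrict_simps(2))

lemma U_top: "topspace (subtopology T U) = U" using openin_subset[OF U(1)] by auto

lemma h_bij: "bij_betw h U (pts B \<times> cone_points (topspace (dtop L)))"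
proof -
  have "pts B \<subseteq> topspace T" using B_sub stratum_subset[OF S(1)] by blast
  then have eq: "topspace (prod_topology (subtopology T (pts B)) (cone_topology (dtop L))) =
      pts B \<times> cone_points (topspace (dtop L))" by (auto simp: topspace_cone_topology)
  show ?thesis
    using homeomorphic_imp_surjective_map[OF hom, unfolded U_top eq]
      homeomorphic_imp_injective_map[OF hom, unfolded U_top]
    by (simp add: bij_betw_def)
qed

lemma preimage_open:
  assumes "openin (prod_topology (subtopology T (pts B)) (cone_topology (dtop L))) W"
  shows "openin T {y \<in> U. h y \<in> W}"
proof -
  have "openin (subtopology T U) {y \<in> U. h y \<in> W}"
    using openin_continuous_map_preimage[OF homeomorphic_imp_continuous_map[OF hom] assms]
    unfolding U_top .
  then show ?thesis using U by (simp add: openin_open_subtopology)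
qed

lemma restrict_atlas: "R \<in> strata X \<Longrightarrow> atlas (mfd_restrict R U)"
  by (intro atlas_restrict[OF stratum_manifold] openin_pts_Int U)

text \<open>The image of x lies over the apex, which belongs to no piece \<open>cone_mfd M\<close>;
  so the piece that corresponds to S is the ball times the apex.\<close>

lemma S_diffeo: "diffeo (mfd_restrict S U) (mfd_prod B apex_mfd) h"
proof -
  obtain S' where S': "S' \<in> insert apex_mfd (cone_mfd ` strata L)" "diffeo (mfd_restrict S U) (mfd_prod B S') h"
    using pieces[OF S(1)] S U by blast
  have "h x \<in> pts (mfd_prod B S')"
    using S'(2) S U by (auto simp: diffeo_def dest!: bij_betw_apply)
  then have "None \<in> pts S'" by (simp add: hx mfd_prod_def)
  then have "S' = apex_mfd" using S'(1) by (auto simp: pts_cone_mfd)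
  then show ?thesis using S'(2) by simp
qed

lemma h_S: assumes "y \<in> pts S" "y \<in> U" shows "h y = (fst (h y), None)" "fst (h y) \<in> pts B"
proof -
  have "h y \<in> pts B \<times> {None}"
    using S_diffeo assms by (auto simp: diffeo_def mfd_prod_apex_simps dest!: bij_betw_apply)
  then show "h y = (fst (h y), None)" "fst (h y) \<in> pts B" by auto
qed

lemma C_local: "f \<in> C \<Longrightarrow> f \<in> local_functions T C U"
  using U by (auto simp: local_functions_def)

text \<open>In the local expression G(a(y), b(z)) of f the cone functions b are frozen at their
  values at the apex. The result is still smooth because \<open>CC\<close> contains the constants,
  it depends on the ball coordinate only, and it agrees with f on S because S lies over the
  apex.\<close>

lemma freeze:
  assumes f: "f \<in> C"
  obtains f' q N where "f' \<in> C" "openin T N" "x \<in> N" "N \<subseteq> U"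
    "\<forall>y\<in>N. f' y = q (fst (h y))" "\<forall>y\<in>N. y \<in> pts S \<longrightarrow> f' y = f y"
    "q \<in> mfd_smooth B"
proof -
  obtain g where g: "g \<in> prod_smooth (subtopology T (pts B)) (mfd_smooth B) (cone_topology (dtop L)) CC"
    "\<forall>y\<in>U. f y = g (h y)" using C_local[OF f] loc by blast
  have p: "(x, None) \<in> topspace (subtopology T (pts B)) \<times> topspace (cone_topology (dtop L))"
    using x_top B by (simp add: topspace_cone_topology cone_points_def)
  from g(1) p obtain W n k G a b where W: "openin (prod_topology (subtopology T (pts B)) (cone_topology (dtop L))) W"
    "(x, None) \<in> W" and G: "smooth_on (n + k) (topspace (Euclidean_space (n + k))) G"
    and a: "\<forall>i<n. a i \<in> mfd_smooth B" and b: "\<forall>j<k. b j \<in> CC"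
    and gW: "\<forall>(y, z)\<in>W. g (y, z) = G (\<lambda>i. if i < n then a i y else if i < n + k then b (i - n) z else 0)"
    unfolding prod_smooth_def by blast
  define q where "q y = G (\<lambda>i. if i < n then a i y else if i < n + k then b (i - n) None else 0)" for y
  have q: "q \<in> mfd_smooth B"
  proof -
    have "(\<lambda>y. G (\<lambda>i. if i < n + k then (if i < n then a i else (\<lambda>_. b (i - n) None)) y else 0)) \<in> mfd_smooth B"
      using a real_subalgebra_mfd_smooth[OF B_atlas]
      by (intro mfd_smooth_compose[OF B_atlas G]) (auto simp: real_subalgebra_def)
    moreover have "G (\<lambda>i. if i < n + k then (if i < n then a i else (\<lambda>_. b (i - n) None)) y else 0) = q y" for y
      unfolding q_def by (rule arg_cong[of _ _ G]) auto
    ultimately show ?thesis by simp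
  qed
  have "(\<lambda>p. q (fst p)) \<in> prod_smooth (subtopology T (pts B)) (mfd_smooth B) (cone_topology (dtop L)) CC"
    unfolding prod_smooth_def mem_Collect_eq
  proof (rule ballI, intro exI conjI)
    let ?P = "prod_topology (subtopology T (pts B)) (cone_topology (dtop L))"
    show "openin ?P (topspace ?P)" by (rule openin_topspace)
    show "smooth_on (n + k) (topspace (Euclidean_space (n + k))) G" by (rule G)
    show "\<forall>i<n. a i \<in> mfd_smooth B" by (rule a)
    show "\<forall>j<k. (\<lambda>_. b j None) \<in> CC" using CC by (simp add: real_subalgebra_def)
    show "\<forall>(y, z)\<in>topspace ?P. q (fst (y, z)) = G (\<lambda>i. if i < n then a i y else if i < n + k then b (i - n) None else 0)"
      by (simp add: q_def)
  qed auto
  then have "(\<lambda>y. q (fst (h y))) \<in> local_functions T C U" unfolding loc by (intro bexI) auto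
  then obtain W' f' where W': "openin T W'" "x \<in> W'" "f' \<in> C" "\<forall>y\<in>W' \<inter> U. q (fst (h y)) = f' y"
    using U unfolding local_functions_def by blast
  let ?N = "W' \<inter> {y \<in> U. h y \<in> W}"
  show ?thesis
  proof (rule that[of f' ?N q])
    show "openin T ?N" using W'(1) preimage_open[OF W(1)] by blast
    show "x \<in> ?N" using W' U W(2) hx by simp
    show "\<forall>y\<in>?N. f' y = q (fst (h y))" using W'(4) by auto
    have "f' y = f y" if "y \<in> ?N" "y \<in> pts S" for y
    proof -
      have "(fst (h y), None) \<in> W" using that h_S[of y] by auto
      from bspec[OF gW this] have "g (fst (h y), None) = q (fst (h y))" by (simp add: q_def)
      then have "g (h y) = q (fst (h y))" using h_S(1)[of y] that by (metis (no_types, lifting) Int_iff mem_Collect_eq)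
      then show ?thesis using g(2) W'(4) that by auto
    qed
    then show "\<forall>y\<in>?N. y \<in> pts S \<longrightarrow> f' y = f y" by blast
  qed (use W' q in auto)
qed

text \<open>On S the function agrees near x with a frozen one, and that is the pullback of a smooth
  function on the ball along the diffeomorphism h.\<close>

lemma C_smooth_near:
  assumes "f \<in> C" shows "\<exists>N. x \<in> N \<and> f \<in> mfd_smooth (mfd_restrict S N)"
proof -
  obtain f' q N where "f' \<in> C" and N: "openin T N" "x \<in> N" "N \<subseteq> U"
    "\<forall>y\<in>N. f' y = q (fst (h y))" "\<forall>y\<in>N. y \<in> pts S \<longrightarrow> f' y = f y"
    "q \<in> mfd_smooth B" by (rule freeze[OF assms]) (rule that)
  have at: "atlas (mfd_restrict S N)"
    by (intro atlas_restrict[OF stratum_manifold[OF S(1)]] openin_pts_Int N)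
  have "(\<lambda>p. q (fst p)) \<in> mfd_smooth (mfd_prod B (apex_mfd :: ('a \<times> real) option mfd))"
    using N(6) by (simp add: mfd_smooth_prod_apex_iff[OF B_atlas])
  then have "(\<lambda>y. q (fst (h y))) \<in> mfd_smooth (mfd_restrict S U)"
    using S_diffeo
    by (intro mfd_smooth_pullback[OF restrict_atlas[OF S(1)] atlas_prod_apex[OF B_atlas]])
      (auto simp: diffeo_def mfd_prod_apex_simps B_dim)
  moreover have "mfd_restrict (mfd_restrict S U) N = mfd_restrict S N"
    using N(3) by (simp add: mfd_restrict_restrict Int_absorb1)
  ultimately have "(\<lambda>y. q (fst (h y))) \<in> mfd_smooth (mfd_restrict S N)"
    using mfd_smooth_restrict[OF restrict_atlas[OF S(1)], of N] at by simp
  then have "f \<in> mfd_smooth (mfd_restrict S N)"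
    by (rule mfd_smooth_cong[OF at]) (use N(4,5) in auto)
  then show ?thesis using N(2) by blast
qed

end

lemma (in smooth_space) C_smooth:
  assumes "S \<in> strata X" shows "C \<subseteq> mfd_smooth S"
proof
  fix f assume f: "f \<in> C"
  show "f \<in> mfd_smooth S"
  proof (rule mfd_smooth_local[OF stratum_atlas[OF assms]])
    fix x assume x: "x \<in> pts S"
    then obtain U B L h CC where "local_model X C x U B L h CC S"
      using local_model_exists stratum_subset[OF assms] assms by blast
    then interpret local_model X C x U B L h CC S .
    show "\<exists>W. x \<in> W \<and> f \<in> mfd_smooth (mfd_restrict S W)" by (rule C_smooth_near[OF f])
  qed
qed

text \<open>Without a link the cone is a point, so U lies in S and h identifies it with the ball.
  The smooth structure on U is then the usual one.\<close>

lemma (in local_model) smooth_germ_in_C: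
  assumes L: "topspace (dtop L) = {}" and a: "a \<in> mfd_smooth S"
  obtains f N where "f \<in> C" "openin T N" "x \<in> N" "N \<subseteq> pts S" "\<And>y. y \<in> N \<Longrightarrow> f y = a y"
proof -
  have bij: "bij_betw h U (pts B \<times> {None})" using h_bij L by (simp add: cone_points_def)
  have Sbij: "bij_betw h (pts S \<inter> U) (pts B \<times> {None})"
    using S_diffeo by (simp add: diffeo_def mfd_prod_apex_simps)
  have US: "U \<subseteq> pts S"
  proof
    fix y assume y: "y \<in> U"
    then have "h y \<in> h ` (pts S \<inter> U)" using bij Sbij by (metis bij_betw_apply bij_betw_imp_surj_on)
    then show "y \<in> pts S" using y bij by (auto simp: bij_betw_def inj_on_def)
  qed
  then have SU: "pts S \<inter> U = U" by blast
  let ?k = "inv_into U h"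
  have "smooth_map (mfd_prod B apex_mfd) (mfd_restrict S U) ?k" using S_diffeo by (simp add: diffeo_def SU)
  then have "(\<lambda>p. a (?k p)) \<in> mfd_smooth (mfd_prod B (apex_mfd :: ('a \<times> real) option mfd))"
    using mfd_smooth_restrict[OF stratum_atlas[OF S(1)] restrict_atlas[OF S(1)] a]
    by (intro mfd_smooth_pullback[OF atlas_prod_apex[OF B_atlas] restrict_atlas[OF S(1)]])
      (auto simp: mfd_prod_apex_simps B_dim)
  then have q: "(\<lambda>y. a (?k (y, None))) \<in> mfd_smooth B" by (simp add: mfd_smooth_prod_apex_iff[OF B_atlas])
  have "(\<lambda>p. a (?k (fst p, None))) \<in> prod_smooth (subtopology T (pts B)) (mfd_smooth B) (cone_topology (dtop L)) CC"
    unfolding prod_smooth_def mem_Collect_eq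
  proof (rule ballI, intro exI conjI)
    let ?P = "prod_topology (subtopology T (pts B)) (cone_topology (dtop L))"
    show "openin ?P (topspace ?P)" by (rule openin_topspace)
    show "smooth_on (1 + 0) (topspace (Euclidean_space (1 + 0))) (\<lambda>y. y 0)"
      by (intro smooth_on_coord) simp
    show "\<forall>i<1. (\<lambda>i. (\<lambda>y. a (?k (y, None)))) i \<in> mfd_smooth B" using q by simp
    show "\<forall>j<0::nat. (\<lambda>_. 0) \<in> CC" by simp
    show "\<forall>(y, z)\<in>topspace ?P. a (?k (fst (y, z), None)) =
      (if (0::nat) < 1 then a (?k (y, None)) else if 0 < 1 + (0::nat) then 0 else 0)" by simp
  qed auto
  then have "a \<in> local_functions T C U"
  proof (subst loc, rule bexI[rotated], intro ballI)
    fix y assume y: "y \<in> U"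
    then have "(fst (h y), None) = h y" using bij by (auto dest: bij_betw_apply)
    then show "a y = a (?k (fst (h y), None))" using y bij by (simp add: bij_betw_def)
  qed
  then obtain W f where "openin T W" "x \<in> W" "f \<in> C" "\<forall>y\<in>W \<inter> U. a y = f y"
    using U unfolding local_functions_def by blast
  then show ?thesis using U US by (intro that[of f "W \<inter> U"]) auto
qed

section \<open>Curves towards the apex of the cone\<close>

context local_model begin

text \<open>The path in X that leaves x at t = 0 along the ray of the cone through z, with the ball
  coordinate kept equal to x.\<close>

definition ray :: "'a \<Rightarrow> real \<Rightarrow> 'a" where
  "ray z t = inv_into U h (x, cone_proj (z, t))"

context
  fixes z assumes z: "z \<in> topspace (dtop L)"
begin

lemma ray: assumes "0 \<le> t" "t < 1" shows "ray z t \<in> U" "h (ray z t) = (x, cone_proj (z, t))"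
proof -
  have "(x, cone_proj (z, t)) \<in> h ` U"
    using h_bij z B(2) assms by (auto simp: bij_betw_def cone_points_def cone_proj_def)
  then show "ray z t \<in> U" "h (ray z t) = (x, cone_proj (z, t))"
    by (simp_all add: ray_def inv_into_into f_inv_into_f)
qed

lemma ray_unique: "y \<in> U \<Longrightarrow> h y = (x, cone_proj (z, t)) \<Longrightarrow> ray z t = y"
  using h_bij by (simp add: ray_def bij_betw_def inv_into_f_eq)

lemma ray_0: "ray z 0 = x"
  by (intro ray_unique U) (simp add: hx cone_proj_def)

text \<open>Continuity of the ray at t0. The value t0 = 0 is allowed; it is how neighbourhoods of x
  are entered.\<close>

lemma ray_preimage:
  assumes "openin T W" "0 \<le> t0" "t0 < 1" "ray z t0 \<in> W"
  obtains e where "e > 0" "\<And>t. 0 \<le> t \<Longrightarrow> t < 1 \<Longrightarrow> \<bar>t - t0\<bar> < e \<Longrightarrow> ray z t \<in> W"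
proof -
  let ?P = "prod_topology (subtopology T (pts B)) (cone_topology (dtop L))"
  have "openin (subtopology T U) (W \<inter> U)" using assms(1) by (auto simp: openin_subtopology)
  then have "openin ?P (h ` (W \<inter> U))" using homeomorphic_imp_open_map[OF hom] by (simp add: open_map_def)
  moreover have "continuous_map (top_of_set {0..<1}) ?P (\<lambda>t. (x, cone_proj (z, t)))"
    using continuous_map_cone_ray[OF z] x_top B(2) by (auto simp: continuous_map_pairwise o_def)
  ultimately have "openin (top_of_set {0..<1}) {t \<in> topspace (top_of_set {0..<1}). (x, cone_proj (z, t)) \<in> h ` (W \<inter> U)}"
    by (rule openin_continuous_map_preimage[rotated])
  then obtain O' where O': "open O'" "{t \<in> {0..<1}. (x, cone_proj (z, t)) \<in> h ` (W \<inter> U)} = {0..<1} \<inter> O'"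
    by (auto simp: openin_open)
  have "t0 \<in> {t \<in> {0..<1}. (x, cone_proj (z, t)) \<in> h ` (W \<inter> U)}"
    using assms ray[of t0] by (auto simp: image_iff intro!: bexI[of _ "ray z t0"])
  then have "t0 \<in> O'" using O'(2) by blast
  then obtain e where e: "e > 0" "\<And>t. \<bar>t - t0\<bar> < e \<Longrightarrow> t \<in> O'"
    using O'(1) unfolding open_dist by (auto simp: dist_real_def)
  show ?thesis
  proof (rule that[OF e(1)])
    fix t :: real assume t: "0 \<le> t" "t < 1" "\<bar>t - t0\<bar> < e"
    then have "t \<in> {t \<in> {0..<1}. (x, cone_proj (z, t)) \<in> h ` (W \<inter> U)}" using O'(2) e(2) by auto
    then obtain y where "y \<in> W" "y \<in> U" "h y = (x, cone_proj (z, t))" by auto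
    then show "ray z t \<in> W" using ray_unique by metis
  qed
qed

text \<open>The piece of the cone over a stratum M of the link contains the whole open ray through
  each point of M, so an open ray never leaves its stratum of X.\<close>

lemma ray_stratum:
  assumes R: "R \<in> strata X" and t0: "0 < t0" "t0 < 1" "ray z t0 \<in> pts R"
  obtains M where "M \<in> strata L" "z \<in> pts M" "diffeo (mfd_restrict R U) (mfd_prod B (cone_mfd M)) h"
    "\<And>t. 0 < t \<Longrightarrow> t < 1 \<Longrightarrow> ray z t \<in> pts R \<inter> U \<and>
      inv_into (pts R \<inter> U) h (x, Some (z, t)) = ray z t"
proof -
  have y: "ray z t0 \<in> pts R \<inter> U" using t0 ray by simp
  then obtain S' where S': "S' \<in> insert apex_mfd (cone_mfd ` strata L)" "diffeo (mfd_restrict R U) (mfd_prod B S') h"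
    using pieces[OF R] by blast
  have bij: "bij_betw h (pts R \<inter> U) (pts B \<times> pts S')" using S'(2) by (simp add: diffeo_def mfd_prod_def)
  have "Some (z, t0) \<in> pts S'"
    using bij_betw_apply[OF bij y] ray[of t0] t0 by (simp add: cone_proj_def)
  then obtain M where M: "M \<in> strata L" "S' = cone_mfd M" "z \<in> pts M"
    using S'(1) by (auto simp: apex_mfd_def pts_cone_mfd)
  show ?thesis
  proof (rule that[OF M(1,3)])
    show "diffeo (mfd_restrict R U) (mfd_prod B (cone_mfd M)) h" using S' M by simp
    fix t :: real assume t: "0 < t" "t < 1"
    then have "(x, Some (z, t)) \<in> pts B \<times> pts S'" using B(2) M by (auto simp: pts_cone_mfd)
    then have "(x, Some (z, t)) \<in> h ` (pts R \<inter> U)" using bij by (simp add: bij_betw_def)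
    then obtain y where y: "y \<in> pts R \<inter> U" "h y = (x, Some (z, t))" by (metis imageE)
    then have "ray z t = y" using t by (intro ray_unique) (auto simp: cone_proj_def)
    then show "ray z t \<in> pts R \<inter> U \<and> inv_into (pts R \<inter> U) h (x, Some (z, t)) = ray z t"
      using y bij by (simp add: bij_betw_def inv_into_f_eq)
  qed
qed

text \<open>In a product chart of ball, link stratum and interval the ray is a coordinate line, in
  the direction with index dim B + dim M. Its differentiability is therefore that of the inverse of
  h with respect to one coordinate.\<close>

lemma ray_differentiable:
  assumes R: "R \<in> strata X" and t0: "0 < t0" "t0 < 1" "ray z t0 \<in> pts R" and a: "a \<in> mfd_smooth R"
  shows "(\<lambda>t. a (ray z t)) differentiable at t0"
proof -
  obtain M where M: "M \<in> strata L" "z \<in> pts M" and diff: "diffeo (mfd_restrict R U) (mfd_prod B (cone_mfd M)) h"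
    and k: "\<And>t. 0 < t \<Longrightarrow> t < 1 \<Longrightarrow> ray z t \<in> pts R \<inter> U \<and>
      inv_into (pts R \<inter> U) h (x, Some (z, t)) = ray z t"
    using ray_stratum[OF R t0] by blast
  have aR: "atlas R" by (rule stratum_atlas[OF R])
  have "smooth_manifold (dtop L) M" using decL M(1) by (simp add: decomposed_space_def)
  then have aM: "atlas M" by (rule smooth_manifold_atlas)
  obtain V \<psi> where V: "(V, \<psi>) \<in> charts R" "ray z t0 \<in> V" using atlas_chartE[OF aR t0(3)] by blast
  obtain VB \<phi>B where VB: "(VB, \<phi>B) \<in> charts B" "x \<in> VB" using atlas_chartE[OF B_atlas B(2)] by blast
  obtain VM \<phi>M where VM: "(VM, \<phi>M) \<in> charts M" "z \<in> VM" using atlas_chartE[OF aM M(2)] by blast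
  let ?I = "{0<..<1::real}"
  define \<theta> where "\<theta> = (\<lambda>t i. if i = (0::nat) then t else (0::real))"
  define \<phi>N where "\<phi>N = (\<lambda>q i. if i < dim M then \<phi>M (fst q) i else \<theta> (snd q) (i - dim M))"
  define \<kappa> where "\<kappa> = (\<lambda>p i. if i < dim B then \<phi>B (fst p) i else (\<phi>N \<circ> the) (snd p) (i - dim B))"
  let ?V = "VB \<times> Some ` (VM \<times> ?I)" and ?D = "dim B + (dim M + 1)" and ?J = "dim B + dim M"
  have ch1: "(VM \<times> ?I, \<phi>N) \<in> charts (mfd_prod M unit_interval_mfd)"
    using VM(1) by (force simp: mfd_prod_def unit_interval_mfd_def \<phi>N_def \<theta>_def)
  then have ch2: "(Some ` (VM \<times> ?I), \<phi>N \<circ> the) \<in> charts (cone_mfd M)"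
    by (force simp: cone_mfd_def Let_def)
  then have ch3: "(?V, \<kappa>) \<in> charts (mfd_prod B (cone_mfd M))"
    unfolding mfd_prod_def using VB(1) unfolding \<kappa>_def by simp blast
  have dims: "dim (mfd_prod B (cone_mfd M)) = ?D"
    by (simp add: mfd_prod_def cone_mfd_def unit_interval_mfd_def Let_def)
  have inj: "inj_on \<kappa> ?V"
  proof (rule inj_onI)
    fix p p' assume p: "p \<in> ?V" "p' \<in> ?V" and eq: "\<kappa> p = \<kappa> p'"
    obtain b s t b' s' t' where pp: "p = (b, Some (s, t))" "p' = (b', Some (s', t'))"
      and V: "b \<in> VB" "b' \<in> VB" "s \<in> VM" "s' \<in> VM" using p by auto
    have "\<phi>B b i = \<phi>B b' i" if "i < dim B" for i
      using fun_cong[OF eq, of i] that by (simp add: \<kappa>_def pp)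
    then have "pad (dim B) (\<phi>B b) = pad (dim B) (\<phi>B b')" by (auto simp: pad_def)
    then have "b = b'" using V atlasD(1,4)[OF B_atlas VB(1)] by (simp add: inj_on_eq_iff)
    moreover have "\<phi>M s i = \<phi>M s' i" if "i < dim M" for i
      using fun_cong[OF eq, of "dim B + i"] that by (simp add: \<kappa>_def pp \<phi>N_def)
    then have "pad (dim M) (\<phi>M s) = pad (dim M) (\<phi>M s')" by (auto simp: pad_def)
    then have "s = s'" using V atlasD(1,4)[OF aM VM(1)] by (simp add: inj_on_eq_iff)
    moreover have "t = t'" using fun_cong[OF eq, of ?J] by (simp add: \<kappa>_def pp \<phi>N_def \<theta>_def)
    ultimately show "p = p'" by (simp add: pp)
  qed
  let ?p = "\<lambda>t. (x, Some (z, t))" and ?k = "inv_into (pts R \<inter> U) h"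
  have pV: "?p t \<in> ?V" if "0 < t" "t < 1" for t using that VB VM by auto
  have line: "(\<kappa> (?p t0))(?J := t) = \<kappa> (?p t)" for t
    by (auto simp: \<kappa>_def \<phi>N_def \<theta>_def fun_eq_iff)
  have "smooth_map (mfd_prod B (cone_mfd M)) (mfd_restrict R U) ?k" using diff by (simp add: diffeo_def)
  moreover have "(V \<inter> U, \<psi>) \<in> charts (mfd_restrict R U)" using V by (auto simp: charts_mfd_restrict)
  ultimately have sm: "smooth_on ?D (\<kappa> ` {p \<in> ?V. ?k p \<in> V \<inter> U}) (\<lambda>y. \<psi> (?k (inv_into ?V \<kappa> y)) i)"
    if "i < dim R" for i
    using ch3 that unfolding smooth_map_def dims by fastforce
  have ev01: "\<forall>\<^sub>F t in nhds t0. 0 < t \<and> t < 1"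
    using eventually_nhds_in_open[of "{0<..<1}" t0] t0 by simp
  have coord: "(\<lambda>t. \<psi> (ray z t) i) differentiable at t0" if i: "i < dim R" for i
  proof -
    let ?W = "\<kappa> ` {p \<in> ?V. ?k p \<in> V \<inter> U}" and ?F = "\<lambda>y. \<psi> (?k (inv_into ?V \<kappa> y)) i"
    have "?k (?p t0) \<in> V \<inter> U" using k[OF t0(1,2)] V(2) by simp
    then have W0: "\<kappa> (?p t0) \<in> ?W" using pV[OF t0(1,2)] by blast
    have "C_k_on (Suc 0) ?D ?W ?F" using sm[OF i] by (simp add: smooth_on_def del: C_k_on.simps)
    then have "\<forall>j<?D. \<forall>y\<in>?W. (\<lambda>t. ?F (y(j := t))) differentiable (at (y j))" by simp
    from this[rule_format, of ?J, OF _ W0]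
    have "(\<lambda>t. ?F (\<kappa> (?p t))) differentiable at (\<kappa> (?p t0) ?J)" unfolding line by simp
    moreover have "\<kappa> (?p t0) ?J = t0" by (simp add: \<kappa>_def \<phi>N_def \<theta>_def)
    ultimately have "(\<lambda>t. ?F (\<kappa> (?p t))) differentiable at t0" by simp
    then show ?thesis
    proof (rule differentiable_cong_ev)
      show "\<forall>\<^sub>F t in nhds t0. ?F (\<kappa> (?p t)) = \<psi> (ray z t) i"
        using ev01
      proof (rule eventually_mono)
        fix t :: real assume t: "0 < t \<and> t < 1"
        then have "inv_into ?V \<kappa> (\<kappa> (?p t)) = ?p t" using inv_into_f_f[OF inj pV] by blast
        then show "?F (\<kappa> (?p t)) = \<psi> (ray z t) i" using k t by simp
      qed
    qed
  qed
  have evV: "\<forall>\<^sub>F t in nhds t0. ray z t \<in> V"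
  proof -
    have "openin (subtopology T (pts R)) V"
      using stratum_manifold[OF R] V(1) by (auto simp: smooth_manifold_def is_chart_def)
    then obtain O' where O': "openin T O'" "V = O' \<inter> pts R" by (auto simp: openin_subtopology)
    then obtain e where e: "e > 0" "\<And>t. 0 \<le> t \<Longrightarrow> t < 1 \<Longrightarrow> \<bar>t - t0\<bar> < e \<Longrightarrow> ray z t \<in> O'"
      using ray_preimage[OF O'(1), of t0] t0 V(2) by auto
    have "\<forall>\<^sub>F t in nhds t0. \<bar>t - t0\<bar> < e"
      using e(1) unfolding eventually_nhds_metric by (auto simp: dist_real_def)
    with ev01 show ?thesis
      by eventually_elim (use e k O' in auto)
  qed
  have "(\<lambda>t. a (inv_into V \<psi> (\<psi> (ray z t)))) differentiable at t0"
    using evV by (intro smooth_on_curve[OF mfd_smoothD[OF a V(1)]] coord) (auto elim: eventually_mono)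
  then show ?thesis
    by (rule differentiable_cong_ev)
      (use evV atlasD(1)[OF aR V(1)] in \<open>auto elim!: eventually_mono\<close>)
qed

end

end

section \<open>Pullback of forms, and matrices close to the Gram matrix\<close>

lemma alt_forms_map:
  assumes B: "B \<in> alt_forms V' k"
    and r: "\<And>u. u \<in> vcarrier V \<Longrightarrow> r u \<in> vcarrier V'"
    "\<And>u v. u \<in> vcarrier V \<Longrightarrow> v \<in> vcarrier V \<Longrightarrow> r (vadd V u v) = vadd V' (r u) (r v)"
    "\<And>c u. u \<in> vcarrier V \<Longrightarrow> r (vscale V c u) = vscale V' c (r u)"
  shows "(\<lambda>vs. B (map r vs)) \<in> alt_forms V k"
  unfolding alt_forms_def mem_Collect_eq
proof (intro allI impI)
  fix vs assume vs: "length vs = k \<and> set vs \<subseteq> vcarrier V"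
  then have *: "length (map r vs) = k \<and> set (map r vs) \<subseteq> vcarrier V'" using r(1) by auto
  have "(\<forall>i<k. \<forall>u\<in>vcarrier V'. \<forall>w\<in>vcarrier V'.
        B ((map r vs)[i := vadd V' u w]) = B ((map r vs)[i := u]) + B ((map r vs)[i := w])) \<and>
     (\<forall>i<k. \<forall>c. \<forall>u\<in>vcarrier V'. B ((map r vs)[i := vscale V' c u]) = c * B ((map r vs)[i := u])) \<and>
     (\<forall>i j. i < j \<and> j < k \<and> map r vs ! i = map r vs ! j \<longrightarrow> B (map r vs) = 0)"
    using B * unfolding alt_forms_def by blast
  note A = this
  have "B (map r vs) = 0" if "i < j" "j < k" "vs ! i = vs ! j" for i j
  proof -
    have "map r vs ! i = map r vs ! j" using that vs by simp
    then show ?thesis using A that by blast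
  qed
  with A show "(\<forall>i<k. \<forall>u\<in>vcarrier V. \<forall>w\<in>vcarrier V.
        B (map r (vs[i := vadd V u w])) = B (map r (vs[i := u])) + B (map r (vs[i := w]))) \<and>
     (\<forall>i<k. \<forall>c. \<forall>u\<in>vcarrier V. B (map r (vs[i := vscale V c u])) = c * B (map r (vs[i := u]))) \<and>
     (\<forall>i j. i < j \<and> j < k \<and> vs ! i = vs ! j \<longrightarrow> B (map r vs) = 0)"
    using vs by (simp add: map_update r subset_iff) blast
qed

text \<open>Let c k have the largest absolute value and let k' be the partner of k, the index for
  which the Gram entry is 1 or -1. The equation for k' gives |c k| \<le> 2m/(2m + 1) |c k|: the
  tolerance 1/(2m + 1) is small enough for 2m errors to stay below 1 in total.\<close>

lemma near_gram_independent:
  assumes near: "\<And>i j. i < 2 * m \<Longrightarrow> j < 2 * m \<Longrightarrow> \<bar>b i j - gram m i j\<bar> < 1 / (2 * real m + 1)"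
    and eq: "\<And>j. j < 2 * m \<Longrightarrow> (\<Sum>i<2 * m. c i * b i j) = 0" and i: "i < 2 * m"
  shows "c i = 0"
proof -
  have fin: "finite ((\<lambda>i. \<bar>c i\<bar>) ` {..<2 * m})" "(\<lambda>i. \<bar>c i\<bar>) ` {..<2 * m} \<noteq> {}" using i by auto
  from Max_in[OF fin] obtain k where "k \<in> {..<2 * m}" "Max ((\<lambda>i. \<bar>c i\<bar>) ` {..<2 * m}) = \<bar>c k\<bar>"
    by (rule imageE)
  then have k: "k < 2 * m" "\<bar>c k\<bar> = Max ((\<lambda>i. \<bar>c i\<bar>) ` {..<2 * m})" by simp_all
  have le: "\<bar>c j\<bar> \<le> \<bar>c k\<bar>" if "j < 2 * m" for j unfolding k(2) using that by (intro Max_ge) auto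
  define k' where "k' = (if k < m then m + k else k - m)"
  have k': "k' < 2 * m" using k by (auto simp: k'_def)
  have gz: "gram m j k' = 0" if "j < 2 * m" "j \<noteq> k" for j
    using that k by (auto simp: gram_def k'_def)
  have "(\<Sum>j<2 * m. c j * gram m j k') = (\<Sum>j<2 * m. if j = k then c k * gram m k k' else 0)"
    by (intro sum.cong) (auto simp: gz)
  also have "\<dots> = c k * gram m k k'" using k by simp
  finally have g: "(\<Sum>j<2 * m. c j * gram m j k') = c k * gram m k k'" .
  have "\<bar>gram m k k'\<bar> = 1" using k by (auto simp: gram_def k'_def)
  then have "\<bar>c k\<bar> = \<bar>\<Sum>j<2 * m. c j * gram m j k'\<bar>" unfolding g by (simp add: abs_mult)
  also have "\<dots> = \<bar>\<Sum>j<2 * m. c j * (gram m j k' - b j k')\<bar>"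
    using eq[OF k'] by (simp add: right_diff_distrib sum_subtractf)
  also have "\<dots> \<le> (\<Sum>j<2 * m. \<bar>c k\<bar> * (1 / (2 * real m + 1)))"
  proof (rule order_trans[OF sum_abs sum_mono])
    fix j assume "j \<in> {..<2 * m}"
    then show "\<bar>c j * (gram m j k' - b j k')\<bar> \<le> \<bar>c k\<bar> * (1 / (2 * real m + 1))"
      using le[of j] near[OF _ k', of j] unfolding abs_mult
      by (intro mult_mono) (auto simp: abs_minus_commute)
  qed
  finally have "\<bar>c k\<bar> \<le> \<bar>c k\<bar> * (2 * real m / (2 * real m + 1))" by (simp add: mult.commute)
  then have "\<bar>c k\<bar> * (2 * real m + 1) \<le> \<bar>c k\<bar> * (2 * real m)" by (simp add: field_simps)
  then have "\<bar>c k\<bar> \<le> 0" by (simp add: distrib_left)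
  then show ?thesis using le[OF i] by simp
qed

lemma max_ideal_sq_restrict:
  assumes "f \<in> max_ideal_sq T C x" "C \<subseteq> C'" "x \<in> S"
  shows "f \<in> max_ideal_sq (subtopology T S) C' x"
proof -
  from assms(1) obtain U and n :: nat and a b where "openin T U" "x \<in> U"
    "\<forall>i<n. a i \<in> C \<and> a i x = 0 \<and> b i \<in> C \<and> b i x = 0" "\<forall>y\<in>U. f y = (\<Sum>i<n. a i y * b i y)"
    unfolding max_ideal_sq_def by blast
  then have "openin (subtopology T S) (U \<inter> S) \<and> x \<in> U \<inter> S \<and>
     (\<forall>i<n. a i \<in> C' \<and> a i x = 0 \<and> b i \<in> C' \<and> b i x = 0) \<and>
     (\<forall>y\<in>U \<inter> S. f y = (\<Sum>i<n. a i y * b i y))"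
    using assms(2,3) by (auto simp: openin_subtopology)
  then show ?thesis unfolding max_ideal_sq_def by blast
qed

section \<open>Symplectic and Poisson structures\<close>

locale symplectic_space = smooth_space X C for X :: "'a dspace" and C +
  fixes \<omega> :: "'a mfd \<Rightarrow> 'a form" and wt :: "'a form"
    and br :: "('a \<Rightarrow> real) \<Rightarrow> ('a \<Rightarrow> real) \<Rightarrow> 'a \<Rightarrow> real"
    and g :: "'a \<Rightarrow> ('a covector \<Rightarrow> real) multivector"
  assumes poisson: "poisson_structure X C \<omega> br"
    and bivector: "poisson_bivector_field X C br g"
    and weak: "weakly_symplectic X C \<omega> wt"
begin

lemma br_in: "f \<in> C \<Longrightarrow> k \<in> C \<Longrightarrow> br f k \<in> C"
  using poisson by (simp add: poisson_structure_def poisson_bracket_def)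

lemma br_anti: "f \<in> C \<Longrightarrow> k \<in> C \<Longrightarrow> y \<in> topspace T \<Longrightarrow> br f k y = - br k f y"
  using poisson unfolding poisson_structure_def poisson_bracket_def by blast

lemma br_comb: "f \<in> C \<Longrightarrow> f' \<in> C \<Longrightarrow> k \<in> C \<Longrightarrow> y \<in> topspace T \<Longrightarrow>
    br (\<lambda>z. a * f z + b * f' z) k y = a * br f k y + b * br f' k y"
  using poisson unfolding poisson_structure_def poisson_bracket_def by blast

abbreviation G where "G y \<equiv> bivector_eval (g y)"

lemma germ_X: "y \<in> topspace T \<Longrightarrow> germ_algebra T C y"
  using algebra_C by unfold_locales

lemma germ_S: "S \<in> strata X \<Longrightarrow> y \<in> pts S \<Longrightarrow> germ_algebra (subtopology T (pts S)) (mfd_smooth S) y"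
  using stratum_subset real_subalgebra_mfd_smooth[OF stratum_atlas] by unfold_locales auto

abbreviation dX where "dX \<equiv> diff_at T C"
abbreviation dS where "dS S \<equiv> diff_at (subtopology T (pts S)) (mfd_smooth S)"

lemma G_eq: "y \<in> topspace T \<Longrightarrow> f \<in> C \<Longrightarrow> k \<in> C \<Longrightarrow> G y (dX y f) (dX y k) = br f k y"
  using bivector unfolding poisson_bivector_field_def by blast

text \<open>On differentials of smooth functions G is the bracket, which is linear in the first
  argument and, by antisymmetry, in the second.\<close>

lemma G_alternating:
  assumes y: "y \<in> topspace T" shows "alternating_on (cotangent T C y) (G y)"
proof -
  interpret germ_algebra T C y by (rule germ_X[OF y])
  have "linear_on cot (G y (d f)) \<and> linear_on cot (\<lambda>v. G y v (d f)) \<and> G y (d f) (d f) = 0" if f: "f \<in> C" for f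
  proof (intro conjI)
    have add: "br (\<lambda>z. f z + f' z) k y = br f k y + br f' k y" if "f \<in> C" "f' \<in> C" "k \<in> C" for f f' k
      using br_comb[OF that y, of 1 1] by simp
    have scale: "br (\<lambda>z. c * f z) k y = c * br f k y" if "f \<in> C" "k \<in> C" for c f k
      using br_comb[OF that(1) that(1) that(2) y, of c 0] by simp
    show "linear_on cot (\<lambda>v. G y v (d f))"
      using f by (intro linear_on_cotI) (simp_all add: G_eq[OF y] C_add C_scale add scale)
    have add2: "br k (\<lambda>z. f z + f' z) y = br k f y + br k f' y" if "f \<in> C" "f' \<in> C" "k \<in> C" for f f' k
      using add[OF that] br_anti[OF that(3) C_add[OF that(1,2)] y]
        br_anti[OF that(3,1) y] br_anti[OF that(3,2) y] by simp
    have scale2: "br k (\<lambda>z. c * f z) y = c * br k f y" if "f \<in> C" "k \<in> C" for c f k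
      using scale[OF that, of c] br_anti[OF that(2) C_scale[OF that(1), of c] y] br_anti[OF that(2,1) y] by simp
    show "linear_on cot (G y (d f))"
      using f by (intro linear_on_cotI) (simp_all add: G_eq[OF y] C_add C_scale add2 scale2)
    show "G y (d f) (d f) = 0" using br_anti[OF f f y] f by (simp add: G_eq[OF y])
  qed
  then show ?thesis by (auto simp: alternating_on_def)
qed

text \<open>A presentation of the Zariski symplectic form as a sum of a du \<and> dv that holds
  throughout W, hence for all strata that meet W at once.\<close>

definition expansion :: "'a set \<Rightarrow> nat \<Rightarrow> (nat \<Rightarrow> 'a \<Rightarrow> real) \<Rightarrow> (nat \<Rightarrow> 'a \<Rightarrow> real) \<Rightarrow> (nat \<Rightarrow> 'a \<Rightarrow> real) \<Rightarrow> bool" where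
  "expansion W P a u v \<longleftrightarrow> openin T W \<and> (\<forall>p<P. a p \<in> C \<and> u p \<in> C \<and> v p \<in> C) \<and>
     (\<forall>y\<in>W. wt y = (\<lambda>A. \<Sum>p<P. a p y * wedge (cotangent T C y) [dX y (u p), dX y (v p)] A))"

lemma expansion_exists:
  assumes "x \<in> topspace T" obtains W P a u v where "expansion W P a u v" "x \<in> W"
proof -
  have "wt \<in> forms T C 2" using weak by (simp add: weakly_symplectic_def)
  then obtain W and P :: nat and a fs where W: "openin T W" "x \<in> W"
    and fs: "\<forall>i<P. a i \<in> C \<and> length (fs i) = 2 \<and> set (fs i) \<subseteq> C"
    and wt: "\<forall>y\<in>W. wt y = (\<lambda>A. \<Sum>i<P. a i y * wedge (cotangent T C y) (map (dX y) (fs i)) A)"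
    using assms unfolding forms_def by blast
  have 2: "fs i = [fs i ! 0, fs i ! 1]" if "i < P" for i
    using fs that by (auto simp: length_Suc_conv numeral_2_eq_2)
  have "map (dX y) (fs i) = [dX y (fs i ! 0), dX y (fs i ! 1)]" if "i < P" for i y
    by (subst 2[OF that]) simp
  then have "expansion W P a (\<lambda>i. fs i ! 0) (\<lambda>i. fs i ! 1)"
    using W fs wt unfolding expansion_def by (auto simp: subset_iff intro!: ext sum.cong)
  then show ?thesis using W(2) by (rule that)
qed

definition pairing :: "'a \<Rightarrow> real" where
  "pairing y = wt y (\<lambda>vs. G y (vs ! 0) (vs ! 1))"

lemma pairing_eq:
  assumes e: "expansion W P a u v" and y: "y \<in> W"
  shows "pairing y = (\<Sum>p<P. a p y * br (u p) (v p) y)"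
proof -
  have yT: "y \<in> topspace T" using e y openin_subset by (auto simp: expansion_def)
  interpret germ_algebra T C y by (rule germ_X[OF yT])
  have "wt y = (\<lambda>A. \<Sum>p<P. a p y * wedge cot [d (u p), d (v p)] A)"
    using e y by (simp add: expansion_def)
  then show ?thesis
    using alternating_on_alt_forms[OF vclosed_cot G_alternating[OF yT]] e
    by (simp add: pairing_def wedge_def numeral_2_eq_2 expansion_def G_eq[OF yT])
qed

lemma C_sum:
  assumes "finite I" "\<And>i. i \<in> I \<Longrightarrow> f i \<in> C" shows "(\<lambda>y. \<Sum>i\<in>I. f i y) \<in> C"
  using assms
  by (induction I rule: finite_induct) (use algebra_C(1) in \<open>auto simp: real_subalgebra_def\<close>)

lemma near_value:
  assumes "f \<in> C" "x \<in> topspace T" "e > 0"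
  obtains N where "openin T N" "x \<in> N" "\<And>y. y \<in> N \<Longrightarrow> \<bar>f y - f x\<bar> < e"
proof -
  have "openin T {y \<in> topspace T. f y \<in> ball (f x) e}"
    using algebra_C(2)[OF assms(1)] by (intro openin_continuous_map_preimage) auto
  then show ?thesis
    by (rule that) (use assms in \<open>auto simp: dist_real_def abs_minus_commute\<close>)
qed

text \<open>Restricting the expansion to S gives an expansion of \<open>\<omega> S y\<close>, to
  which \<open>darboux_expansion\<close> applies. As the functions a, u, v do not depend on the
  stratum, they make different strata comparable.\<close>

lemma stratum_darboux:
  assumes S: "S \<in> strata X" "y \<in> pts S" and e: "expansion W P a u v" "y \<in> W"
  obtains H m F where "germ_algebra.darboux (subtopology T (pts S)) (mfd_smooth S) y H (\<omega> S y) m F"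
    "\<And>f k. f \<in> C \<Longrightarrow> k \<in> C \<Longrightarrow> H (dS S y f) (dS S y k) = br f k y"
    "\<And>l z. linear_on (mfd_cotangent X S y) l \<Longrightarrow> z \<in> vcarrier (mfd_cotangent X S y) \<Longrightarrow>
      (\<Sum>p<P. a p y * (H (dS S y (v p)) z * l (dS S y (u p)) - H (dS S y (u p)) z * l (dS S y (v p)))) = l z"
    "pairing y = - real m"
proof -
  have yT: "y \<in> topspace T" using stratum_subset S by blast
  interpret gX: germ_algebra T C y by (rule germ_X[OF yT])
  interpret gS: germ_algebra "subtopology T (pts S)" "mfd_smooth S" y by (rule germ_S[OF S])
  note CS = C_smooth[OF S(1)]
  obtain H where H: "symplectic_bivector gS.cot (\<omega> S y) H"
    "\<forall>f\<in>C. \<forall>k\<in>C. br f k y = H (gS.d f) (gS.d k)"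
    using poisson S unfolding poisson_structure_def by blast
  obtain m F where D: "gS.darboux H (\<omega> S y) m F" by (rule gS.symplectic_bivector_darboux[OF H(1)])
  let ?r = "restrict_covector X S y"
  \<comment> \<open>Independent of the representative, because elements of C are smooth on S and so
    a product of two germs vanishing at y restricts to such a product.\<close>
  have r: "?r (gX.d f) = gS.d f" if f: "f \<in> C" for f
  proof -
    have "gS.d f' = gS.d f" if f': "f' \<in> gX.d f" for f'
    proof -
      have "f' \<in> C" "f' y = 0" and m: "(\<lambda>z. (f z - f y) - f' z) \<in> gX.msq" using gX.d_memD[OF f'] by auto
      moreover have "(\<lambda>z. (f z - f y) - f' z) \<in> gS.msq" by (rule max_ideal_sq_restrict[OF m CS S(2)])
      ultimately show ?thesis using f CS gS.d_eq_iff[of f f'] by auto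
    qed
    then show ?thesis using gX.shift_in_d[OF f] unfolding restrict_covector_def by blast
  qed
  have u: "a p \<in> C" "u p \<in> C" "v p \<in> C" if "p < P" for p using e(1) that by (auto simp: expansion_def)
  have w: "\<omega> S y A = (\<Sum>p<P. a p y * A [gS.d (u p), gS.d (v p)])" if A: "A \<in> alt_forms gS.cot 2" for A
  proof -
    have A': "(\<lambda>vs. A (map ?r vs)) \<in> alt_forms gX.cot 2"
      using CS by (intro alt_forms_map[OF A])
        (auto simp: r gX.vadd_cot gX.vscale_cot gS.vadd_cot gS.vscale_cot gX.C_add gX.C_scale subset_iff)
    have "\<omega> S = restrict_form X S 2 wt" using weak S(1) by (simp add: weakly_symplectic_def)
    then have "\<omega> S y A = wt y (\<lambda>vs. A (map ?r vs))" using A S(2) by (simp add: restrict_form_def)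
    also have "\<dots> = (\<Sum>p<P. a p y * A [gS.d (u p), gS.d (v p)])"
      using e A' u unfolding expansion_def by (simp add: wedge_def numeral_2_eq_2 r)
    finally show ?thesis .
  qed
  have car: "gS.d (u p) \<in> vcarrier gS.cot" "gS.d (v p) \<in> vcarrier gS.cot" if "p < P" for p
    using u[OF that] CS by auto
  note E = gS.darboux_expansion[OF D car w]
  have "(\<Sum>p<P. a p y * br (u p) (v p) y) = (\<Sum>p<P. a p y * H (gS.d (u p)) (gS.d (v p)))"
    using u H(2) by (intro sum.cong) auto
  then have "pairing y = - real m" using E(2) pairing_eq[OF e] by simp
  with D _ E(1) show ?thesis by (rule that) (use H(2) in auto)
qed

lemma pairing_nat:
  assumes "y \<in> topspace T" shows "\<exists>m::nat. pairing y = - real m"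
proof -
  obtain S where "S \<in> strata X" "y \<in> pts S" using strata_cover[OF assms] by blast
  moreover obtain W P a u v where "expansion W P a u v" "y \<in> W" using expansion_exists[OF assms] .
  ultimately show ?thesis by (rule stratum_darboux) (rule exI, assumption)
qed

lemma pairing_locally_constant:
  assumes x: "x \<in> topspace T"
  obtains N where "openin T N" "x \<in> N" "\<And>y. y \<in> N \<Longrightarrow> pairing y = pairing x"
proof -
  obtain W P a u v where e: "expansion W P a u v" "x \<in> W" using expansion_exists[OF x] .
  let ?f = "\<lambda>y. \<Sum>p<P. a p y * br (u p) (v p) y"
  have "?f \<in> C" using e(1) algebra_C(1) br_in
    by (intro C_sum) (auto simp: expansion_def real_subalgebra_def)
  then obtain N where N: "openin T N" "x \<in> N" "\<And>y. y \<in> N \<Longrightarrow> \<bar>?f y - ?f x\<bar> < 1"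
    using near_value[OF _ x, of ?f 1] by auto
  show ?thesis
  proof (rule that[of "N \<inter> W"])
    show "openin T (N \<inter> W)" "x \<in> N \<inter> W" using N e by (auto simp: expansion_def)
    fix y assume y: "y \<in> N \<inter> W"
    then have "\<bar>pairing y - pairing x\<bar> < 1" using N(3)[of y] e by (simp add: pairing_eq)
    moreover have "y \<in> topspace T" using y N(1) openin_subset by blast
    ultimately show "pairing y = pairing x" using pairing_nat[of y] pairing_nat[OF x] by auto
  qed
qed

text \<open>If the link of \<open>x\<close> were nonempty, then the rays of the cone would run through strata whose
  cotangent spaces have the same dimension as that of the stratum of \<open>x\<close>, because the pairing is
  locally constant. Nondegeneracy near \<open>x\<close> forces them to be spanned by differentials of functions of
  the ball coordinate, so all smooth functions would be constant along the rays.\<close>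

lemma ray_derivative_zero:
  assumes "local_model X C x U B L h CC S" and z: "z \<in> topspace (dtop L)"
  shows "\<exists>e>0. e \<le> 1 \<and> (\<forall>t0. 0 < t0 \<and> t0 < e \<longrightarrow> (\<forall>f\<in>C.
    ((\<lambda>t. f (local_model.ray x U h z t)) has_real_derivative 0) (at t0)))"
proof -
  interpret local_model X C x U B L h CC S by fact
  interpret gS: germ_algebra "subtopology T (pts S)" "mfd_smooth S" x by (rule germ_S[OF S])
  note CS = C_smooth[OF S(1)]
  obtain W P a u v where e: "expansion W P a u v" "x \<in> W" using expansion_exists[OF x_top] .
  then have auv: "a p \<in> C" "u p \<in> C" "v p \<in> C" if "p < P" for p using that by (auto simp: expansion_def)
  obtain H m F where D: "gS.darboux H (\<omega> S x) m F"
    and H: "\<And>f k. f \<in> C \<Longrightarrow> k \<in> C \<Longrightarrow> H (dS S x f) (dS S x k) = br f k x"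
    and rep: "\<And>l z. linear_on gS.cot l \<Longrightarrow> z \<in> vcarrier gS.cot \<Longrightarrow>
      (\<Sum>p<P. a p x * (H (dS S x (v p)) z * l (dS S x (u p)) - H (dS S x (u p)) z * l (dS S x (v p)))) = l z"
    and m: "pairing x = - real m"
    by (rule stratum_darboux[OF S e]) (rule that)
  have F: "F i \<in> mfd_smooth S" if "i < 2 * m" for i using D that by (simp add: gS.darboux_def)
  have Halt: "alternating_on gS.cot H" using D by (simp add: gS.darboux_def)
  \<comment> \<open>The functions F i are smooth on S only. The reproducing property with z = dF_i
    writes dF_i as a combination of the du_p and dv_p, and with these constant coefficients the
    functions u_p, v_p combine to an element of C.\<close>
  have "\<exists>f. f \<in> C \<and> (\<forall>l. linear_on gS.cot l \<longrightarrow> l (gS.d f) = l (gS.d (F i)))" if i: "i < 2 * m" for i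
  proof -
    let ?b = "\<lambda>p. a p x * H (gS.d (v p)) (gS.d (F i))" and ?b' = "\<lambda>p. - (a p x * H (gS.d (u p)) (gS.d (F i)))"
    let ?f = "\<lambda>y. (\<Sum>p<P. ?b p * u p y) + (\<Sum>p<P. ?b' p * v p y)"
    have s: "(\<lambda>y. \<Sum>p<P. c p * u p y) \<in> C" "(\<lambda>y. \<Sum>p<P. c p * v p y) \<in> C" for c
      by (intro germ_algebra.C_sum[OF germ_X[OF x_top]]; simp add: auv)+
    have "?f \<in> C" using algebra_C(1) s[of ?b] s[of ?b'] by (simp add: real_subalgebra_def)
    moreover have "l (gS.d ?f) = l (gS.d (F i))" if l: "linear_on gS.cot l" for l
    proof -
      have "l (gS.d ?f) = l (gS.d (\<lambda>y. \<Sum>p<P. ?b p * u p y)) + l (gS.d (\<lambda>y. \<Sum>p<P. ?b' p * v p y))"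
        by (rule gS.linear_on_cotD(1)[OF l]) (rule subsetD[OF CS], rule s)+
      also have "l (gS.d (\<lambda>y. \<Sum>p<P. ?b p * u p y)) = (\<Sum>p<P. ?b p * l (gS.d (u p)))"
        by (rule gS.linear_on_cot_sum[OF l]) (use auv CS in auto)
      also have "l (gS.d (\<lambda>y. \<Sum>p<P. ?b' p * v p y)) = (\<Sum>p<P. ?b' p * l (gS.d (v p)))"
        by (rule gS.linear_on_cot_sum[OF l]) (use auv CS in auto)
      also have "(\<Sum>p<P. ?b p * l (gS.d (u p))) + (\<Sum>p<P. ?b' p * l (gS.d (v p)))
        = (\<Sum>p<P. a p x * (H (gS.d (v p)) (gS.d (F i)) * l (gS.d (u p)) - H (gS.d (u p)) (gS.d (F i)) * l (gS.d (v p))))"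
        by (simp add: sum.distrib[symmetric] algebra_simps)
      also have "\<dots> = l (gS.d (F i))" by (rule rep[OF l]) (simp add: F[OF i])
      finally show ?thesis .
    qed
    ultimately show ?thesis by blast
  qed
  then obtain Y0 where Y0: "\<And>i. i < 2 * m \<Longrightarrow> Y0 i \<in> C"
    "\<And>i l. i < 2 * m \<Longrightarrow> linear_on gS.cot l \<Longrightarrow> l (gS.d (Y0 i)) = l (gS.d (F i))"
    by metis
  \<comment> \<open>Freezing makes these functions depend on the ball coordinate only. On S they do
    not change near x, so the differentials at x along S are kept.\<close>
  have "\<exists>f' q N. f' \<in> C \<and> openin T N \<and> x \<in> N \<and> N \<subseteq> U \<and>
    (\<forall>y\<in>N. f' y = q (fst (h y))) \<and> (\<forall>y\<in>N. y \<in> pts S \<longrightarrow> f' y = Y0 i y)" if "i < 2 * m" for i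
    by (rule freeze[OF Y0(1)[OF that]]) blast
  then obtain Y q N where YqN: "\<And>i. i < 2 * m \<Longrightarrow> Y i \<in> C \<and> openin T (N i) \<and> x \<in> N i \<and> N i \<subseteq> U \<and>
    (\<forall>y\<in>N i. Y i y = q i (fst (h y))) \<and> (\<forall>y\<in>N i. y \<in> pts S \<longrightarrow> Y i y = Y0 i y)"
    by metis
  then have Y: "\<And>i. i < 2 * m \<Longrightarrow> Y i \<in> C"
    and N: "\<And>i. i < 2 * m \<Longrightarrow> openin T (N i)" "\<And>i. i < 2 * m \<Longrightarrow> x \<in> N i"
    and q: "\<And>i y. i < 2 * m \<Longrightarrow> y \<in> N i \<Longrightarrow> Y i y = q i (fst (h y))"
    and YS: "\<And>i y. i < 2 * m \<Longrightarrow> y \<in> N i \<Longrightarrow> y \<in> pts S \<Longrightarrow> Y i y = Y0 i y"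
    by blast+
  have dY: "gS.d (Y i) = gS.d (Y0 i)" if "i < 2 * m" for i
    by (rule gS.d_cong[where U = "pts S \<inter> N i"])
      (use that Y Y0 CS N S YS in \<open>auto intro!: openin_pts_Int\<close>)
  \<comment> \<open>The bracket at x sees only differentials along S, and F i may be put for Y i in
    one slot at a time since each slot is a linear functional.\<close>
  have gram: "br (Y i) (Y j) x = gram m i j" if "i < 2 * m" "j < 2 * m" for i j
  proof -
    have lin: "linear_on gS.cot (\<lambda>w. H w k)" "linear_on gS.cot (H k)" if "k \<in> vcarrier gS.cot" for k
      using Halt that by (auto simp: alternating_on_def simp del: gS.vcarrier_cot)
    have k: "gS.d (Y0 j) \<in> vcarrier gS.cot" "gS.d (F i) \<in> vcarrier gS.cot"
      using Y0(1)[OF that(2)] F[OF that(1)] CS by auto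
    have "br (Y i) (Y j) x = H (gS.d (Y0 i)) (gS.d (Y0 j))"
      using H[OF Y[OF that(1)] Y[OF that(2)]] dY[OF that(1)] dY[OF that(2)] by simp
    also have "\<dots> = H (gS.d (F i)) (gS.d (Y0 j))" by (rule Y0(2)[OF that(1) lin(1)[OF k(1)]])
    also have "\<dots> = H (gS.d (F i)) (gS.d (F j))" by (rule Y0(2)[OF that(2) lin(2)[OF k(2)]])
    also have "\<dots> = gram m i j" using D that by (simp add: gS.darboux_def)
    finally show ?thesis .
  qed
  have "\<exists>N'. openin T N' \<and> x \<in> N' \<and> (\<forall>y\<in>N'. \<bar>br (Y i) (Y j) y - gram m i j\<bar> < 1 / (2 * real m + 1))"
    if ij: "i < 2 * m" "j < 2 * m" for i j
  proof -
    have "0 < 1 / (2 * real m + 1)" by simp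
    then obtain N' where "openin T N'" "x \<in> N'"
      "\<And>y. y \<in> N' \<Longrightarrow> \<bar>br (Y i) (Y j) y - br (Y i) (Y j) x\<bar> < 1 / (2 * real m + 1)"
      by (rule near_value[OF br_in[OF Y[OF ij(1)] Y[OF ij(2)]] x_top]) (rule that)
    then show ?thesis unfolding gram[OF ij] by blast
  qed
  then obtain N' where N': "\<And>i j. i < 2 * m \<Longrightarrow> j < 2 * m \<Longrightarrow> openin T (N' i j) \<and> x \<in> N' i j"
    "\<And>i j y. i < 2 * m \<Longrightarrow> j < 2 * m \<Longrightarrow> y \<in> N' i j \<Longrightarrow> \<bar>br (Y i) (Y j) y - gram m i j\<bar> < 1 / (2 * real m + 1)"
    by metis
  obtain Np where Np: "openin T Np" "x \<in> Np" "\<And>y. y \<in> Np \<Longrightarrow> pairing y = pairing x"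
    by (rule pairing_locally_constant[OF x_top]) (rule that)
  define O' where "O' = \<Inter>(insert Np (insert W (N ` {..<2 * m} \<union> (\<lambda>(i, j). N' i j) ` ({..<2 * m} \<times> {..<2 * m}))))"
  have O'_open: "openin T O'" unfolding O'_def
    using Np e N N' by (intro openin_Inter) (auto simp: expansion_def)
  have O'_x: "x \<in> O'" using Np e N N' by (auto simp: O'_def)
  have O'_D: "y \<in> Np" "y \<in> W" "i < 2 * m \<Longrightarrow> y \<in> N i" "i < 2 * m \<Longrightarrow> j < 2 * m \<Longrightarrow> y \<in> N' i j"
    if "y \<in> O'" for y i j using that by (auto simp: O'_def)
  obtain e0 where e0: "e0 > 0" "\<And>t. 0 \<le> t \<Longrightarrow> t < 1 \<Longrightarrow> \<bar>t - 0\<bar> < e0 \<Longrightarrow> ray z t \<in> O'"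
    using ray_preimage[OF z O'_open, of 0] O'_x ray_0[OF z] by auto
  show ?thesis
  proof (intro exI[of _ "min e0 1"] conjI allI impI ballI)
    fix t0 f assume t0': "0 < t0 \<and> t0 < min e0 1" and f: "f \<in> C"
    then have t0: "0 < t0" "t0 < 1" and near: "ray z t0 \<in> O'" using e0(2)[of t0] by auto
    let ?y = "ray z t0"
    have yT: "?y \<in> topspace T" using near O'_open openin_subset by blast
    then obtain R where R: "R \<in> strata X" "?y \<in> pts R" using strata_cover by blast
    note CR = C_smooth[OF R(1)]
    interpret gR: germ_algebra "subtopology T (pts R)" "mfd_smooth R" ?y by (rule germ_S[OF R])
    obtain H' m' F' where D': "gR.darboux H' (\<omega> R ?y) m' F'"
      and H': "\<And>f k. f \<in> C \<Longrightarrow> k \<in> C \<Longrightarrow> H' (dS R ?y f) (dS R ?y k) = br f k ?y"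
      and m': "pairing ?y = - real m'"
      by (rule stratum_darboux[OF R e(1) O'_D(2)[OF near]]) (rule that)
    \<comment> \<open>The pairing is constant near x, so the stratum that contains the ray has the
      same half dimension as S.\<close>
    have mm: "m' = m" using m m' Np(3)[OF O'_D(1)[OF near]] by simp
    have evR: "\<forall>\<^sub>F t in nhds t0. ray z t \<in> pts R \<inter> V" if V: "openin T V" "?y \<in> V" for V
    proof -
      obtain e' where e': "e' > 0" "\<And>t. 0 \<le> t \<Longrightarrow> t < 1 \<Longrightarrow> \<bar>t - t0\<bar> < e' \<Longrightarrow> ray z t \<in> V"
        using ray_preimage[OF z V(1), of t0] t0 V(2) by auto
      have "ray z t \<in> pts R \<inter> V" if "dist t t0 < min e' (min t0 (1 - t0))" for t
      proof -
        have "0 < t" "t < 1" "\<bar>t - t0\<bar> < e'" using that by (auto simp: dist_real_def)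
        then show ?thesis using e'(2)[of t] by - (rule ray_stratum[OF z R(1) t0 R(2)], auto)
      qed
      then show ?thesis using e'(1) t0 unfolding eventually_nhds_metric
        by (intro exI[of _ "min e' (min t0 (1 - t0))"]) auto
    qed
    have diff: "((\<lambda>t. f (ray z t)) has_real_derivative deriv (\<lambda>t. f (ray z t)) t0) (at t0)"
      if "f \<in> mfd_smooth R" for f
      using ray_differentiable[OF z R(1) t0 R(2) that] by (simp add: DERIV_deriv_iff_real_differentiable)
    \<comment> \<open>Product rule: both factors of each summand vanish at the point.\<close>
    have msq0: "((\<lambda>t. f (ray z t)) has_real_derivative 0) (at t0)" if f: "f \<in> gR.msq" for f
    proof -
      from f obtain V n a b where V: "openin (subtopology T (pts R)) V" "?y \<in> V"
        and ab: "\<And>i. i < (n::nat) \<Longrightarrow> a i \<in> mfd_smooth R \<and> a i ?y = 0 \<and> b i \<in> mfd_smooth R \<and> b i ?y = 0"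
        and feq: "\<And>w. w \<in> V \<Longrightarrow> f w = (\<Sum>i<n. a i w * b i w)" by (rule gR.msqE) blast
      obtain V' where V': "openin T V'" "V = V' \<inter> pts R" using V(1) by (auto simp: openin_subtopology)
      have "((\<lambda>t. a i (ray z t) * b i (ray z t)) has_real_derivative 0) (at t0)" if "i < n" for i
        using DERIV_mult[OF diff diff, of "a i" "b i"] ab[OF that] by simp
      then have "((\<lambda>t. \<Sum>i<n. a i (ray z t) * b i (ray z t)) has_real_derivative (\<Sum>i<n. 0)) (at t0)"
        by (intro DERIV_sum) auto
      moreover have "\<forall>\<^sub>F t in nhds t0. (\<Sum>i<n. a i (ray z t) * b i (ray z t)) = f (ray z t)"
        using evR[OF V'(1)] V V'(2) feq by (auto elim!: eventually_mono)
      ultimately show ?thesis using DERIV_cong_ev[OF refl _ refl, THEN iffD1] by fastforce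
    qed
    \<comment> \<open>The velocity of the ray as a functional on the covectors of R. A
      representative is picked arbitrarily; by \<open>msq0\<close> the choice does not influence the
      derivative.\<close>
    define \<kappa> where "\<kappa> w = deriv (\<lambda>t. (SOME f. f \<in> mfd_smooth R \<and> gR.d f = w) (ray z t)) t0" for w
    have \<kappa>: "\<kappa> (gR.d f) = deriv (\<lambda>t. f (ray z t)) t0" if f: "f \<in> mfd_smooth R" for f
    proof -
      define f' where "f' = (SOME f'. f' \<in> mfd_smooth R \<and> gR.d f' = gR.d f)"
      have f': "f' \<in> mfd_smooth R \<and> gR.d f' = gR.d f"
        unfolding f'_def by (rule someI[of _ f]) (use f in auto)
      have "((\<lambda>t. (f' (ray z t) - f' ?y) - (f (ray z t) - f ?y)) has_real_derivative 0) (at t0)"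
        using gR.d_eq_iff[of f' f] f f' by (intro msq0) auto
      moreover have "((\<lambda>t. (f' (ray z t) - f' ?y) - (f (ray z t) - f ?y)) has_real_derivative
          deriv (\<lambda>t. f' (ray z t)) t0 - deriv (\<lambda>t. f (ray z t)) t0) (at t0)"
        using diff[of f] diff[of f'] f f' by (auto intro!: derivative_eq_intros)
      ultimately have "0 = deriv (\<lambda>t. f' (ray z t)) t0 - deriv (\<lambda>t. f (ray z t)) t0" by (rule DERIV_unique)
      then show ?thesis by (simp add: \<kappa>_def f'_def)
    qed
    have \<kappa>_lin: "linear_on gR.cot \<kappa>"
    proof (rule gR.linear_on_cotI)
      fix f k assume "f \<in> mfd_smooth R" "k \<in> mfd_smooth R"
      then show "\<kappa> (gR.d (\<lambda>y. f y + k y)) = \<kappa> (gR.d f) + \<kappa> (gR.d k)"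
        using DERIV_imp_deriv[OF DERIV_add[OF diff diff], of f k] by (simp add: \<kappa> gR.C_add)
    next
      fix c f assume "f \<in> mfd_smooth R"
      then show "\<kappa> (gR.d (\<lambda>y. c * f y)) = c * \<kappa> (gR.d f)"
        using DERIV_imp_deriv[OF DERIV_cmult[OF diff], of f c] by (simp add: \<kappa> gR.C_scale)
    qed
    \<comment> \<open>Y i is a function of the ball coordinate, which equals x all along the
      ray.\<close>
    have \<kappa>_Y: "\<kappa> (gR.d (Y i)) = 0" if i: "i < 2 * m" for i
    proof -
      have "\<forall>\<^sub>F t in nhds t0. 0 < t \<and> t < 1"
        using eventually_nhds_in_open[of "{0<..<1}" t0] t0 by simp
      with evR[OF N(1)[OF i] O'_D(3)[OF near i]]
      have ev: "\<forall>\<^sub>F t in nhds t0. Y i (ray z t) = q i x"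
        by eventually_elim (use q[OF i] ray(2)[OF z] in auto)
      have "((\<lambda>t. Y i (ray z t)) has_real_derivative 0) (at t0)"
        by (rule DERIV_cong_ev[OF refl ev refl, THEN iffD2]) simp
      then show ?thesis using Y[OF i] CR by (subst \<kappa>) (auto intro: DERIV_imp_deriv)
    qed
    \<comment> \<open>These are 2m + 1 covectors of R, one more than the dimension, so there is a
      nontrivial relation. Since the relation must involve df, applying \<kappa> to it gives
      \<kappa>(df) = 0.\<close>
    define us where "us i = (if i < 2 * m then gR.d (Y i) else gR.d f)" for i
    have "\<forall>i\<le>2 * m. us i \<in> vcarrier gR.cot" using Y f CR by (auto simp: us_def)
    then obtain c where c: "\<exists>i\<le>2 * m. c i \<noteq> 0"
      "\<And>l. linear_on gR.cot l \<Longrightarrow> (\<Sum>i\<le>2 * m. c i * l (us i)) = 0"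
      using D' unfolding gR.darboux_def mm by blast
    have c': "(\<Sum>i<2 * m. c i * l (gR.d (Y i))) + c (2 * m) * l (gR.d f) = 0" if "linear_on gR.cot l" for l
    proof -
      have "(\<Sum>i<2 * m. c i * l (us i)) = (\<Sum>i<2 * m. c i * l (gR.d (Y i)))" by (simp add: us_def)
      then show ?thesis using c(2)[OF that] by (simp add: lessThan_Suc_atMost[symmetric] us_def)
    qed
    \<comment> \<open>Otherwise the dY_i alone would be dependent, although their brackets near x
      are close to the Gram matrix.\<close>
    have nz: "c (2 * m) \<noteq> 0"
    proof
      assume 0: "c (2 * m) = 0"
      have "c i = 0" if "i < 2 * m" for i
      proof (rule near_gram_independent[where b = "\<lambda>i j. br (Y i) (Y j) ?y", OF _ _ that])
        show "\<bar>br (Y i) (Y j) ?y - gram m i j\<bar> < 1 / (2 * real m + 1)" if "i < 2 * m" "j < 2 * m" for i j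
          using N'(2)[OF that O'_D(4)[OF near that]] .
        show "(\<Sum>i<2 * m. c i * br (Y i) (Y j) ?y) = 0" if j: "j < 2 * m" for j
        proof -
          have "gR.d (Y j) \<in> vcarrier gR.cot" using Y[OF j] CR by auto
          then have "linear_on gR.cot (\<lambda>w. H' w (gR.d (Y j)))"
            using D' unfolding gR.darboux_def alternating_on_def by blast
          from c'[OF this] show ?thesis using 0 H' Y j by simp
        qed
      qed
      then show False using c(1) 0 by (metis le_neq_implies_less)
    qed
    have "c (2 * m) * \<kappa> (gR.d f) = 0" using c'[OF \<kappa>_lin] \<kappa>_Y by simp
    then have "deriv (\<lambda>t. f (ray z t)) t0 = 0" using nz \<kappa>[of f] f CR by auto
    then show "((\<lambda>t. f (ray z t)) has_real_derivative 0) (at t0)" using diff[of f] f CR by auto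
  qed (use e0(1) in auto)
qed

end

section \<open>Radial bump functions and the absence of links\<close>

lemma bump_smooth:
  "(\<lambda>t. flat 0 (t - a) * flat 0 (b - t)) \<in> mfd_smooth unit_interval_mfd"
proof -
  let ?\<theta> = "\<lambda>t i. if i = (0::nat) then t else (0::real)" and ?I = "{0<..<1::real}"
  have inj: "inj_on ?\<theta> ?I" by (auto simp: inj_on_def fun_eq_iff)
  have img: "?\<theta> ` ?I = {y \<in> topspace (Euclidean_space 1). y 0 \<in> ?I}"
  proof -
    have "y = ?\<theta> (y 0)" if "y \<in> topspace (Euclidean_space 1)" for y
      using that by (auto simp: topspace_Euclidean_space fun_eq_iff)
    then have "{y \<in> topspace (Euclidean_space 1). y 0 \<in> ?I} \<subseteq> ?\<theta> ` ?I" by (intro subsetI) blast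
    then show ?thesis by (auto simp: topspace_Euclidean_space)
  qed
  have "continuous_map (Euclidean_space 1) euclideanreal (\<lambda>y. y 0)"
    using continuous_map_coord[of 1 "topspace (Euclidean_space 1)" 0] by simp
  then have W: "openin (Euclidean_space 1) (?\<theta> ` ?I)"
    unfolding img by (intro openin_continuous_map_preimage) auto
  note coord = smooth_on_coord[OF W, of 0] and const = smooth_on_const[OF W]
  have "smooth_on 1 (?\<theta> ` ?I) (\<lambda>y. flat 0 (y 0 + - a) * flat 0 (b + (- 1) * y 0))"
    by (intro smooth_on_mult smooth_on_flat_compose smooth_on_add coord const)
  then have "smooth_on 1 (?\<theta> ` ?I) (\<lambda>y. flat 0 (inv_into ?I ?\<theta> y - a) * flat 0 (b - inv_into ?I ?\<theta> y))"
    by (rule smooth_on_cong) (auto simp: inv_into_f_f[OF inj])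
  then show ?thesis by (simp add: mfd_smooth_def unit_interval_mfd_def)
qed

context symplectic_space begin

text \<open>A radial bump function is locally a restriction of elements of C, so along the ray its
  derivative would be zero on the whole interval (0, e), where it is not constant.\<close>

lemma link_empty:
  assumes lm: "local_model X C x U B L h CC S" shows "topspace (dtop L) = {}"
proof (rule ccontr)
  interpret local_model X C x U B L h CC S by (rule lm)
  assume "topspace (dtop L) \<noteq> {}"
  then obtain z where z: "z \<in> topspace (dtop L)" by blast
  obtain e where e: "e > 0" "e \<le> 1" and der: "\<And>t0 f. 0 < t0 \<Longrightarrow> t0 < e \<Longrightarrow> f \<in> C \<Longrightarrow>
    ((\<lambda>t. f (ray z t)) has_real_derivative 0) (at t0)"
    using ray_derivative_zero[OF lm z] by blast
  \<comment> \<open>The support lies inside (0, e), and \<rho> vanishes at e/4 but is positive at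
    e/2.\<close>
  define \<rho> where "\<rho> t = flat 0 (t - e / 4) * flat 0 (3 * e / 4 - t)" for t
  let ?\<Phi> = "\<lambda>p. case p of None \<Rightarrow> 0 | Some (z :: 'a, t) \<Rightarrow> \<rho> t"
  have \<Phi>: "?\<Phi> \<in> CC"
  proof (rule bumps)
    show "\<rho> \<in> mfd_smooth unit_interval_mfd" using bump_smooth unfolding \<rho>_def .
    show "compact {e / 4..3 * e / 4}" "{e / 4..3 * e / 4} \<subseteq> {0<..<1}" using e by auto
    show "\<rho> t = 0" if "t \<notin> {e / 4..3 * e / 4}" for t using that by (auto simp: \<rho>_def flat_def)
  qed
  have "(\<lambda>p. ?\<Phi> (snd p)) \<in> prod_smooth (subtopology T (pts B)) (mfd_smooth B) (cone_topology (dtop L)) CC"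
    unfolding prod_smooth_def mem_Collect_eq
  proof (rule ballI, rule exI[of _ "topspace (prod_topology (subtopology T (pts B)) (cone_topology (dtop L)))"],
      rule exI[of _ 0], rule exI[of _ 1], rule exI[of _ "\<lambda>y. y 0"], rule exI[of _ "\<lambda>_ _. 0"],
      rule exI[of _ "\<lambda>_. ?\<Phi>"], intro conjI)
    show "smooth_on (0 + 1) (topspace (Euclidean_space (0 + 1))) (\<lambda>y. y 0)" by (intro smooth_on_coord) simp
  qed (use \<Phi> openin_topspace[of "prod_topology (subtopology T (pts B)) (cone_topology (dtop L))"] in auto)
  then have loc': "(\<lambda>y. ?\<Phi> (snd (h y))) \<in> local_functions T C U" unfolding loc by (intro bexI) auto
  have D: "(\<rho> has_real_derivative 0) (at t0)" if t0: "0 < t0" "t0 < e" for t0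
  proof -
    have "ray z t0 \<in> U" using ray(1)[OF z] t0 e by simp
    then obtain W f where W: "openin T W" "ray z t0 \<in> W" "f \<in> C" "\<forall>y\<in>W \<inter> U. ?\<Phi> (snd (h y)) = f y"
      using loc' unfolding local_functions_def by blast
    obtain e' where e': "e' > 0" "\<And>t. 0 \<le> t \<Longrightarrow> t < 1 \<Longrightarrow> \<bar>t - t0\<bar> < e' \<Longrightarrow> ray z t \<in> W"
      using ray_preimage[OF z W(1), of t0] t0 e W(2) by auto
    have "f (ray z t) = \<rho> t" if "dist t t0 < min e' (min t0 (1 - t0))" for t
    proof -
      have t: "0 < t" "t < 1" "\<bar>t - t0\<bar> < e'" using that by (auto simp: dist_real_def)
      then have "f (ray z t) = ?\<Phi> (snd (h (ray z t)))" using W(4) e'(2) ray(1)[OF z, of t] by simp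
      then show ?thesis using t by (simp add: ray(2)[OF z] cone_proj_def)
    qed
    then have ev: "\<forall>\<^sub>F t in nhds t0. f (ray z t) = \<rho> t"
      using e'(1) t0 e unfolding eventually_nhds_metric
      by (intro exI[of _ "min e' (min t0 (1 - t0))"]) auto
    show ?thesis by (rule DERIV_cong_ev[OF refl ev refl, THEN iffD1, OF der[OF t0 W(3)]])
  qed
  have "\<exists>t. e / 4 < t \<and> t < e / 2 \<and> \<rho> (e / 2) - \<rho> (e / 4) = (e / 2 - e / 4) * 0"
    using e D by (intro MVT2) auto
  then have "\<rho> (e / 2) = \<rho> (e / 4)" by auto
  moreover have "\<rho> (e / 4) = 0" "\<rho> (e / 2) > 0" using e by (auto simp: \<rho>_def flat_def)
  ultimately show False by simp
qed

section \<open>Comparison of the cotangent spaces of the space and of a stratum\<close>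

lemma smooth_germ:
  assumes S: "S \<in> strata X" "x \<in> pts S" and a: "a \<in> mfd_smooth S"
  obtains f N where "f \<in> C" "openin T N" "x \<in> N" "N \<subseteq> pts S" "\<forall>y\<in>N. f y = a y"
proof -
  obtain U B L h CC where lm: "local_model X C x U B L h CC S"
    using local_model_exists stratum_subset[OF S(1)] S by blast
  show ?thesis by (rule local_model.smooth_germ_in_C[OF lm link_empty[OF lm] a]) (rule that, auto)
qed

text \<open>Membership in the squared ideal on S is witnessed by finitely many smooth functions on
  S, and \<open>smooth_germ\<close> replaces each of them near x by an element of C.\<close>

lemma dX_inj:
  assumes S: "S \<in> strata X" "x \<in> pts S" and f: "f \<in> C" "f' \<in> C" and eq: "dS S x f = dS S x f'"
  shows "dX x f = dX x f'"
proof -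
  have xT: "x \<in> topspace T" using stratum_subset S by blast
  interpret gX: germ_algebra T C x by (rule germ_X[OF xT])
  interpret gS: germ_algebra "subtopology T (pts S)" "mfd_smooth S" x by (rule germ_S[OF S])
  let ?h = "\<lambda>y. (f y - f x) - (f' y - f' x)"
  have "?h \<in> gS.msq" using gS.d_eq_iff[of f f'] eq f C_smooth[OF S(1)] by auto
  then obtain V n a b where V: "openin (subtopology T (pts S)) V" "x \<in> V"
    and ab: "\<And>i. i < (n::nat) \<Longrightarrow> a i \<in> mfd_smooth S \<and> a i x = 0 \<and> b i \<in> mfd_smooth S \<and> b i x = 0"
    and heq: "\<And>y. y \<in> V \<Longrightarrow> ?h y = (\<Sum>i<n. a i y * b i y)" by (rule gS.msqE) blast
  obtain V' where V': "openin T V'" "V = V' \<inter> pts S" using V(1) by (auto simp: openin_subtopology)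
  have ext: "\<exists>k N. k \<in> C \<and> openin T N \<and> x \<in> N \<and> N \<subseteq> pts S \<and> (\<forall>y\<in>N. k y = a y)"
    if "a \<in> mfd_smooth S" for a by (rule smooth_germ[OF S that]) blast
  have "\<forall>i\<in>{..<n}. \<exists>k N. k \<in> C \<and> openin T N \<and> x \<in> N \<and> N \<subseteq> pts S \<and> (\<forall>y\<in>N. k y = a i y)"
    using ext ab by simp
  then obtain a' Na where a': "\<And>i. i < n \<Longrightarrow> a' i \<in> C \<and> openin T (Na i) \<and> x \<in> Na i \<and> Na i \<subseteq> pts S \<and> (\<forall>y\<in>Na i. a' i y = a i y)"
    by (metis lessThan_iff)
  have "\<forall>i\<in>{..<n}. \<exists>k N. k \<in> C \<and> openin T N \<and> x \<in> N \<and> N \<subseteq> pts S \<and> (\<forall>y\<in>N. k y = b i y)"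
    using ext ab by simp
  then obtain b' Nb where b': "\<And>i. i < n \<Longrightarrow> b' i \<in> C \<and> openin T (Nb i) \<and> x \<in> Nb i \<and> Nb i \<subseteq> pts S \<and> (\<forall>y\<in>Nb i. b' i y = b i y)"
    by (metis lessThan_iff)
  \<comment> \<open>Applied to the zero function, \<open>smooth_germ\<close> merely supplies an open
    set of X around x that lies in S; for n = 0 no other one is at hand.\<close>
  have "(\<lambda>_. 0) \<in> mfd_smooth S" by (rule gS.C_const)
  then obtain k0 N0 where N0: "openin T N0" "x \<in> N0" "N0 \<subseteq> pts S" using smooth_germ[OF S] by metis
  let ?O = "\<Inter>(insert V' (insert N0 (Na ` {..<n} \<union> Nb ` {..<n})))"
  have "?h \<in> gX.msq"
  proof (rule gX.msqI[of ?O n a' b'])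
    show "openin T ?O" using V' N0 a' b' by (intro openin_Inter) auto
    show "x \<in> ?O" using V V' N0 a' b' by auto
    show "a' i \<in> C \<and> a' i x = 0 \<and> b' i \<in> C \<and> b' i x = 0" if "i < n" for i
      using a'[OF that] b'[OF that] ab[OF that] by auto
    show "?h y = (\<Sum>i<n. a' i y * b' i y)" if y: "y \<in> ?O" for y
    proof -
      have "y \<in> V" using y V' N0 by auto
      then have "?h y = (\<Sum>i<n. a i y * b i y)" by (rule heq)
      also have "\<dots> = (\<Sum>i<n. a' i y * b' i y)" using y a' b' by (intro sum.cong) auto
      finally show ?thesis .
    qed
  qed
  then show ?thesis using gX.d_eq_iff[OF f] by simp
qed

text \<open>The reproducing property is known on S and is carried over to X. A functional l on
  covectors of X yields one on covectors of S: every covector of S is the differential of an element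
  of C, and by \<open>dX_inj\<close> the value does not depend on that element.\<close>

lemma symplectic_point_at:
  assumes e: "expansion W P a u v" and x: "x \<in> W"
  obtains m where "pairing x = - real m"
    "symplectic_point (cotangent T C x) (wt x) (g x) P m (\<lambda>p. a p x) (\<lambda>p. dX x (u p)) (\<lambda>p. dX x (v p))"
proof -
  have xT: "x \<in> topspace T" using e x openin_subset by (auto simp: expansion_def)
  obtain S where S: "S \<in> strata X" "x \<in> pts S" using strata_cover[OF xT] by blast
  interpret gX: germ_algebra T C x by (rule germ_X[OF xT])
  interpret gS: germ_algebra "subtopology T (pts S)" "mfd_smooth S" x by (rule germ_S[OF S])
  note CS = C_smooth[OF S(1)]
  have auv: "a p \<in> C" "u p \<in> C" "v p \<in> C" if "p < P" for p using e that by (auto simp: expansion_def)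
  obtain H m F where D: "gS.darboux H (\<omega> S x) m F"
    and H: "\<And>f k. f \<in> C \<Longrightarrow> k \<in> C \<Longrightarrow> H (dS S x f) (dS S x k) = br f k x"
    and rep: "\<And>l z. linear_on gS.cot l \<Longrightarrow> z \<in> vcarrier gS.cot \<Longrightarrow>
      (\<Sum>p<P. a p x * (H (dS S x (v p)) z * l (dS S x (u p)) - H (dS S x (u p)) z * l (dS S x (v p)))) = l z"
    and m: "pairing x = - real m"
    by (rule stratum_darboux[OF S e x]) (rule that)
  have "symplectic_point gX.cot (wt x) (g x) P m (\<lambda>p. a p x) (\<lambda>p. gX.d (u p)) (\<lambda>p. gX.d (v p))"
  proof
    show "vclosed gX.cot" by (rule gX.vclosed_cot)
    show "gX.d (u p) \<in> vcarrier gX.cot" "gX.d (v p) \<in> vcarrier gX.cot" if "p < P" for p using auv[OF that] by auto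
    show "wt x = (\<lambda>A. \<Sum>p<P. a p x * wedge gX.cot [gX.d (u p), gX.d (v p)] A)"
      using e x by (simp add: expansion_def)
    show "alternating_on gX.cot (G x)" by (rule G_alternating[OF xT])
    show "(\<Sum>p<P. a p x * G x (gX.d (u p)) (gX.d (v p))) = - real m"
      using pairing_eq[OF e x] m auv by (simp add: G_eq[OF xT])
    fix l z assume l: "linear_on gX.cot l" and "z \<in> vcarrier gX.cot"
    then obtain f where f: "f \<in> C" "z = gX.d f" by auto
    define l' where "l' w = l (gX.d (SOME k. k \<in> C \<and> gS.d k = w))" for w
    have l': "l' (gS.d k) = l (gX.d k)" if k: "k \<in> C" for k
    proof -
      define k' where "k' = (SOME k'. k' \<in> C \<and> gS.d k' = gS.d k)"
      have k': "k' \<in> C \<and> gS.d k' = gS.d k" unfolding k'_def by (rule someI[of _ k]) (use k in auto)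
      then have "gX.d k' = gX.d k" using dX_inj[OF S _ k] by blast
      then show ?thesis by (simp add: l'_def k'_def)
    qed
    have rep_C: "\<exists>k\<in>C. gS.d k = gS.d b" if b: "b \<in> mfd_smooth S" for b
    proof -
      obtain k N where "k \<in> C" "openin T N" "x \<in> N" "N \<subseteq> pts S" "\<forall>y\<in>N. k y = b y"
        by (rule smooth_germ[OF S b]) (rule that)
      then show ?thesis using CS b S
        by (intro bexI[of _ k] gS.d_cong[where U = "pts S \<inter> N"]) (auto intro!: openin_pts_Int)
    qed
    have "linear_on gS.cot l'"
    proof (rule gS.linear_on_cotI)
      fix b b' assume b: "b \<in> mfd_smooth S" "b' \<in> mfd_smooth S"
      then obtain k k' where k: "k \<in> C" "k' \<in> C" "gS.d k = gS.d b" "gS.d k' = gS.d b'" using rep_C by metis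
      have "gS.d (\<lambda>y. b y + b' y) = gS.d (\<lambda>y. k y + k' y)"
        using k b CS by (intro gS.d_add_cong) auto
      then show "l' (gS.d (\<lambda>y. b y + b' y)) = l' (gS.d b) + l' (gS.d b')"
        using k gX.linear_on_cotD(1)[OF l, of k k'] l' gX.C_add[of k k'] by (metis (no_types, lifting))
    next
      fix c b assume b: "b \<in> mfd_smooth S"
      then obtain k where k: "k \<in> C" "gS.d k = gS.d b" using rep_C by metis
      have "gS.d (\<lambda>y. c * b y) = gS.d (\<lambda>y. c * k y)" using k b CS by (intro gS.d_scale_cong) auto
      then show "l' (gS.d (\<lambda>y. c * b y)) = c * l' (gS.d b)"
        using k gX.linear_on_cotD(2)[OF l, of k c] l' gX.C_scale[of k c] by (metis (no_types, lifting))
    qed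
    from rep[OF this, of "gS.d f"] show "(\<Sum>p<P. a p x * (G x (gX.d (v p)) z * l (gX.d (u p)) - G x (gX.d (u p)) z * l (gX.d (v p)))) = l z"
      using f CS auv by (simp add: l' H G_eq[OF xT] subset_iff)
  qed
  with m show ?thesis by (rule that)
qed

end

section \<open>The Lefschetz decomposition\<close>

context symplectic_space begin

section \<open>Smooth forms and their stability under both operators\<close>

lemma form_off: "\<alpha> \<in> forms T C k \<Longrightarrow> y \<notin> topspace T \<Longrightarrow> \<alpha> y = (\<lambda>_. 0)"
  by (auto simp: forms_def)

lemma form_localE:
  assumes "\<alpha> \<in> forms T C k" "x \<in> topspace T"
  obtains U N f0 fs where "openin T U" "x \<in> U"
    "\<forall>i<(N::nat). f0 i \<in> C \<and> length (fs i) = k \<and> set (fs i) \<subseteq> C"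
    "\<forall>y\<in>U. \<alpha> y = (\<lambda>A. \<Sum>i<N. f0 i y * wedge (cotangent T C y) (map (dX y) (fs i)) A)"
  using assms unfolding forms_def by blast

lemma formsI:
  assumes "\<And>y. y \<notin> topspace T \<Longrightarrow> \<alpha> y = (\<lambda>_. 0)"
    and "\<And>x. x \<in> topspace T \<Longrightarrow> \<exists>U (N::nat) f0 fs. openin T U \<and> x \<in> U \<and>
        (\<forall>i<N. f0 i \<in> C \<and> length (fs i) = k \<and> set (fs i) \<subseteq> C) \<and>
        (\<forall>y\<in>U. \<alpha> y = (\<lambda>A. \<Sum>i<N. f0 i y * wedge (cotangent T C y) (map (dX y) (fs i)) A))"
  shows "\<alpha> \<in> forms T C k"
  using assms by (simp add: forms_def)

lemma form_at: "\<alpha> \<in> forms T C k \<Longrightarrow> y \<in> topspace T \<Longrightarrow> \<alpha> y \<in> ext_power (cotangent T C y) k"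
proof (erule form_localE, assumption)
  fix U N f0 fs assume y: "y \<in> U"
    and fs: "\<forall>i<(N::nat). f0 i \<in> C \<and> length (fs i) = k \<and> set (fs i) \<subseteq> C"
    and \<alpha>: "\<forall>y\<in>U. \<alpha> y = (\<lambda>A. \<Sum>i<N. f0 i y * wedge (cotangent T C y) (map (dX y) (fs i)) A)"
  have "(\<lambda>A. \<Sum>i<N. f0 i y * wedge (cotangent T C y) (map (dX y) (fs i)) A) \<in> ext_power (cotangent T C y) k"
    using fs by (intro ext_power_sum ext_power_wedge) (auto simp: cotangent_def)
  then show ?thesis using \<alpha> y by simp
qed

lemma forms_local:
  assumes "\<And>y. y \<notin> topspace T \<Longrightarrow> \<alpha> y = (\<lambda>_. 0)"
    and "\<And>x. x \<in> topspace T \<Longrightarrow> \<exists>U \<beta>. openin T U \<and> x \<in> U \<and> \<beta> \<in> forms T C k \<and> (\<forall>y\<in>U. \<alpha> y = \<beta> y)"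
  shows "\<alpha> \<in> forms T C k"
proof (rule formsI[OF assms(1)])
  fix x assume x: "x \<in> topspace T"
  then obtain U \<beta> where U: "openin T U" "x \<in> U" and \<beta>: "\<beta> \<in> forms T C k" "\<forall>y\<in>U. \<alpha> y = \<beta> y"
    using assms(2) by blast
  obtain U' N f0 fs where U': "openin T U'" "x \<in> U'"
    "\<forall>i<(N::nat). f0 i \<in> C \<and> length (fs i) = k \<and> set (fs i) \<subseteq> C"
    "\<forall>y\<in>U'. \<beta> y = (\<lambda>A. \<Sum>i<N. f0 i y * wedge (cotangent T C y) (map (dX y) (fs i)) A)"
    by (rule form_localE[OF \<beta>(1) x])
  show "\<exists>U (N::nat) f0 fs. openin T U \<and> x \<in> U \<and>
        (\<forall>i<N. f0 i \<in> C \<and> length (fs i) = k \<and> set (fs i) \<subseteq> C) \<and>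
        (\<forall>y\<in>U. \<alpha> y = (\<lambda>A. \<Sum>i<N. f0 i y * wedge (cotangent T C y) (map (dX y) (fs i)) A))"
    using U U' \<beta>(2)
    by (intro exI[of _ "U \<inter> U'"] exI[of _ N] exI[of _ f0] exI[of _ fs]) auto
qed auto

lemma forms_comb:
  assumes "\<alpha> \<in> forms T C k" "\<beta> \<in> forms T C k"
  shows "(\<lambda>y A. a * \<alpha> y A + b * \<beta> y A) \<in> forms T C k"
proof (rule formsI)
  show "(\<lambda>A. a * \<alpha> y A + b * \<beta> y A) = (\<lambda>_. 0)" if "y \<notin> topspace T" for y
    using form_off[OF assms(1) that] form_off[OF assms(2) that] by simp
  fix x assume x: "x \<in> topspace T"
  obtain U N f0 fs where 1: "openin T U" "x \<in> U"
    "\<forall>i<(N::nat). f0 i \<in> C \<and> length (fs i) = k \<and> set (fs i) \<subseteq> C"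
    "\<forall>y\<in>U. \<alpha> y = (\<lambda>A. \<Sum>i<N. f0 i y * wedge (cotangent T C y) (map (dX y) (fs i)) A)"
    by (rule form_localE[OF assms(1) x])
  obtain U' N' f0' fs' where 2: "openin T U'" "x \<in> U'"
    "\<forall>i<(N'::nat). f0' i \<in> C \<and> length (fs' i) = k \<and> set (fs' i) \<subseteq> C"
    "\<forall>y\<in>U'. \<beta> y = (\<lambda>A. \<Sum>i<N'. f0' i y * wedge (cotangent T C y) (map (dX y) (fs' i)) A)"
    by (rule form_localE[OF assms(2) x])
  let ?f0 = "\<lambda>i. if i < N then (\<lambda>y. a * f0 i y) else (\<lambda>y. b * f0' (i - N) y)"
  let ?fs = "\<lambda>i. if i < N then fs i else fs' (i - N)"
  show "\<exists>U (N::nat) f0 fs. openin T U \<and> x \<in> U \<and>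
        (\<forall>i<N. f0 i \<in> C \<and> length (fs i) = k \<and> set (fs i) \<subseteq> C) \<and>
        (\<forall>y\<in>U. (\<lambda>A. a * \<alpha> y A + b * \<beta> y A) =
          (\<lambda>A. \<Sum>i<N. f0 i y * wedge (cotangent T C y) (map (dX y) (fs i)) A))"
  proof (rule exI[of _ "U \<inter> U'"], rule exI[of _ "N + N'"], rule exI[of _ ?f0], rule exI[of _ ?fs], intro conjI)
    show "\<forall>i<N + N'. ?f0 i \<in> C \<and> length (?fs i) = k \<and> set (?fs i) \<subseteq> C"
      using 1(3) 2(3) germ_algebra.C_scale[OF germ_X[OF x]] by auto
    show "\<forall>y\<in>U \<inter> U'. (\<lambda>A. a * \<alpha> y A + b * \<beta> y A) =
          (\<lambda>A. \<Sum>i<N + N'. ?f0 i y * wedge (cotangent T C y) (map (dX y) (?fs i)) A)"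
      using 1(4) 2(4) by (simp add: sum_lessThan_add sum_distrib_left mult.assoc)
  qed (use 1 2 in auto)
qed

lemma forms_zero: "(\<lambda>_ _. 0) \<in> forms T C k"
proof (rule formsI)
  fix x assume "x \<in> topspace T"
  then show "\<exists>U (N::nat) f0 fs. openin T U \<and> x \<in> U \<and>
        (\<forall>i<N. f0 i \<in> C \<and> length (fs i) = k \<and> set (fs i) \<subseteq> C) \<and>
        (\<forall>y\<in>U. (\<lambda>_. 0) = (\<lambda>A. \<Sum>i<N. f0 i y * wedge (cotangent T C y) (map (dX y) (fs i)) A))"
    by (intro exI[of _ "topspace T"] exI[of _ "0::nat"]) auto
qed simp

lemma forms_sum: "finite I \<Longrightarrow> (\<And>i. i \<in> I \<Longrightarrow> \<alpha> i \<in> forms T C k) \<Longrightarrow> (\<lambda>y A. \<Sum>i\<in>I. \<alpha> i y A) \<in> forms T C k"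
proof (induction I rule: finite_induct)
  case (insert i I)
  then show ?case using forms_comb[of "\<alpha> i" k "\<lambda>y A. \<Sum>i\<in>I. \<alpha> i y A" 1 1] by simp
qed (simp add: forms_zero)

definition mono_form :: "('a \<Rightarrow> real) \<Rightarrow> ('a \<Rightarrow> real) list \<Rightarrow> 'a form" where
  "mono_form f0 fs y A = (if y \<in> topspace T then f0 y * wedge (cotangent T C y) (map (dX y) fs) A else 0)"

lemma mono_form: "f0 \<in> C \<Longrightarrow> length fs = k \<Longrightarrow> set fs \<subseteq> C \<Longrightarrow> mono_form f0 fs \<in> forms T C k"
proof (rule formsI)
  fix x assume *: "x \<in> topspace T" "f0 \<in> C" "length fs = k" "set fs \<subseteq> C"
  show "\<exists>U (N::nat) f0' fs'. openin T U \<and> x \<in> U \<and>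
        (\<forall>i<N. f0' i \<in> C \<and> length (fs' i) = k \<and> set (fs' i) \<subseteq> C) \<and>
        (\<forall>y\<in>U. mono_form f0 fs y = (\<lambda>A. \<Sum>i<N. f0' i y * wedge (cotangent T C y) (map (dX y) (fs' i)) A))"
  proof (rule exI[of _ "topspace T"], rule exI[of _ 1], rule exI[of _ "\<lambda>_. f0"], rule exI[of _ "\<lambda>_. fs"], intro conjI)
    show "\<forall>y\<in>topspace T. mono_form f0 fs y =
        (\<lambda>A. \<Sum>i<(1::nat). f0 y * wedge (cotangent T C y) (map (dX y) fs) A)"
      by (intro ballI ext) (simp add: mono_form_def)
  qed (use * in simp_all)
next
  show "mono_form f0 fs y = (\<lambda>_. 0)" if "y \<notin> topspace T" for y
    by (rule ext) (simp add: mono_form_def that)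
qed

lemma forms_mult:
  assumes \<alpha>: "\<alpha> \<in> forms T C k"
    and c: "\<And>x. x \<in> topspace T \<Longrightarrow> \<exists>N. openin T N \<and> x \<in> N \<and> (\<forall>y\<in>N. c y = c x)"
  shows "(\<lambda>y A. c y * \<alpha> y A) \<in> forms T C k"
proof (rule forms_local)
  show "(\<lambda>A. c y * \<alpha> y A) = (\<lambda>_. 0)" if "y \<notin> topspace T" for y
    using form_off[OF \<alpha> that] by simp
  fix x assume x: "x \<in> topspace T"
  then obtain N where N: "openin T N" "x \<in> N" "\<forall>y\<in>N. c y = c x" using c by blast
  have "(\<lambda>y A. c x * \<alpha> y A) \<in> forms T C k" using forms_comb[OF \<alpha> \<alpha>, of "c x" 0] by simp
  moreover have "\<forall>y\<in>N. (\<lambda>A. c y * \<alpha> y A) = (\<lambda>y A. c x * \<alpha> y A) y" using N(3) by simp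
  ultimately show "\<exists>U \<beta>. openin T U \<and> x \<in> U \<and> \<beta> \<in> forms T C k \<and> (\<forall>y\<in>U. (\<lambda>A. c y * \<alpha> y A) = \<beta> y)"
    using N(1,2) by (intro exI conjI)
qed

lemma Lef_off: "y \<notin> topspace T \<Longrightarrow> Lef X C wt k \<alpha> y = (\<lambda>_. 0)"
  using weak form_off[of wt 2 y] by (auto simp: Lef_def wedge_product_def weakly_symplectic_def)

lemma Lef_dual_off: "\<alpha> \<in> forms T C k \<Longrightarrow> y \<notin> topspace T \<Longrightarrow> Lef_dual X C g k \<alpha> y = (\<lambda>_. 0)"
  using form_off[of \<alpha> k y] by (auto simp: Lef_dual_def contraction_def)

lemma Lef_in:
  assumes \<alpha>: "\<alpha> \<in> forms T C k" shows "Lef X C wt k \<alpha> \<in> forms T C (k + 2)"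
proof (rule forms_local[OF Lef_off])
  fix x assume x: "x \<in> topspace T"
  obtain W P a u v where e: "expansion W P a u v" "x \<in> W" using expansion_exists[OF x] .
  then have W: "openin T W" and auv: "\<And>p. p < P \<Longrightarrow> a p \<in> C \<and> u p \<in> C \<and> v p \<in> C" by (auto simp: expansion_def)
  obtain U N f0 fs where U: "openin T U" "x \<in> U"
    and fs: "\<forall>i<(N::nat). f0 i \<in> C \<and> length (fs i) = k \<and> set (fs i) \<subseteq> C"
    and \<alpha>U: "\<forall>y\<in>U. \<alpha> y = (\<lambda>A. \<Sum>i<N. f0 i y * wedge (cotangent T C y) (map (dX y) (fs i)) A)"
    by (rule form_localE[OF \<alpha> x])
  let ?\<beta> = "\<lambda>y A. \<Sum>i<N. \<Sum>p<P. mono_form (\<lambda>y. f0 i y * a p y) (u p # v p # fs i) y A"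
  have "?\<beta> \<in> forms T C (k + 2)"
    using fs auv algebra_C(1) by (intro forms_sum mono_form) (auto simp: real_subalgebra_def)
  moreover have "Lef X C wt k \<alpha> y = ?\<beta> y" if y: "y \<in> U \<inter> W" for y
  proof -
    have yT: "y \<in> topspace T" using y W openin_subset by blast
    obtain m where "symplectic_point (cotangent T C y) (wt y) (g y) P m (\<lambda>p. a p y) (\<lambda>p. dX y (u p)) (\<lambda>p. dX y (v p))"
      using symplectic_point_at[OF e(1), of y] y by blast
    then interpret symplectic_point "cotangent T C y" "wt y" "g y" P m "\<lambda>p. a p y" "\<lambda>p. dX y (u p)" "\<lambda>p. dX y (v p)"
      "bivector_eval (g y)" by simp
    have 1: "\<forall>i<N. length (map (dX y) (fs i)) = k \<and> set (map (dX y) (fs i)) \<subseteq> vcarrier (cotangent T C y)"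
      using fs by (auto simp: cotangent_def)
    have "\<alpha> y = (\<lambda>A. \<Sum>i<N. f0 i y * wedge (cotangent T C y) (map (dX y) (fs i)) A)" using \<alpha>U y by blast
    then show ?thesis using yT by (simp add: Lef_def wedge_product_sum[OF 1] mono_form_def)
  qed
  moreover have "openin T (U \<inter> W)" "x \<in> U \<inter> W" using U W e(2) by auto
  ultimately show "\<exists>U \<beta>. openin T U \<and> x \<in> U \<and> \<beta> \<in> forms T C (k + 2) \<and> (\<forall>y\<in>U. Lef X C wt k \<alpha> y = \<beta> y)"
    by (intro exI conjI ballI)
qed

text \<open>Contracting a product of differentials df_i produces the brackets {f_i, f_j} as new
  coefficients, and these belong to C because the bracket maps C to itself.\<close>

lemma Lef_dual_in:
  assumes \<alpha>: "\<alpha> \<in> forms T C k" shows "Lef_dual X C g k \<alpha> \<in> forms T C (k - 2)"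
proof (cases "2 \<le> k")
  case False
  then have "Lef_dual X C g k \<alpha> = (\<lambda>_ _. 0)" by (simp add: Lef_dual_def contraction_def fun_eq_iff)
  then show ?thesis by (simp add: forms_zero)
next
  case k: True
  show ?thesis
  proof (rule forms_local[OF Lef_dual_off[OF \<alpha>]])
    fix x assume x: "x \<in> topspace T"
    obtain W P a u v where e: "expansion W P a u v" "x \<in> W" using expansion_exists[OF x] .
    then have W: "openin T W" by (auto simp: expansion_def)
    obtain U N f0 fs where U: "openin T U" "x \<in> U"
      and fs: "\<forall>i<(N::nat). f0 i \<in> C \<and> length (fs i) = k \<and> set (fs i) \<subseteq> C"
      and \<alpha>U: "\<forall>y\<in>U. \<alpha> y = (\<lambda>A. \<Sum>i<N. f0 i y * wedge (cotangent T C y) (map (dX y) (fs i)) A)"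
      by (rule form_localE[OF \<alpha> x])
    have nth: "fs q ! i \<in> C" if "q < N" "i < k" for q i using fs that by (metis nth_mem subsetD)
    have del: "length (delete2 i j (fs q)) = k - 2 \<and> set (delete2 i j (fs q)) \<subseteq> C"
      if "q < N" "i < j" "j < k" for q i j
      using fs that set_nths_subset[of "fs q"] delete2_length[of i j "fs q"]
      unfolding delete2_def by (metis subset_trans)
    have mapdel: "map f (delete2 i j xs) = delete2 i j (map f xs)" for f :: "('a \<Rightarrow> real) \<Rightarrow> 'a covector" and i j xs
      by (simp add: delete2_def nths_map)
    let ?\<beta> = "\<lambda>y A. \<Sum>q<N. \<Sum>j<k. \<Sum>i<j.
      mono_form (\<lambda>y. (-1) ^ (i + j + 1) * (f0 q y * br (fs q ! i) (fs q ! j) y)) (delete2 i j (fs q)) y A"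
    have "?\<beta> \<in> forms T C (k - 2)"
    proof (intro forms_sum mono_form finite_lessThan)
      fix q j i assume qji: "q \<in> {..<N}" "j \<in> {..<k}" "i \<in> {..<j}"
      then have "f0 q \<in> C" "br (fs q ! i) (fs q ! j) \<in> C" using fs br_in nth by auto
      then show "(\<lambda>y. (-1) ^ (i + j + 1) * (f0 q y * br (fs q ! i) (fs q ! j) y)) \<in> C"
        by (intro germ_algebra.C_scale[OF germ_X[OF x]] germ_algebra.C_mult[OF germ_X[OF x]])
    qed (use del in auto)
    moreover have "Lef_dual X C g k \<alpha> y = ?\<beta> y" if y: "y \<in> U \<inter> W" for y
    proof -
      have yT: "y \<in> topspace T" using y W openin_subset by blast
      obtain m where "symplectic_point (cotangent T C y) (wt y) (g y) P m (\<lambda>p. a p y) (\<lambda>p. dX y (u p)) (\<lambda>p. dX y (v p))"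
        using symplectic_point_at[OF e(1), of y] y by blast
      then interpret symplectic_point "cotangent T C y" "wt y" "g y" P m "\<lambda>p. a p y" "\<lambda>p. dX y (u p)" "\<lambda>p. dX y (v p)"
        "bivector_eval (g y)" by simp
      have 1: "\<forall>i<N. length (map (dX y) (fs i)) = k \<and> set (map (dX y) (fs i)) \<subseteq> vcarrier (cotangent T C y)"
        using fs by (auto simp: cotangent_def)
      have "\<alpha> y = (\<lambda>A. \<Sum>i<N. f0 i y * wedge (cotangent T C y) (map (dX y) (fs i)) A)" using \<alpha>U y by blast
      then have "Lef_dual X C g k \<alpha> y = (\<lambda>A. \<Sum>q<N. \<Sum>j<k. \<Sum>i<j.
          (f0 q y * (-1) ^ (i + j + 1) * bivector_eval (g y) (map (dX y) (fs q) ! i) (map (dX y) (fs q) ! j))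
            * wedge (cotangent T C y) (delete2 i j (map (dX y) (fs q))) A)"
        by (simp add: Lef_dual_def contraction_sum[OF 1 k])
      also have "\<dots> = ?\<beta> y"
        using fs nth yT
        by (auto simp: mono_form_def mapdel G_eq fun_eq_iff algebra_simps intro!: sum.cong)
      finally show ?thesis .
    qed
    moreover have "openin T (U \<inter> W)" "x \<in> U \<inter> W" using U W e(2) by auto
    ultimately show "\<exists>U \<beta>. openin T U \<and> x \<in> U \<and> \<beta> \<in> forms T C (k - 2) \<and> (\<forall>y\<in>U. Lef_dual X C g k \<alpha> y = \<beta> y)"
      by (intro exI conjI ballI)
  qed
qed

section \<open>Powers of the operators, pointwise and on forms\<close>

abbreviation LP where "LP \<equiv> Lef_pow X C wt"

primrec DP :: "nat \<Rightarrow> nat \<Rightarrow> 'a form \<Rightarrow> 'a form" where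
  "DP k 0 \<alpha> = \<alpha>"
| "DP k (Suc r) \<alpha> = Lef_dual X C g (k - 2 * r) (DP k r \<alpha>)"

lemma LP_in: "\<alpha> \<in> forms T C k \<Longrightarrow> LP k r \<alpha> \<in> forms T C (k + 2 * r)"
proof (induction r)
  case (Suc r)
  then show ?case using Lef_in[of "LP k r \<alpha>" "k + 2 * r"] by simp
qed simp

lemma DP_in: "\<alpha> \<in> forms T C k \<Longrightarrow> DP k r \<alpha> \<in> forms T C (k - 2 * r)"
proof (induction r)
  case (Suc r)
  then show ?case using Lef_dual_in[of "DP k r \<alpha>" "k - 2 * r"] by simp
qed simp

text \<open>Passes from forms to the module at one point. The parameter m of that module may vary
  with y, so the two sides are related point by point.\<close>

lemma LP_eq: "LP k r \<alpha> y = lefschetz_module.Lp (\<lambda>k. wedge_product (cotangent T C y) 2 k (wt y)) k r (\<alpha> y)"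
  if "lefschetz_module M (\<lambda>k. wedge_product (cotangent T C y) 2 k (wt y)) D m"
  by (induction r) (simp_all add: Lef_def lefschetz_module.Lp.simps[OF that])

lemma DP_eq: "DP k r \<alpha> y = lefschetz_module.Dp (\<lambda>k. contraction (cotangent T C y) k (g y)) k r (\<alpha> y)"
  if "lefschetz_module M L (\<lambda>k. contraction (cotangent T C y) k (g y)) m"
  by (induction r) (simp_all add: Lef_dual_def lefschetz_module.Dp.simps[OF that])

lemma module_at:
  assumes "x \<in> topspace T"
  obtains m where "pairing x = - real m" "lefschetz_module (ext_power (cotangent T C x))
    (\<lambda>k. wedge_product (cotangent T C x) 2 k (wt x)) (\<lambda>k. contraction (cotangent T C x) k (g x)) m"
proof -
  obtain W P a u v where e: "expansion W P a u v" "x \<in> W" using expansion_exists[OF assms] .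
  obtain m where m: "pairing x = - real m"
    "symplectic_point (cotangent T C x) (wt x) (g x) P m (\<lambda>p. a p x) (\<lambda>p. dX x (u p)) (\<lambda>p. dX x (v p))"
    by (rule symplectic_point_at[OF e])
  interpret symplectic_point "cotangent T C x" "wt x" "g x" P m "\<lambda>p. a p x" "\<lambda>p. dX x (u p)" "\<lambda>p. dX x (v p)"
    "bivector_eval (g x)" using m(2) by simp
  show ?thesis by (rule that[OF m(1)]) (rule lefschetz_module_axioms)
qed

lemma Lef_dual_comb:
  "Lef_dual X C g k (\<lambda>y A. a y * \<alpha> y A + b y * \<beta> y A) =
    (\<lambda>y A. a y * Lef_dual X C g k \<alpha> y A + b y * Lef_dual X C g k \<beta> y A)"
  by (simp add: Lef_dual_def contraction_def fun_eq_iff)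

lemma LP_comb:
  assumes "\<alpha> \<in> forms T C k" "\<beta> \<in> forms T C k"
  shows "LP k r (\<lambda>y A. a * \<alpha> y A + b * \<beta> y A) = (\<lambda>y A. a * LP k r \<alpha> y A + b * LP k r \<beta> y A)"
proof
  fix y
  show "LP k r (\<lambda>y A. a * \<alpha> y A + b * \<beta> y A) y = (\<lambda>A. a * LP k r \<alpha> y A + b * LP k r \<beta> y A)"
  proof (cases "y \<in> topspace T")
    case True
    then obtain m where "lefschetz_module (ext_power (cotangent T C y))
      (\<lambda>k. wedge_product (cotangent T C y) 2 k (wt y)) (\<lambda>k. contraction (cotangent T C y) k (g y)) m"
      by (rule module_at)
    then interpret m: lefschetz_module "ext_power (cotangent T C y)"
      "\<lambda>k. wedge_product (cotangent T C y) 2 k (wt y)" "\<lambda>k. contraction (cotangent T C y) k (g y)" m .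
    show ?thesis unfolding LP_eq[OF m.lefschetz_module_axioms]
      by (rule m.Lp_lin[OF form_at[OF assms(1) True] form_at[OF assms(2) True]])
  next
    case False
    then show ?thesis
      using form_off[OF LP_in[OF assms(1)] False] form_off[OF LP_in[OF assms(2)] False]
        form_off[OF LP_in[OF forms_comb[OF assms]] False] by simp
  qed
qed

lemma LP_zero: "LP k r (\<lambda>_ _. 0) = (\<lambda>_ _. 0)"
  using LP_comb[OF forms_zero forms_zero, of k r 0 0] by simp

text \<open>This is \<open>dl_coeff\<close> with \<open>pairing y\<close> in place of -m, so that it
  is visibly a locally constant function of the point.\<close>

definition top_coeff :: "nat \<Rightarrow> nat \<Rightarrow> 'a \<Rightarrow> real" where
  "top_coeff t j y = (\<Prod>s<t. (real s + 1) * (real j + pairing y + real s))"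

lemma prim_subspace:
  assumes "\<alpha> \<in> primitive_forms X C g k" "\<beta> \<in> primitive_forms X C g k"
  shows "(\<lambda>y A. a * \<alpha> y A + b * \<beta> y A) \<in> primitive_forms X C g k"
  using assms Lef_dual_comb[of k "\<lambda>_. a" \<alpha> "\<lambda>_. b" \<beta>] forms_comb by (simp add: primitive_forms_def)

lemma zero_primitive: "(\<lambda>_ _. 0) \<in> primitive_forms X C g k"
  using Lef_dual_comb[of k "\<lambda>_. 0" "\<lambda>_ _. 0" "\<lambda>_. 0" "\<lambda>_ _. 0"] forms_zero by (simp add: primitive_forms_def)

text \<open>\<open>peel_top\<close> carried out at all points simultaneously. The component that is
  split off is D^t \<alpha> divided by a locally constant function, hence a smooth form; where that
  function is zero the quotient is zero by convention, as in \<open>peel_top\<close>.\<close>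

lemma decomposition_exists:
  assumes "\<alpha> \<in> forms T C k" "2 * t \<le> k" "DP k (Suc t) \<alpha> = (\<lambda>_ _. 0)"
  shows "\<exists>\<beta>. (\<forall>r\<le>t. \<beta> r \<in> primitive_forms X C g (k - 2 * r)) \<and>
    \<alpha> = (\<lambda>y A. \<Sum>r\<le>t. LP (k - 2 * r) r (\<beta> r) y A)"
  using assms
proof (induction t arbitrary: \<alpha>)
  case 0
  then show ?case by (intro exI[of _ "\<lambda>_. \<alpha>"]) (simp add: primitive_forms_def)
next
  case (Suc t)
  let ?t = "Suc t"
  let ?j = "k - 2 * ?t"
  define \<gamma> where "\<gamma> = DP k ?t \<alpha>"
  define c where "c = (\<lambda>y. 1 / top_coeff ?t ?j y)"
  have \<gamma>: "\<gamma> \<in> forms T C ?j" unfolding \<gamma>_def by (rule DP_in[OF Suc.prems(1)])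
  have D\<gamma>: "Lef_dual X C g ?j \<gamma> = (\<lambda>_ _. 0)" using Suc.prems(3) by (simp add: \<gamma>_def)
  define \<beta>' where "\<beta>' = (\<lambda>y A. c y * \<gamma> y A)"
  have "\<exists>N. openin T N \<and> x \<in> N \<and> (\<forall>y\<in>N. c y = c x)" if x: "x \<in> topspace T" for x
  proof -
    obtain N where N: "openin T N" "x \<in> N" "\<And>y. y \<in> N \<Longrightarrow> pairing y = pairing x"
      by (rule pairing_locally_constant[OF x]) (rule that)
    have "\<forall>y\<in>N. c y = c x" using N(3) by (simp add: c_def top_coeff_def)
    with N(1,2) show ?thesis by (intro exI conjI)
  qed
  then have \<beta>': "\<beta>' \<in> forms T C ?j" unfolding \<beta>'_def by (rule forms_mult[OF \<gamma>])
  have \<beta>'_prim: "\<beta>' \<in> primitive_forms X C g ?j"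
    using \<beta>' Lef_dual_comb[of ?j c \<gamma> "\<lambda>_. 0" "\<lambda>_ _. 0"] D\<gamma> by (simp add: primitive_forms_def \<beta>'_def)
  define \<alpha>' where "\<alpha>' = (\<lambda>y A. \<alpha> y A - LP ?j ?t \<beta>' y A)"
  have L\<beta>': "LP ?j ?t \<beta>' \<in> forms T C k" 
    using LP_in[OF \<beta>', of ?t] unfolding le_add_diff_inverse2[OF Suc.prems(2)] .
  have \<alpha>': "\<alpha>' \<in> forms T C k" using forms_comb[OF Suc.prems(1) L\<beta>', of 1 "-1"] by (simp add: \<alpha>'_def)
  have "DP k ?t \<alpha>' = (\<lambda>_ _. 0)"
  proof
    fix y
    show "DP k ?t \<alpha>' y = (\<lambda>_. 0)"
    proof (cases "y \<in> topspace T")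
      case True
      obtain m where m: "pairing y = - real m" "lefschetz_module (ext_power (cotangent T C y))
        (\<lambda>k. wedge_product (cotangent T C y) 2 k (wt y)) (\<lambda>k. contraction (cotangent T C y) k (g y)) m"
        by (rule module_at[OF True])
      interpret m: lefschetz_module "ext_power (cotangent T C y)"
        "\<lambda>k. wedge_product (cotangent T C y) 2 k (wt y)" "\<lambda>k. contraction (cotangent T C y) k (g y)" m
        by (rule m(2))
      note DPm = DP_eq[OF m.lefschetz_module_axioms] and LPm = LP_eq[OF m.lefschetz_module_axioms]
      have "top_coeff ?t ?j y = m.dl_coeff ?t ?j" by (simp add: top_coeff_def m.dl_coeff_def m(1))
      then have b: "\<beta>' y = (\<lambda>A. m.Dp k ?t (\<alpha> y) A / m.dl_coeff ?t ?j)"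
        unfolding \<beta>'_def \<gamma>_def c_def DPm by simp
      have z: "m.Dp k (Suc ?t) (\<alpha> y) = (\<lambda>_. 0)" using Suc.prems(3) DPm[of k "Suc ?t" \<alpha>] by simp
      have "\<alpha>' y = (\<lambda>A. \<alpha> y A - m.Lp ?j ?t (\<beta>' y) A)" by (simp add: \<alpha>'_def LPm del: Lef_pow.simps m.Lp.simps)
      then show ?thesis
        unfolding DPm b using m.peel_top[OF form_at[OF Suc.prems(1) True] Suc.prems(2) z] by simp
    next
      case False
      then show ?thesis by (rule form_off[OF DP_in[OF \<alpha>']])
    qed
  qed
  then obtain \<beta> where \<beta>: "\<forall>r\<le>t. \<beta> r \<in> primitive_forms X C g (k - 2 * r)"
    "\<alpha>' = (\<lambda>y A. \<Sum>r\<le>t. LP (k - 2 * r) r (\<beta> r) y A)"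
    using Suc.IH[OF \<alpha>'] Suc.prems(2) by auto
  have "\<alpha> y A = (\<Sum>r\<le>?t. LP (k - 2 * r) r ((\<beta>(?t := \<beta>')) r) y A)" for y A
  proof -
    have "(\<Sum>r\<le>?t. LP (k - 2 * r) r ((\<beta>(?t := \<beta>')) r) y A) =
        (\<Sum>r\<le>t. LP (k - 2 * r) r ((\<beta>(?t := \<beta>')) r) y A) + LP ?j ?t \<beta>' y A"
      by (simp del: Lef_pow.simps)
    also have "(\<Sum>r\<le>t. LP (k - 2 * r) r ((\<beta>(?t := \<beta>')) r) y A) = \<alpha>' y A"
      unfolding \<beta>(2) by (intro sum.cong) auto
    finally show ?thesis by (simp add: \<alpha>'_def)
  qed
  moreover have "\<forall>r\<le>?t. (\<beta>(?t := \<beta>')) r \<in> primitive_forms X C g (k - 2 * r)"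
    using \<beta>(1) \<beta>'_prim by (auto simp: le_Suc_eq)
  ultimately show ?case by (intro exI[of _ "\<beta>(?t := \<beta>')"]) blast
qed

text \<open>At each point of the space this is \<open>direct_sum\<close>; off the space all forms
  vanish by convention.\<close>

lemma decomposition_unique:
  assumes \<beta>: "\<And>r. r \<le> t \<Longrightarrow> \<beta> r \<in> primitive_forms X C g (k - 2 * r)" and t: "2 * t \<le> k"
    and sum: "(\<lambda>y A. \<Sum>r\<le>t. LP (k - 2 * r) r (\<beta> r) y A) = (\<lambda>_ _. 0)" and r: "r \<le> t"
  shows "LP (k - 2 * r) r (\<beta> r) = (\<lambda>_ _. 0)"
proof
  fix y
  have f: "\<beta> r \<in> forms T C (k - 2 * r)" "Lef_dual X C g (k - 2 * r) (\<beta> r) = (\<lambda>_ _. 0)" if "r \<le> t" for r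
    using \<beta>[OF that] by (auto simp: primitive_forms_def)
  show "LP (k - 2 * r) r (\<beta> r) y = (\<lambda>_. 0)"
  proof (cases "y \<in> topspace T")
    case True
    then obtain m where "lefschetz_module (ext_power (cotangent T C y))
      (\<lambda>k. wedge_product (cotangent T C y) 2 k (wt y)) (\<lambda>k. contraction (cotangent T C y) k (g y)) m"
      by (rule module_at)
    then interpret m: lefschetz_module "ext_power (cotangent T C y)"
      "\<lambda>k. wedge_product (cotangent T C y) 2 k (wt y)" "\<lambda>k. contraction (cotangent T C y) k (g y)" m .
    note LPm = LP_eq[OF m.lefschetz_module_axioms]
    show ?thesis unfolding LPm
    proof (rule m.direct_sum[OF t _ _ _ r])
      show "\<beta> r y \<in> ext_power (cotangent T C y) (k - 2 * r)" if "r \<le> t" for r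
        by (rule form_at[OF f(1)[OF that] True])
      show "contraction (cotangent T C y) (k - 2 * r) (g y) (\<beta> r y) = (\<lambda>_. 0)" if "r \<le> t" for r
        using fun_cong[OF f(2)[OF that], of y] by (simp add: Lef_dual_def)
      show "(\<lambda>A. \<Sum>r\<le>t. m.Lp (k - 2 * r) r (\<beta> r y) A) = (\<lambda>_. 0)"
        using fun_cong[OF sum, of y] by (simp add: LPm)
    qed
  next
    case False
    then show ?thesis by (rule form_off[OF LP_in[OF f(1)[OF r]]])
  qed
qed

lemma lefschetz_decomposition:
  "internal_direct_sum (forms T C k) {r. 2 * r \<le> k} (\<lambda>r. LP (k - 2 * r) r ` primitive_forms X C g (k - 2 * r))"
  unfolding internal_direct_sum_def
proof (intro conjI ballI)
  let ?t = "k div 2"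
  let ?M = "\<lambda>r. LP (k - 2 * r) r ` primitive_forms X C g (k - 2 * r)"
  have I: "{r. 2 * r \<le> k} = {..?t}" by auto
  show "form_subspace (forms T C k)" by (simp add: form_subspace_def forms_zero forms_comb)
  have prim: "\<alpha> \<in> forms T C j" if "\<alpha> \<in> primitive_forms X C g j" for \<alpha> j
    using that by (simp add: primitive_forms_def)
  show "form_subspace (?M r)" for r
    unfolding form_subspace_def
  proof (intro conjI ballI allI)
    show "(\<lambda>_ _. 0) \<in> ?M r" using zero_primitive LP_zero by (metis imageI)
    fix \<alpha> \<beta> a b assume "\<alpha> \<in> ?M r" "\<beta> \<in> ?M r"
    then obtain \<alpha>' \<beta>' where *: "\<alpha>' \<in> primitive_forms X C g (k - 2 * r)" "\<beta>' \<in> primitive_forms X C g (k - 2 * r)"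
      "\<alpha> = LP (k - 2 * r) r \<alpha>'" "\<beta> = LP (k - 2 * r) r \<beta>'" by blast
    have "(\<lambda>y A. a * \<alpha> y A + b * \<beta> y A) = LP (k - 2 * r) r (\<lambda>y A. a * \<alpha>' y A + b * \<beta>' y A)"
      unfolding *(3,4) by (rule LP_comb[symmetric]) (use * prim in auto)
    then show "(\<lambda>y A. a * \<alpha> y A + b * \<beta> y A) \<in> ?M r" using prim_subspace[OF *(1,2)] by blast
  qed
  show "?M r \<subseteq> forms T C k" if "r \<in> {r. 2 * r \<le> k}" for r
  proof
    fix \<alpha> assume "\<alpha> \<in> ?M r"
    then obtain \<beta> where "\<beta> \<in> primitive_forms X C g (k - 2 * r)" "\<alpha> = LP (k - 2 * r) r \<beta>" by blast
    then show "\<alpha> \<in> forms T C k" using LP_in[OF prim, of \<beta> "k - 2 * r" r] that by simp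
  qed
  fix \<alpha> assume \<alpha>: "\<alpha> \<in> forms T C k"
  \<comment> \<open>The induction starts here: t + 1 contractions exceed the degree because 2(t + 1)
    > k.\<close>
  have "DP k (Suc ?t) \<alpha> = (\<lambda>_ _. 0)"
  proof
    fix y
    show "DP k (Suc ?t) \<alpha> y = (\<lambda>_. 0)"
    proof (cases "y \<in> topspace T")
      case True
      then obtain m where "lefschetz_module (ext_power (cotangent T C y))
        (\<lambda>k. wedge_product (cotangent T C y) 2 k (wt y)) (\<lambda>k. contraction (cotangent T C y) k (g y)) m"
        by (rule module_at)
      then interpret m: lefschetz_module "ext_power (cotangent T C y)"
        "\<lambda>k. wedge_product (cotangent T C y) 2 k (wt y)" "\<lambda>k. contraction (cotangent T C y) k (g y)" m .
      show ?thesis unfolding DP_eq[OF m.lefschetz_module_axioms]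
        by (rule m.Dp_high[OF form_at[OF \<alpha> True]]) simp
    next
      case False
      then show ?thesis by (rule form_off[OF DP_in[OF \<alpha>]])
    qed
  qed
  then obtain b where b: "\<forall>r\<le>?t. b r \<in> primitive_forms X C g (k - 2 * r)"
    "\<alpha> = (\<lambda>y A. \<Sum>r\<le>?t. LP (k - 2 * r) r (b r) y A)"
    using decomposition_exists[OF \<alpha>, of ?t] by auto
  show "\<exists>!\<beta>. \<beta> \<in> (\<Pi>\<^sub>E r\<in>{r. 2 * r \<le> k}. ?M r) \<and> \<alpha> = (\<lambda>y A. \<Sum>r\<in>{r. 2 * r \<le> k}. \<beta> r y A)"
    unfolding I
  proof (rule ex1I[of _ "restrict (\<lambda>r. LP (k - 2 * r) r (b r)) {..?t}"])
    show "restrict (\<lambda>r. LP (k - 2 * r) r (b r)) {..?t} \<in> (\<Pi>\<^sub>E r\<in>{..?t}. ?M r) \<and>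
      \<alpha> = (\<lambda>y A. \<Sum>r\<le>?t. restrict (\<lambda>r. LP (k - 2 * r) r (b r)) {..?t} r y A)"
      using b(1) by (subst b(2)) auto
    fix \<beta> assume \<beta>: "\<beta> \<in> (\<Pi>\<^sub>E r\<in>{..?t}. ?M r) \<and> \<alpha> = (\<lambda>y A. \<Sum>r\<le>?t. \<beta> r y A)"
    then have "\<forall>r\<in>{..?t}. \<exists>c. c \<in> primitive_forms X C g (k - 2 * r) \<and> \<beta> r = LP (k - 2 * r) r c"
      by (auto simp: PiE_iff)
    then obtain c where c: "\<And>r. r \<le> ?t \<Longrightarrow> c r \<in> primitive_forms X C g (k - 2 * r)"
      "\<And>r. r \<le> ?t \<Longrightarrow> \<beta> r = LP (k - 2 * r) r (c r)"
      unfolding atMost_iff Ball_def by metis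
    \<comment> \<open>The difference of two choices of primitive forms. Its images under L^r are
      shown to vanish, which is all that is asserted: L^r may kill primitive forms, so the choices
      themselves may differ.\<close>
    let ?d = "\<lambda>r y A. 1 * c r y A + (- 1) * b r y A"
    have d: "?d r \<in> primitive_forms X C g (k - 2 * r)" if "r \<le> ?t" for r
      using prim_subspace[OF c(1)[OF that] b(1)[rule_format, OF that]] .
    have Ld: "LP (k - 2 * r) r (?d r) = (\<lambda>y A. 1 * \<beta> r y A + (- 1) * LP (k - 2 * r) r (b r) y A)" if "r \<le> ?t" for r
      using LP_comb[OF prim[OF c(1)[OF that]] prim[OF b(1)[rule_format, OF that]], of r 1 "- 1"]
      unfolding c(2)[OF that] .
    have "(\<Sum>r\<le>?t. LP (k - 2 * r) r (?d r) y A) = 0" for y A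
    proof -
      have "(\<Sum>r\<le>?t. LP (k - 2 * r) r (?d r) y A) = (\<Sum>r\<le>?t. \<beta> r y A - LP (k - 2 * r) r (b r) y A)"
        by (rule sum.cong[OF refl]) (subst Ld, auto)
      also have "\<dots> = \<alpha> y A - \<alpha> y A"
        unfolding sum_subtractf using \<beta> b(2) by (metis (no_types, lifting))
      finally show ?thesis by simp
    qed
    then have z: "LP (k - 2 * r) r (?d r) = (\<lambda>_ _. 0)" if "r \<le> ?t" for r
      by (intro decomposition_unique[where \<beta> = ?d and t = ?t, OF d _ _ that]) auto
    show "\<beta> = restrict (\<lambda>r. LP (k - 2 * r) r (b r)) {..?t}"
    proof (rule ext)
      fix r
      show "\<beta> r = restrict (\<lambda>r. LP (k - 2 * r) r (b r)) {..?t} r"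
      proof (cases "r \<le> ?t")
        case True
        then show ?thesis using z[OF True] unfolding Ld[OF True] by (auto simp: fun_eq_iff)
      next
        case False
        then show ?thesis using \<beta> by (auto simp: PiE_iff extensional_def)
      qed
    qed
  qed
qed

end

theorem proposition3p20:
  fixes X :: "'a dspace"
    and \<omega> :: "'a mfd \<Rightarrow> 'a form"
    and C :: "('a \<Rightarrow> real) set"
    and wt :: "'a form"
    and br :: "('a \<Rightarrow> real) \<Rightarrow> ('a \<Rightarrow> real) \<Rightarrow> 'a \<Rightarrow> real"
    and g :: "'a \<Rightarrow> ('a covector \<Rightarrow> real) multivector"
    and n k :: nat
  assumes "stratified_symplectic_space X \<omega>"
    and "smooth_structure X C"
    and "poisson_structure X C \<omega> br"
    and "poisson_bivector_field X C br g"
    and "weakly_symplectic X C \<omega> wt"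
    and "\<And>S. regular_stratum X S \<Longrightarrow> dim S = 2 * n"
  shows "internal_direct_sum (forms (dtop X) C k) {r. 2 * r \<le> k}
           (\<lambda>r. Lef_pow X C wt (k - 2 * r) r ` primitive_forms X C g (k - 2 * r))"
proof -
  interpret symplectic_space X C \<omega> wt br g
    using assms(2-5) by unfold_locales
  show ?thesis by (rule lefschetz_decomposition)
qed

end
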